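(* Let $K$ be a nonarchimedean local field with residue field of cardinality $q$ and ring of integers $R$. Suppose $N\geq 2$ and $\beta\in\mathbb{C}$ with $\operatorname{Re}(\beta)>-2/N$, and let $F_0(t,\beta),\dots,F_N(t,\beta)$ be the functions defined by the recurrence given in the context. The $N$th canonical partition functions are given by the formulas $$Z_N(R,\beta)=N!\,q^{\frac{1}{2}\binom{N}{2}\beta}F_N(\log(q),\beta)$$ and $$Z_N(\mathbb{P}^1(K),\beta)=N!\sum_{k=0}^N\frac{\cosh\left(\frac{\log(q)}{2}\left(N+\binom{N}{2}\beta\right)\left(1-\frac{2k}{N}\right)\right)}{\left(2\cosh\left(\frac{\log(q)}{2}\right)\right)^N}\cdot F_{N-k}(\log(q),\beta)\cdot F_k(\log(q),\beta).$$ These formulas extend $Z_N(R,\beta)$ and $Z_N(\mathbb{P}^1(K),\beta)$ to smooth functions of $q\in(0,\infty)$ (i.e. the right-hand sides, with $q$ regarded as a real variable in $(0,\infty)$, are smooth in $q$), and these extensions satisfy $$Z_N(R,\beta)\big|_{q\mapsto q^{-1}}=q^{-\binom{N}{2}\beta}Z_N(R,\beta)\qquad\text{and}\qquad Z_N(\mathbb{P}^1(K),\beta)\big|_{q\mapsto q^{-1}}=Z_N(\mathbb{P}^1(K),\beta)$$ for all $q\in(0,\infty)$, where $|_{q\mapsto q^{-1}}$ denotes the extension evaluated at $q^{-1}$.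
   Context: Field. $K$ is a nonarchimedean local field with canonical absolute value $|\cdot|$, closed unit ball (ring of integers) $R=\{x\in K:|x|\leq 1\}$, open unit ball (maximal ideal) $P=\{x\in K:|x|<1\}$, $q=\#(R/P)$, and $|\cdot|$ is normalized so that $|\pi|=q^{-1}$ for any generator $\pi$ of $P$. $\mu$ is the additive Haar measure on $K$ with $\mu(R)=1$. Projective line. $\mathbb{P}^1(K)$ is the set of classes $[x_0:x_1]$ of nonzero vectors $(x_0,x_1)\in K^2$ modulo scaling by $K^\times$, with the quotient topology. The spherical metric is $$\delta([x_0:x_1],[y_0:y_1])=\frac{|x_0y_1-x_1y_0|}{\max\{|x_0|,|x_1|\}\cdot\max\{|y_0|,|y_1|\}}.$$ The group $PGL_2(R)$ (the quotient of $GL_2(R)$ by its center $R^\times$) acts on $\mathbb{P}^1(K)$: the class of $\left(\begin{smallmatrix}a&b\\c&d\end{smallmatrix}\right)\in GL_2(R)$ sends $[x_0:x_1]$ to $[ax_0+bx_1:cx_0+dx_1]$. $\nu$ is the unique $PGL_2(R)$-invariant Borel probability measure on $\mathbb{P}^1(K)$. Canonical partition functions. For $N\geq 1$ and complex $\beta$ for which the integrals converge absolutely (in particular for $N\ge 2$ and $\operatorname{Re}(\beta)>-2/N$), $$Z_N(R,\beta)=\int_{R^N}\prod_{1\leq i<j\leq N}|x_i-x_j|^{\beta}\,d\mu^N,\qquad Z_N(\mathbb{P}^1(K),\beta)=\int_{(\mathbb{P}^1(K))^N}\prod_{1\leq i<j\leq N}\delta(x_i,x_j)^{\beta}\,d\nu^N,$$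 where $\mu^N,\nu^N$ are product measures. Recurrence. Set $F_0(t,\beta)=F_1(t,\beta)=1$ for all $\beta\in\mathbb{C}$, $t\in\mathbb{R}$. For $n\geq 2$, $\operatorname{Re}(\beta)>-2/n$ and $t\in\mathbb{R}$, define recursively $$F_n(t,\beta)=\sum_{k=1}^{n-1}\frac{k}{n}\cdot\frac{\sinh\left(\frac{t}{2}\left[\left(n+\binom{n}{2}\beta\right)\left(1-\frac{2k}{n}\right)+1\right]\right)}{\sinh\left(\frac{t}{2}\left[\left(n+\binom{n}{2}\beta\right)-1\right]\right)}\,F_{n-k}(t,\beta)\,F_k(t,\beta)\quad\text{if }t\neq 0,$$ $$F_n(0,\beta)=\sum_{k=1}^{n-1}\frac{k}{n}\cdot\frac{\left(n+\binom{n}{2}\beta\right)\left(1-\frac{2k}{n}\right)+1}{\left(n+\binom{n}{2}\beta\right)-1}\,F_{n-k}(0,\beta)\,F_k(0,\beta).$$ For real $q>0$ and complex $z$, $q^z=\exp(z\log q)$ with the real logarithm. *)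

theory Defs
  imports "HOL-Probability.Probability"
begin

section \<open>Nonarchimedean local fields\<close>

class nonarch_valued_field = field + metric_space +
  fixes absv :: "'a \<Rightarrow> real"
  assumes absv_nonneg: "0 \<le> absv x"
    and absv_eq_0_iff: "absv x = 0 \<longleftrightarrow> x = 0"
    and absv_mult: "absv (x * y) = absv x * absv y"
    and absv_add_le_max: "absv (x + y) \<le> max (absv x) (absv y)"
    and dist_eq_absv: "dist x y = absv (x - y)"
begin

definition int_ring :: "'a set" where
  "int_ring = {x. absv x \<le> 1}"

definition max_ideal :: "'a set" where
  "max_ideal = {x. absv x < 1}"

definition residue_card :: "'a itself \<Rightarrow> nat" where
  "residue_card _ =
     card (int_ring // {(x, y). x \<in> int_ring \<and> y \<in> int_ring \<and> x - y \<in> max_ideal})"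

end

text \<open>
  A nonarchimedean local field is a locally compact, nontrivially valued field. The last axiom
  fixes the canonical absolute value within its equivalence class: every generator of the
  maximal ideal has absolute value \<open>1/q\<close>.
\<close>

class nonarch_local_field = nonarch_valued_field +
  assumes absv_nontrivial: "\<exists>x. absv x \<noteq> 0 \<and> absv x \<noteq> 1"
    and locally_compact: "locally_compact_space (topology open)"
    and absv_generator:
      "max_ideal = {p * r | r. r \<in> int_ring} \<Longrightarrow> absv p = 1 / real (residue_card TYPE('a))"

text \<open>
  No regularity condition is needed: \<open>K\<close> is locally compact and second countable, so a Borel
  measure that is finite on compact sets is automatically regular.
\<close>

definition is_normalized_haar :: "'k::nonarch_local_field measure \<Rightarrow> bool" where
  "is_normalized_haar \<mu> \<longleftrightarrow>
     sets \<mu> = sets borel \<and>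
     (\<forall>a. \<forall>A\<in>sets borel. emeasure \<mu> ((\<lambda>x. a + x) ` A) = emeasure \<mu> A) \<and>
     (\<forall>C. compact C \<longrightarrow> emeasure \<mu> C < \<infinity>) \<and>
     emeasure \<mu> int_ring = 1"


section \<open>The projective line\<close>

text \<open>
  The vector \<open>(x\<^sub>0, x\<^sub>1)\<close> is represented by \<open>x :: 'a ^ 2\<close> with \<open>x\<^sub>0 = x $ 1\<close> and \<open>x\<^sub>1 = x $ 2\<close>.
\<close>

definition proj_rel :: "'a::field ^ 2 \<Rightarrow> 'a ^ 2 \<Rightarrow> bool" where
  "proj_rel x y \<longleftrightarrow> x \<noteq> 0 \<and> y \<noteq> 0 \<and> (\<exists>c. c \<noteq> 0 \<and> y = c *s x)"

lemma part_equivp_proj_rel: "part_equivp (proj_rel :: 'a::field ^ 2 \<Rightarrow> 'a ^ 2 \<Rightarrow> bool)"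
proof (rule part_equivpI)
  have "proj_rel (1 :: 'a ^ 2) 1"
    unfolding proj_rel_def by (auto intro!: exI[of _ "1::'a"] simp: vec_eq_iff)
  then show "\<exists>x :: 'a ^ 2. proj_rel x x" by blast
  show "symp (proj_rel :: 'a ^ 2 \<Rightarrow> 'a ^ 2 \<Rightarrow> bool)"
  proof (rule sympI)
    fix x y :: "'a ^ 2"
    assume "proj_rel x y"
    then obtain c where c: "x \<noteq> 0" "y \<noteq> 0" "c \<noteq> 0" "y = c *s x"
      unfolding proj_rel_def by blast
    then have "x = inverse c *s y" by (simp add: vec_eq_iff)
    with c show "proj_rel y x"
      unfolding proj_rel_def by (metis inverse_nonzero_iff_nonzero)
  qed
  show "transp (proj_rel :: 'a ^ 2 \<Rightarrow> 'a ^ 2 \<Rightarrow> bool)"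
  proof (rule transpI)
    fix x y z :: "'a ^ 2"
    assume "proj_rel x y" "proj_rel y z"
    then obtain c d where c: "x \<noteq> 0" "z \<noteq> 0" "c \<noteq> 0" "y = c *s x" "d \<noteq> 0" "z = d *s y"
      unfolding proj_rel_def by blast
    then have "z = (d * c) *s x" by (simp add: vec_eq_iff)
    with c show "proj_rel x z"
      unfolding proj_rel_def by (metis mult_eq_0_iff)
  qed
qed

quotient_type (overloaded) 'a proj_line = "'a::field ^ 2" / partial: proj_rel
  by (rule part_equivp_proj_rel)

text \<open>The quotient topology from the nonzero vectors; \<open>abs_proj_line x\<close> is the class of \<open>x\<close>.\<close>

instantiation proj_line :: ("{field,topological_space}") topological_space
begin

definition open_proj_line :: "'a proj_line set \<Rightarrow> bool" where
  "open_proj_line U \<longleftrightarrow>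
     openin (top_of_set {x :: 'a ^ 2. x \<noteq> 0}) {x. x \<noteq> 0 \<and> abs_proj_line x \<in> U}"

instance
proof
  show "open (UNIV :: 'a proj_line set)"
    by (simp add: open_proj_line_def)
next
  fix S T :: "'a proj_line set"
  assume "open S" "open T"
  then have "openin (top_of_set {x :: 'a ^ 2. x \<noteq> 0})
      ({x. x \<noteq> 0 \<and> abs_proj_line x \<in> S} \<inter> {x. x \<noteq> 0 \<and> abs_proj_line x \<in> T})"
    unfolding open_proj_line_def by (rule openin_Int)
  moreover have "{x :: 'a ^ 2. x \<noteq> 0 \<and> abs_proj_line x \<in> S} \<inter> {x. x \<noteq> 0 \<and> abs_proj_line x \<in> T}
      = {x. x \<noteq> 0 \<and> abs_proj_line x \<in> S \<inter> T}" by auto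
  ultimately show "open (S \<inter> T)" by (simp add: open_proj_line_def)
next
  fix \<U> :: "'a proj_line set set"
  assume "\<forall>S\<in>\<U>. open S"
  then have "openin (top_of_set {x :: 'a ^ 2. x \<noteq> 0})
      (\<Union>S\<in>\<U>. {x. x \<noteq> 0 \<and> abs_proj_line x \<in> S})"
    unfolding open_proj_line_def by blast
  moreover have "(\<Union>S\<in>\<U>. {x :: 'a ^ 2. x \<noteq> 0 \<and> abs_proj_line x \<in> S})
      = {x. x \<noteq> 0 \<and> abs_proj_line x \<in> \<Union>\<U>}" by auto
  ultimately show "open (\<Union>\<U>)" by (simp add: open_proj_line_def)
qed

end

lift_definition spherical_dist ::
    "'a::nonarch_valued_field proj_line \<Rightarrow> 'a proj_line \<Rightarrow> real" is
  "\<lambda>x y. absv (x $ 1 * y $ 2 - x $ 2 * y $ 1) /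
     (max (absv (x $ 1)) (absv (x $ 2)) * max (absv (y $ 1)) (absv (y $ 2)))"
proof -
  fix x x' y y' :: "'a ^ 2"
  assume "proj_rel x x'" "proj_rel y y'"
  then obtain c d where c: "c \<noteq> 0" "x' = c *s x" "d \<noteq> 0" "y' = d *s y"
    unfolding proj_rel_def by blast
  have pos: "absv c > 0" "absv d > 0"
    using c absv_nonneg absv_eq_0_iff by (metis order_le_less)+
  have m: "max (absv (e * u)) (absv (e * v)) = absv e * max (absv u) (absv v)" for e u v :: 'a
    by (simp add: absv_mult absv_nonneg max_mult_distrib_left)
  have n: "x' $ 1 * y' $ 2 - x' $ 2 * y' $ 1 = (c * d) * (x $ 1 * y $ 2 - x $ 2 * y $ 1)"
    by (simp add: c algebra_simps)
  show "absv (x $ 1 * y $ 2 - x $ 2 * y $ 1) /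
      (max (absv (x $ 1)) (absv (x $ 2)) * max (absv (y $ 1)) (absv (y $ 2))) =
     absv (x' $ 1 * y' $ 2 - x' $ 2 * y' $ 1) /
      (max (absv (x' $ 1)) (absv (x' $ 2)) * max (absv (y' $ 1)) (absv (y' $ 2)))"
    unfolding n using pos by (simp add: c m absv_mult[of "c * d"] absv_mult[of c d])
qed

text \<open>The value at singular matrices is a dummy that only makes the function total.\<close>

lift_definition proj_act :: "'a::field ^ 2 ^ 2 \<Rightarrow> 'a proj_line \<Rightarrow> 'a proj_line" is
  "\<lambda>A x. if invertible A then A *v x else x"
proof -
  fix A :: "'a ^ 2 ^ 2" and x y :: "'a ^ 2"
  assume r: "proj_rel x y"
  show "proj_rel (if invertible A then A *v x else x) (if invertible A then A *v y else y)"
  proof (cases "invertible A")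
    case True
    then obtain B where B: "B ** A = mat 1" unfolding invertible_def by blast
    have nz: "A *v z \<noteq> 0" if "z \<noteq> 0" for z
      using B that by (metis matrix_vector_mul_assoc matrix_vector_mul_lid matrix_vector_mult_0_right)
    from r obtain c where "x \<noteq> 0" "y \<noteq> 0" "c \<noteq> 0" "y = c *s x"
      unfolding proj_rel_def by blast
    then have "A *v x \<noteq> 0 \<and> A *v y \<noteq> 0 \<and> A *v y = c *s (A *v x)"
      using nz by (simp add: vector_scalar_commute)
    with \<open>c \<noteq> 0\<close> True show ?thesis unfolding proj_rel_def by auto
  qed (use r in auto)
qed

definition GL2_int_ring :: "('a::nonarch_valued_field ^ 2 ^ 2) set" where
  "GL2_int_ring =
     {A. (\<forall>i j. A $ i $ j \<in> int_ring) \<and>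
         (\<exists>B. (\<forall>i j. B $ i $ j \<in> int_ring) \<and> A ** B = mat 1 \<and> B ** A = mat 1)}"

text \<open>
  Scalar matrices act trivially on the projective line, so invariance under \<open>PGL\<^sub>2(R)\<close> is
  invariance under all of \<open>GL\<^sub>2(R)\<close>.
\<close>

definition is_PGL2_invariant_prob :: "'k::nonarch_local_field proj_line measure \<Rightarrow> bool" where
  "is_PGL2_invariant_prob \<nu> \<longleftrightarrow>
     sets \<nu> = sets borel \<and>
     prob_space \<nu> \<and>
     (\<forall>A\<in>GL2_int_ring. \<forall>B\<in>sets borel. emeasure \<nu> (proj_act A ` B) = emeasure \<nu> B)"


section \<open>Canonical partition functions\<close>

text \<open>
  HOL sets \<open>0 powr \<beta> = 0\<close> for every \<open>\<beta>\<close>. This affects the integrands only where two coordinates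
  coincide, which is a null set.
\<close>

definition pairs :: "nat \<Rightarrow> (nat \<times> nat) set" where
  "pairs N = {(i, j). 1 \<le> i \<and> i < j \<and> j \<le> N}"

definition integrand_R ::
    "nat \<Rightarrow> complex \<Rightarrow> (nat \<Rightarrow> 'k::nonarch_local_field) \<Rightarrow> complex" where
  "integrand_R N \<beta> x = (\<Prod>(i, j)\<in>pairs N. complex_of_real (absv (x i - x j)) powr \<beta>)"

definition integrand_P1 ::
    "nat \<Rightarrow> complex \<Rightarrow> (nat \<Rightarrow> 'k::nonarch_local_field proj_line) \<Rightarrow> complex" where
  "integrand_P1 N \<beta> x = (\<Prod>(i, j)\<in>pairs N. complex_of_real (spherical_dist (x i) (x j)) powr \<beta>)"

definition Z_R :: "'k::nonarch_local_field measure \<Rightarrow> nat \<Rightarrow> complex \<Rightarrow> complex" where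
  "Z_R \<mu> N \<beta> =
     (LINT x : (\<Pi>\<^sub>E i\<in>{1..N}. int_ring) | (\<Pi>\<^sub>M i\<in>{1..N}. \<mu>). integrand_R N \<beta> x)"

definition Z_P1 :: "'k::nonarch_local_field proj_line measure \<Rightarrow> nat \<Rightarrow> complex \<Rightarrow> complex" where
  "Z_P1 \<nu> N \<beta> = (LINT x | (\<Pi>\<^sub>M i\<in>{1..N}. \<nu>). integrand_P1 N \<beta> x)"


section \<open>The recurrence and the extensions in \<open>q\<close>\<close>

definition recE :: "nat \<Rightarrow> complex \<Rightarrow> complex" where
  "recE n \<beta> = of_nat n + of_nat (n choose 2) * \<beta>"

function recF :: "nat \<Rightarrow> real \<Rightarrow> complex \<Rightarrow> complex" where
  "recF n t \<beta> =
     (if n \<le> 1 then 1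
      else if t \<noteq> 0 then
        (\<Sum>k\<in>{1..<n}. of_nat k / of_nat n *
           (sinh (of_real t / 2 * (recE n \<beta> * (1 - 2 * of_nat k / of_nat n) + 1)) /
            sinh (of_real t / 2 * (recE n \<beta> - 1))) *
           recF (n - k) t \<beta> * recF k t \<beta>)
      else
        (\<Sum>k\<in>{1..<n}. of_nat k / of_nat n *
           ((recE n \<beta> * (1 - 2 * of_nat k / of_nat n) + 1) / (recE n \<beta> - 1)) *
           recF (n - k) t \<beta> * recF k t \<beta>))"
  by auto
termination
  by (relation "Wellfounded.measure (\<lambda>(n, t, \<beta>). n)") auto

declare recF.simps [simp del]

definition Z_R_ext :: "nat \<Rightarrow> complex \<Rightarrow> real \<Rightarrow> complex" where
  "Z_R_ext N \<beta> q =
     fact N * complex_of_real q powr (1 / 2 * of_nat (N choose 2) * \<beta>) * recF N (ln q) \<beta>"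

definition Z_P1_ext :: "nat \<Rightarrow> complex \<Rightarrow> real \<Rightarrow> complex" where
  "Z_P1_ext N \<beta> q =
     fact N * (\<Sum>k\<in>{0..N}.
       cosh (of_real (ln q) / 2 * recE N \<beta> * (1 - 2 * of_nat k / of_nat N)) /
       (2 * cosh (of_real (ln q) / 2)) ^ N * recF (N - k) (ln q) \<beta> * recF k (ln q) \<beta>)"

text \<open>\<open>C\<^sup>\<infinity>\<close> on an open set of reals: every iterated derivative is differentiable there.\<close>

definition smooth_on :: "real set \<Rightarrow> (real \<Rightarrow> complex) \<Rightarrow> bool" where
  "smooth_on S f \<longleftrightarrow>
     (\<forall>n. \<forall>x\<in>S. ((\<lambda>g y. vector_derivative g (at y)) ^^ n) f differentiable (at x))"

end

theory Submission
  imports Defs "HOL-Complex_Analysis.Cauchy_Integral_Formula" "HOL-Computational_Algebra.Formal_Power_Series"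
begin

text \<open>
  If a space is split into two pieces such that the interaction between points of different pieces
  is \<open>1\<close>, then the exponential generating function of its partition functions is the product of those
  of the pieces. The ring \<open>R\<close> is a union of \<open>q\<close> residue classes at mutual distance \<open>1\<close>, each a copy of
  \<open>R\<close> scaled by \<open>1 / q\<close>. Hence the generating function \<open>A = \<Sum> Z\<^sub>n z\<^sup>n / n!\<close> of \<open>R\<close> satisfies \<open>A = B\<^sup>q\<close>,
  where \<open>B\<close> arises from \<open>A\<close> by multiplying the \<open>n\<close>-th coefficient by \<open>q\<close> to the power
  \<open>- (n + (n choose 2) \<beta>)\<close>. Comparing coefficients in \<open>A' B = q A B'\<close> gives the quadratic recurrence.
  The projective line splits into a copy of \<open>R\<close> and a copy of the maximal ideal at distance \<open>1\<close>, so its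
  generating function is a product of rescalings of \<open>A\<close> and \<open>B\<close>; the sum over \<open>k\<close> is made symmetric
  under \<open>k \<mapsto> N - k\<close> to obtain the hyperbolic cosine. All functions of \<open>log q\<close> that occur are even and
  extend analytically to a neighbourhood of the real axis.
\<close>

section \<open>Partition functions of decomposable spaces\<close>

text \<open>Differentiating logarithmically turns q from an exponent into a coefficient, which a
  real variable can replace. In degree n the unknown a_n occurs on both sides; collected, it has a
  coefficient proportional to 1 - q w_n, where w_n = q^(-E_n) and E_n = n + (n choose 2) \<beta>.
  This vanishes for n = 1, so a_1 must be read off from the total mass of R. For n \<ge> 2 it is
  nonzero because Re E_n > 1, which is exactly the condition Re \<beta> > -2/n. The same inequality
  says |q w_n| < 1, and this contraction yields the convergence of the integrals, without which the
  recursion would be meaningless. The normalisation a_n = F_n q^((E_n - n)/2) makes the two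
  exponentials in each coefficient opposite up to a common factor, so that they combine into sinh;
  the identity E_(n-k) - E_k = E_n (1 - 2k/n) supplies the argument. The two pieces of the
  projective line have masses q/(q+1) and 1/(q+1), that is q^(1/2) and q^(-1/2) divided by 2
  cosh(log q / 2); this is the origin of the denominator in the second formula.\<close>

definition ordered_pairs :: "nat set \<Rightarrow> (nat \<times> nat) set" where
  "ordered_pairs I = {(i, j). i \<in> I \<and> j \<in> I \<and> i < j}"

definition pair_prod :: "('a \<Rightarrow> 'a \<Rightarrow> 'b) \<Rightarrow> nat set \<Rightarrow> (nat \<Rightarrow> 'a) \<Rightarrow> 'b::comm_monoid_mult" where
  "pair_prod \<kappa> I x = (\<Prod>(i, j)\<in>ordered_pairs I. \<kappa> (x i) (x j))"

text \<open>The confinement to \<open>S\<close> sits in the integrand and not in the measure, so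
  that all pieces of a decomposition are integrated against the same product measure and the
  decomposition becomes a pointwise identity.\<close>

definition restricted_pair_prod ::
    "'a set \<Rightarrow> ('a \<Rightarrow> 'a \<Rightarrow> 'b) \<Rightarrow> nat set \<Rightarrow> (nat \<Rightarrow> 'a) \<Rightarrow> 'b::comm_semiring_1" where
  "restricted_pair_prod S \<kappa> I x = (\<Prod>i\<in>I. indicator S (x i)) * pair_prod \<kappa> I x"

text \<open>
  \<open>A\<close> is, up to degree \<open>N\<close>, the exponential generating function of the partition functions of
  particles confined to \<open>S\<close> with pair interaction \<open>\<kappa>\<close>. Quantifying over all index sets of a given
  size builds in the independence of the labelling.
\<close>

definition has_partition_series ::
    "'a measure \<Rightarrow> 'a set \<Rightarrow> ('a \<Rightarrow> 'a \<Rightarrow> 'b::{real_normed_field,banach,second_countable_topology})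
      \<Rightarrow> nat \<Rightarrow> 'b fps \<Rightarrow> bool" where
  "has_partition_series M S \<kappa> N A \<longleftrightarrow>
     (\<forall>I. finite I \<longrightarrow> card I \<le> N \<longrightarrow>
        has_bochner_integral (\<Pi>\<^sub>M i\<in>I. M) (restricted_pair_prod S \<kappa> I) (fact (card I) * fps_nth A (card I)))"

lemma has_partition_seriesD:
  assumes "has_partition_series M S \<kappa> N A" "finite I" "card I = N"
  shows "has_bochner_integral (\<Pi>\<^sub>M i\<in>I. M) (restricted_pair_prod S \<kappa> I) (fact N * fps_nth A N)"
  using assms by (auto simp: has_partition_series_def)

lemma pairs_eq_ordered_pairs: "pairs N = ordered_pairs {1..N}"
  by (auto simp: pairs_def ordered_pairs_def)

lemma finite_ordered_pairs [simp]: "finite I \<Longrightarrow> finite (ordered_pairs I)"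
  by (rule finite_subset[of _ "I \<times> I"]) (auto simp: ordered_pairs_def)

text \<open>Each two-element subset has exactly one increasing enumeration. The count is the
  exponent of the factor that every pair acquires under rescaling.\<close>

lemma card_ordered_pairs: "finite I \<Longrightarrow> card (ordered_pairs I) = card I choose 2"
proof -
  assume fin: "finite I"
  have "bij_betw (\<lambda>(i, j). {i, j}) (ordered_pairs I) {B. B \<subseteq> I \<and> card B = 2}"
  proof (rule bij_betw_imageI)
    show "inj_on (\<lambda>(i, j). {i, j}) (ordered_pairs I)"
      by (auto simp: inj_on_def ordered_pairs_def doubleton_eq_iff)
    show "(\<lambda>(i, j). {i, j}) ` ordered_pairs I = {B. B \<subseteq> I \<and> card B = 2}"
    proof (intro equalityI subsetI)
      fix B assume "B \<in> {B. B \<subseteq> I \<and> card B = 2}"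
      then obtain a b where ab: "B = {a, b}" "a \<noteq> b" "a \<in> I" "b \<in> I"
        by (auto simp: card_2_iff)
      show "B \<in> (\<lambda>(i, j). {i, j}) ` ordered_pairs I"
      proof (cases "a < b")
        case True
        with ab show ?thesis by (force simp: ordered_pairs_def)
      next
        case False
        with ab have "(b, a) \<in> ordered_pairs I" "B = {b, a}" by (auto simp: ordered_pairs_def)
        then show ?thesis by force
      qed
    qed (auto simp: ordered_pairs_def)
  qed
  then have "card (ordered_pairs I) = card {B. B \<subseteq> I \<and> card B = 2}" by (rule bij_betw_same_card)
  with n_subsets[OF fin, of 2] show ?thesis by simp
qed

lemma pair_prod_cong:
  "(\<And>i. i \<in> I \<Longrightarrow> x i = y i) \<Longrightarrow> pair_prod \<kappa> I x = pair_prod \<kappa> I y"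
  unfolding pair_prod_def by (rule prod.cong) (auto simp: ordered_pairs_def)

lemma restricted_pair_prod_cong:
  "(\<And>i. i \<in> I \<Longrightarrow> x i = y i) \<Longrightarrow> restricted_pair_prod S \<kappa> I x = restricted_pair_prod S \<kappa> I y"
  unfolding restricted_pair_prod_def by (simp cong: pair_prod_cong prod.cong)

lemma prod_indicator_eq:
  "finite I \<Longrightarrow> (\<Prod>i\<in>I. indicator (S i) (x i)) = (if \<forall>i\<in>I. x i \<in> S i then 1 else (0::'b::comm_semiring_1))"
  by (induction I rule: finite_induct) (auto simp: indicator_def)

text \<open>Pairs with one index in \<open>I\<close> and one in \<open>J\<close> contribute 1. Both
  argument orders occur because \<kappa> is not assumed symmetric and either index of such a pair
  may be the smaller one.\<close>

lemma pair_prod_Un: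
  assumes "finite I" "finite J" "I \<inter> J = {}"
    and "\<And>i j. i \<in> I \<Longrightarrow> j \<in> J \<Longrightarrow> \<kappa> (x i) (x j) = 1 \<and> \<kappa> (x j) (x i) = 1"
  shows "pair_prod \<kappa> (I \<union> J) x = pair_prod \<kappa> I x * pair_prod \<kappa> J x"
proof -
  let ?D = "ordered_pairs I \<union> ordered_pairs J"
  have "pair_prod \<kappa> (I \<union> J) x = (\<Prod>(i, j)\<in>?D. \<kappa> (x i) (x j))"
    unfolding pair_prod_def
  proof (rule prod.mono_neutral_right)
    show "finite (ordered_pairs (I \<union> J))" using assms by simp
  qed (use assms in \<open>auto simp: ordered_pairs_def\<close>)
  also have "\<dots> = pair_prod \<kappa> I x * pair_prod \<kappa> J x"
    unfolding pair_prod_def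
    by (rule prod.union_disjoint) (use assms in \<open>auto simp: ordered_pairs_def intro: finite_ordered_pairs[unfolded ordered_pairs_def]\<close>)
  finally show ?thesis .
qed

text \<open>Expanding the product of sums of two indicators sorts configurations by the set
  \<open>J\<close> of particles that lie in \<open>S\<close>; the interaction between the two groups
  is 1.\<close>

lemma restricted_pair_prod_Un:
  fixes \<kappa> :: "'a \<Rightarrow> 'a \<Rightarrow> 'b::comm_semiring_1"
  assumes fin: "finite I" and disj: "S \<inter> C = {}"
    and cross: "\<And>x y. x \<in> S \<Longrightarrow> y \<in> C \<Longrightarrow> \<kappa> x y = 1 \<and> \<kappa> y x = 1"
  shows "restricted_pair_prod (S \<union> C) \<kappa> I x =
    (\<Sum>J\<in>Pow I. restricted_pair_prod S \<kappa> J x * restricted_pair_prod C \<kappa> (I - J) x)"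
proof -
  have "(\<Prod>i\<in>I. indicator (S \<union> C) (x i) :: 'b) = (\<Prod>i\<in>I. indicator S (x i) + indicator C (x i))"
    using disj by (intro prod.cong refl) (auto simp: indicator_def)
  also have "\<dots> = (\<Sum>J\<in>Pow I. (\<Prod>i\<in>J. indicator S (x i)) * (\<Prod>i\<in>I - J. indicator C (x i)))"
    by (rule prod_add[OF fin])
  finally have "restricted_pair_prod (S \<union> C) \<kappa> I x =
    (\<Sum>J\<in>Pow I. (\<Prod>i\<in>J. indicator S (x i)) * (\<Prod>i\<in>I - J. indicator C (x i)) * pair_prod \<kappa> I x)"
    by (simp add: restricted_pair_prod_def sum_distrib_right)
  also have "\<dots> = (\<Sum>J\<in>Pow I. restricted_pair_prod S \<kappa> J x * restricted_pair_prod C \<kappa> (I - J) x)"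
  proof (rule sum.cong[OF refl])
    fix J assume "J \<in> Pow I"
    then have J: "finite J" "finite (I - J)" "J \<union> (I - J) = I" using fin finite_subset by auto
    show "(\<Prod>i\<in>J. indicator S (x i)) * (\<Prod>i\<in>I - J. indicator C (x i)) * pair_prod \<kappa> I x =
      restricted_pair_prod S \<kappa> J x * restricted_pair_prod C \<kappa> (I - J) x"
    proof (cases "(\<forall>i\<in>J. x i \<in> S) \<and> (\<forall>i\<in>I - J. x i \<in> C)")
      case True
      then have "pair_prod \<kappa> (J \<union> (I - J)) x = pair_prod \<kappa> J x * pair_prod \<kappa> (I - J) x"
        using J cross by (intro pair_prod_Un) auto
      then show ?thesis using J by (simp add: restricted_pair_prod_def mult_ac)
    next
      \<comment> \<open>The indicators make both sides vanish, whatever the interaction is.\<close>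
      case False
      then show ?thesis
        using J(1,2) by (auto simp: restricted_pair_prod_def prod_indicator_eq)
    qed
  qed
  finally show ?thesis .
qed

lemma sum_Pow_card:
  assumes "finite I"
  shows "(\<Sum>J\<in>Pow I. g (card J)) = (\<Sum>k\<le>card I. of_nat (card I choose k) * (g k :: 'b::comm_semiring_1))"
proof -
  have "(\<Sum>k\<le>card I. \<Sum>J | J \<in> Pow I \<and> card J = k. g (card J)) = (\<Sum>J\<in>Pow I. g (card J))"
    by (rule sum.group) (use assms in \<open>auto intro: card_mono\<close>)
  moreover have "(\<Sum>J | J \<in> Pow I \<and> card J = k. g (card J)) = of_nat (card I choose k) * g k" for k
    using n_subsets[OF assms, of k] by simp
  ultimately show ?thesis by simp
qed

lemma (in pair_sigma_finite) has_bochner_integral_mult: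
  fixes f :: "'a \<Rightarrow> 'c::{real_normed_field,banach,second_countable_topology}"
  assumes "has_bochner_integral M1 f a" "has_bochner_integral M2 g b"
  shows "has_bochner_integral (M1 \<Otimes>\<^sub>M M2) (\<lambda>(x, y). f x * g y) (a * b)"
proof -
  have f: "integrable M1 f" "integral\<^sup>L M1 f = a" and g: "integrable M2 g" "integral\<^sup>L M2 g = b"
    using assms by (auto simp: has_bochner_integral_iff)
  note [measurable] = borel_measurable_integrable[OF f(1)] borel_measurable_integrable[OF g(1)]
  have int: "integrable (M1 \<Otimes>\<^sub>M M2) (\<lambda>(x, y). f x * g y)"
  proof (rule Fubini_integrable)
    have "(\<lambda>x. \<integral>y. norm (f x * g y) \<partial>M2) = (\<lambda>x. norm (f x) * (\<integral>y. norm (g y) \<partial>M2))"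
      by (simp add: norm_mult)
    then show "integrable M1 (\<lambda>x. \<integral>y. norm (case (x, y) of (x, y) \<Rightarrow> f x * g y) \<partial>M2)"
      using f(1) by simp
  qed (use g(1) in \<open>auto\<close>)
  have "integral\<^sup>L (M1 \<Otimes>\<^sub>M M2) (\<lambda>(x, y). f x * g y) = (\<integral>x. (\<integral>y. f x * g y \<partial>M2) \<partial>M1)"
    using integral_fst'[OF int] by simp
  also have "\<dots> = a * b" using f g by simp
  finally show ?thesis using int by (simp add: has_bochner_integral_iff)
qed

text \<open>The map \<open>merge\<close> identifies the product over the union with the product of
  the two products; \<open>restrict\<close> appears because the factors are functions on extensional
  families.\<close>

lemma (in product_sigma_finite) has_bochner_integral_PiM_mult:
  fixes f :: "('i \<Rightarrow> 'a) \<Rightarrow> 'c::{real_normed_field,banach,second_countable_topology}"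
  assumes IJ: "I \<inter> J = {}" "finite I" "finite J"
    and f: "has_bochner_integral (PiM I M) f a" and g: "has_bochner_integral (PiM J M) g b"
  shows "has_bochner_integral (PiM (I \<union> J) M) (\<lambda>x. f (restrict x I) * g (restrict x J)) (a * b)"
proof -
  interpret I: finite_product_sigma_finite M I by standard fact
  interpret J: finite_product_sigma_finite M J by standard fact
  interpret P: pair_sigma_finite "PiM I M" "PiM J M" ..
  have [measurable]: "f \<in> borel_measurable (PiM I M)" "g \<in> borel_measurable (PiM J M)"
    using f g by (auto simp: has_bochner_integral_iff)
  have "has_bochner_integral (distr (PiM I M \<Otimes>\<^sub>M PiM J M) (PiM (I \<union> J) M) (merge I J))
      (\<lambda>x. f (restrict x I) * g (restrict x J)) (a * b)"
  proof (rule has_bochner_integral_distr)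
    show "(\<lambda>x. f (restrict x I) * g (restrict x J)) \<in> borel_measurable (PiM (I \<union> J) M)"
      by measurable
    have "(f (restrict (merge I J z) I) * g (restrict (merge I J z) J)) = (case z of (x, y) \<Rightarrow> f x * g y)"
      if "z \<in> space (PiM I M \<Otimes>\<^sub>M PiM J M)" for z
    proof -
      obtain x y where z: "z = (x, y)" by force
      from that z have "x \<in> extensional I" "y \<in> extensional J"
        by (auto simp: space_pair_measure space_PiM PiE_def)
      with z IJ show ?thesis by (simp add: restrict_merge extensional_restrict)
    qed
    then show "has_bochner_integral (PiM I M \<Otimes>\<^sub>M PiM J M)
       (\<lambda>z. f (restrict (merge I J z) I) * g (restrict (merge I J z) J)) (a * b)"
      using P.has_bochner_integral_mult[OF f g] by (simp cong: has_bochner_integral_cong)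
  qed measurable
  then show ?thesis using distr_merge[OF IJ] by simp
qed

text \<open>The integral of a term of the subset expansion depends only on the size of the subset,
  so terms are grouped by \<open>k = card J\<close>. The binomial coefficient cancels the two
  factorials, which is why the generating functions are exponential.\<close>

lemma has_partition_series_Un:
  fixes \<kappa> :: "'a \<Rightarrow> 'a \<Rightarrow> 'b::{real_normed_field,banach,second_countable_topology}"
  assumes "sigma_finite_measure M" and disj: "S \<inter> C = {}"
    and cross: "\<And>x y. x \<in> S \<Longrightarrow> y \<in> C \<Longrightarrow> \<kappa> x y = 1 \<and> \<kappa> y x = 1"
    and A: "has_partition_series M S \<kappa> N A" and B: "has_partition_series M C \<kappa> N B"
  shows "has_partition_series M (S \<union> C) \<kappa> N (A * B)"
  unfolding has_partition_series_def
proof (intro allI impI)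
  fix I :: "nat set" assume I: "finite I" "card I \<le> N"
  interpret product_sigma_finite "\<lambda>_::nat. M" by (simp add: product_sigma_finite_def assms(1))
  let ?a = "\<lambda>n. fact n * fps_nth A n" and ?b = "\<lambda>n. fact n * fps_nth B n"
  have "has_bochner_integral (\<Pi>\<^sub>M i\<in>I. M)
      (\<lambda>x. \<Sum>J\<in>Pow I. restricted_pair_prod S \<kappa> J x * restricted_pair_prod C \<kappa> (I - J) x)
      (\<Sum>J\<in>Pow I. ?a (card J) * ?b (card (I - J)))"
  proof (rule has_bochner_integral_sum)
    fix J assume J: "J \<in> Pow I"
    then have fin: "finite J" "finite (I - J)" "J \<inter> (I - J) = {}" and Un: "J \<union> (I - J) = I"
      using I(1) finite_subset by auto
    have "card J \<le> N" "card (I - J) \<le> N"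
      using J I by (meson Diff_subset PowD card_mono le_trans)+
    with fin A B have
      "has_bochner_integral (\<Pi>\<^sub>M i\<in>J. M) (restricted_pair_prod S \<kappa> J) (?a (card J))"
      "has_bochner_integral (\<Pi>\<^sub>M i\<in>I - J. M) (restricted_pair_prod C \<kappa> (I - J)) (?b (card (I - J)))"
      by (auto simp: has_partition_series_def)
    from has_bochner_integral_PiM_mult[OF fin(3) fin(1,2) this] 
    have "has_bochner_integral (\<Pi>\<^sub>M i\<in>I. M) (\<lambda>x. restricted_pair_prod S \<kappa> J (restrict x J) * restricted_pair_prod C \<kappa> (I - J) (restrict x (I - J)))
      (?a (card J) * ?b (card (I - J)))"
      unfolding Un .
    moreover have "restricted_pair_prod S \<kappa> J (restrict x J) = restricted_pair_prod S \<kappa> J x"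
      "restricted_pair_prod C \<kappa> (I - J) (restrict x (I - J)) = restricted_pair_prod C \<kappa> (I - J) x" for x
      by (auto intro!: restricted_pair_prod_cong)
    ultimately show "has_bochner_integral (\<Pi>\<^sub>M i\<in>I. M)
       (\<lambda>x. restricted_pair_prod S \<kappa> J x * restricted_pair_prod C \<kappa> (I - J) x) (?a (card J) * ?b (card (I - J)))"
      by simp
  qed
  moreover have "(\<Sum>J\<in>Pow I. ?a (card J) * ?b (card (I - J))) = fact (card I) * fps_nth (A * B) (card I)"
  proof -
    have "(\<Sum>J\<in>Pow I. ?a (card J) * ?b (card (I - J))) = (\<Sum>J\<in>Pow I. ?a (card J) * ?b (card I - card J))"
      using I(1) by (intro sum.cong refl) (auto simp: card_Diff_subset finite_subset)
    also have "\<dots> = (\<Sum>k\<le>card I. of_nat (card I choose k) * (?a k * ?b (card I - k)))"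
      by (rule sum_Pow_card[OF I(1)])
    also have "\<dots> = (\<Sum>k\<le>card I. fact (card I) * (fps_nth A k * fps_nth B (card I - k)))"
    proof (rule sum.cong[OF refl])
      fix k assume "k \<in> {..card I}"
      then have "fact k * fact (card I - k) * (card I choose k) = (fact (card I) :: nat)"
        by (intro binomial_fact_lemma) simp
      then have "of_nat (fact k * fact (card I - k) * (card I choose k)) = (of_nat (fact (card I)) :: 'b)"
        by simp
      then have e: "fact k * fact (card I - k) * of_nat (card I choose k) = (fact (card I) :: 'b)"
        by (simp only: of_nat_mult of_nat_fact)
      show "of_nat (card I choose k) * (?a k * ?b (card I - k)) = fact (card I) * (fps_nth A k * fps_nth B (card I - k))"
        unfolding e[symmetric] by (simp only: mult_ac)
    qed
    also have "\<dots> = fact (card I) * fps_nth (A * B) (card I)"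
      by (simp add: fps_mult_nth sum_distrib_left atLeast0AtMost)
    finally show ?thesis .
  qed
  moreover have "restricted_pair_prod (S \<union> C) \<kappa> I = (\<lambda>x. \<Sum>J\<in>Pow I. restricted_pair_prod S \<kappa> J x * restricted_pair_prod C \<kappa> (I - J) x)"
    by (intro ext restricted_pair_prod_Un I(1) disj cross)
  ultimately show "has_bochner_integral (\<Pi>\<^sub>M i\<in>I. M) (restricted_pair_prod (S \<union> C) \<kappa> I)
      (fact (card I) * fps_nth (A * B) (card I))"
    by simp
qed

text \<open>Without particles the constant 1 is integrated over a one-point probability space; with
  at least one particle the indicator of the empty set vanishes.\<close>

lemma has_partition_series_empty:
  "has_partition_series M {} (\<kappa> :: _ \<Rightarrow> _ \<Rightarrow> 'b::{real_normed_field,banach,second_countable_topology}) N 1"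
  unfolding has_partition_series_def
proof (intro allI impI)
  fix I :: "nat set" assume I: "finite I" "card I \<le> N"
  interpret e: prob_space "\<Pi>\<^sub>M i\<in>{}. M" by (rule prob_space_PiM) simp
  show "has_bochner_integral (\<Pi>\<^sub>M i\<in>I. M) (restricted_pair_prod {} \<kappa> I) (fact (card I) * fps_nth 1 (card I))"
  proof (cases "I = {}")
    case True
    have "restricted_pair_prod {} \<kappa> {} = (\<lambda>_. 1)"
      by (auto simp: restricted_pair_prod_def pair_prod_def ordered_pairs_def)
    then show ?thesis using True
      by (simp add: has_bochner_integral_iff e.prob_space)
  next
    case False
    then have "restricted_pair_prod {} \<kappa> I = (\<lambda>_. 0)"
      using I(1) by (auto simp: restricted_pair_prod_def prod_indicator_eq intro!: ext)
    with False I(1) show ?thesis by (simp add: has_bochner_integral_zero)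
  qed
qed

lemma has_partition_series_UN:
  fixes \<kappa> :: "'a \<Rightarrow> 'a \<Rightarrow> 'b::{real_normed_field,banach,second_countable_topology}"
  assumes M: "sigma_finite_measure M" and "finite D"
    and "disjoint_family_on S D"
    and cross: "\<And>c d x y. c \<in> D \<Longrightarrow> d \<in> D \<Longrightarrow> c \<noteq> d \<Longrightarrow> x \<in> S c \<Longrightarrow> y \<in> S d \<Longrightarrow> \<kappa> x y = 1"
    and "\<And>d. d \<in> D \<Longrightarrow> has_partition_series M (S d) \<kappa> N B"
  shows "has_partition_series M (\<Union>d\<in>D. S d) \<kappa> N (B ^ card D)"
  using assms(2-)
proof (induction D rule: finite_induct)
  case empty
  then show ?case by (simp add: has_partition_series_empty)
next
  case (insert d D)
  have "has_partition_series M (S d \<union> (\<Union>d\<in>D. S d)) \<kappa> N (B * B ^ card D)"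
  proof (rule has_partition_series_Un[OF M])
    show "S d \<inter> (\<Union>d\<in>D. S d) = {}" using insert by (auto simp: disjoint_family_on_def)
    show "\<kappa> x y = 1 \<and> \<kappa> y x = 1" if "x \<in> S d" "y \<in> (\<Union>d\<in>D. S d)" for x y
      using that insert.prems(2)[of d _ x y] insert.prems(2)[of _ d y x] insert.hyps(2) by auto
    show "has_partition_series M (\<Union>d\<in>D. S d) \<kappa> N (B ^ card D)"
      using insert by (intro insert.IH) (auto simp: disjoint_family_on_def)
  qed (use insert in auto)
  then show ?case using insert by simp
qed

section \<open>Partition series under maps that rescale volume and interaction by constants\<close>

lemma sigma_finite_density_indicator:
  assumes "S \<in> sets M" "emeasure M S < \<infinity>"
  shows "sigma_finite_measure (density M (indicator S))"
proof -
  have "emeasure (density M (indicator S)) (space M) = emeasure M S"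
    using assms sets.sets_into_space by (subst emeasure_density) (auto simp: Int_absorb2 indicator_inter_arith[symmetric])
  then have "finite_measure (density M (indicator S))"
    using assms by (intro finite_measureI) simp
  then show ?thesis by (rule finite_measure.axioms)
qed

text \<open>Moving the confinement from the integrand into the one-particle measure lets a
  coordinatewise map act on a genuine product measure. The two measures are compared on
  boxes.\<close>

lemma PiM_density_indicator:
  assumes M: "sigma_finite_measure M" and S: "S \<in> sets M" "emeasure M S < \<infinity>" and I: "finite I"
  shows "density (\<Pi>\<^sub>M i\<in>I. M) (\<lambda>x. \<Prod>i\<in>I. indicator S (x i)) = (\<Pi>\<^sub>M i\<in>I. density M (indicator S))"
proof -
  interpret product_sigma_finite "\<lambda>_. M" by (simp add: product_sigma_finite_def M)
  interpret D: product_sigma_finite "\<lambda>_. density M (indicator S)"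
    using sigma_finite_density_indicator[OF S] by (simp add: product_sigma_finite_def)
  show ?thesis
  proof (rule D.PiM_eqI[OF I])
    show "sets (density (\<Pi>\<^sub>M i\<in>I. M) (\<lambda>x. \<Prod>i\<in>I. indicator S (x i))) = sets (\<Pi>\<^sub>M i\<in>I. density M (indicator S))"
      by (simp cong: sets_PiM_cong)
  next
    fix A assume "\<And>i. i \<in> I \<Longrightarrow> A i \<in> sets (density M (indicator S))"
    then have A: "\<And>i. i \<in> I \<Longrightarrow> A i \<in> sets M" by simp
    have [measurable]: "S \<in> sets M" by fact
    have "(\<lambda>x. (\<Prod>i\<in>I. indicator S (x i)) :: ennreal) \<in> borel_measurable (\<Pi>\<^sub>M i\<in>I. M)"
      by measurable
    then have "emeasure (density (\<Pi>\<^sub>M i\<in>I. M) (\<lambda>x. \<Prod>i\<in>I. indicator S (x i))) (Pi\<^sub>E I A) =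
      (\<integral>\<^sup>+x. (\<Prod>i\<in>I. indicator S (x i)) * indicator (Pi\<^sub>E I A) x \<partial>(\<Pi>\<^sub>M i\<in>I. M))"
      using A I by (intro emeasure_density) (auto intro!: sets_PiM_I_finite)
    also have "\<dots> = (\<integral>\<^sup>+x. (\<Prod>i\<in>I. indicator (A i \<inter> S) (x i)) \<partial>(\<Pi>\<^sub>M i\<in>I. M))"
    proof (rule nn_integral_cong)
      fix x assume "x \<in> space (\<Pi>\<^sub>M i\<in>I. M)"
      then have "indicator (Pi\<^sub>E I A) x = (\<Prod>i\<in>I. indicator (A i) (x i) :: ennreal)"
        using I by (auto simp: prod_indicator_eq space_PiM PiE_def Pi_def indicator_def)
      then show "(\<Prod>i\<in>I. indicator S (x i)) * indicator (Pi\<^sub>E I A) x = (\<Prod>i\<in>I. indicator (A i \<inter> S) (x i) :: ennreal)"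
        by (simp add: prod.distrib[symmetric] indicator_inter_arith mult.commute)
    qed
    also have "\<dots> = (\<Prod>i\<in>I. emeasure M (A i \<inter> S))"
      using A S(1) by (subst product_nn_integral_prod[OF I]) (auto intro!: prod.cong)
    also have "\<dots> = (\<Prod>i\<in>I. emeasure (density M (indicator S)) (A i))"
      using A S(1) by (intro prod.cong refl) (subst emeasure_density, auto simp: indicator_inter_arith[symmetric] Int_commute)
    finally show "emeasure (density (\<Pi>\<^sub>M i\<in>I. M) (\<lambda>x. \<Prod>i\<in>I. indicator S (x i))) (Pi\<^sub>E I A) =
      (\<Prod>i\<in>I. emeasure (density M (indicator S)) (A i))" .
  qed
qed

lemma measurable_pair_prod:
  fixes \<kappa> :: "'a \<Rightarrow> 'a \<Rightarrow> 'b::{real_normed_field,banach,second_countable_topology}"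
  assumes \<kappa>: "(\<lambda>(x, y). \<kappa> x y) \<in> borel_measurable (M \<Otimes>\<^sub>M M)"
  shows "pair_prod \<kappa> I \<in> borel_measurable (\<Pi>\<^sub>M i\<in>I. M)"
proof -
  have "(\<lambda>x. \<Prod>p\<in>ordered_pairs I. \<kappa> (x (fst p)) (x (snd p))) \<in> borel_measurable (\<Pi>\<^sub>M i\<in>I. M)"
  proof (rule borel_measurable_prod)
    fix p assume "p \<in> ordered_pairs I"
    then have "fst p \<in> I" "snd p \<in> I" by (auto simp: ordered_pairs_def)
    then have "(\<lambda>x. (x (fst p), x (snd p))) \<in> measurable (\<Pi>\<^sub>M i\<in>I. M) (M \<Otimes>\<^sub>M M)"
      by measurable
    from measurable_compose[OF this \<kappa>]
    show "(\<lambda>x. \<kappa> (x (fst p)) (x (snd p))) \<in> borel_measurable (\<Pi>\<^sub>M i\<in>I. M)" by simp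
  qed
  then show ?thesis by (simp add: pair_prod_def[abs_def] case_prod_beta)
qed

lemma measurable_restricted_pair_prod:
  fixes \<kappa> :: "'a \<Rightarrow> 'a \<Rightarrow> 'b::{real_normed_field,banach,second_countable_topology}"
  assumes \<kappa>: "(\<lambda>(x, y). \<kappa> x y) \<in> borel_measurable (M \<Otimes>\<^sub>M M)" and [measurable]: "S \<in> sets M"
  shows "restricted_pair_prod S \<kappa> I \<in> borel_measurable (\<Pi>\<^sub>M i\<in>I. M)"
proof -
  note [measurable] = measurable_pair_prod[OF \<kappa>, of I]
  show ?thesis unfolding restricted_pair_prod_def[abs_def] by measurable
qed

lemma density_prod_indicator_eq:
  "finite I \<Longrightarrow> density M (\<lambda>x. \<Prod>i\<in>I. indicator S (x i)) =
    density M (\<lambda>x. ennreal (\<Prod>i\<in>I. indicator S (x i)))"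
  by (intro arg_cong[of _ _ "density M"] ext) (simp add: prod_indicator_eq)

lemma scaleR_prod_indicator_mult:
  fixes a :: "'b::real_normed_field"
  shows "finite I \<Longrightarrow> (\<Prod>i\<in>I. indicator S (x i)) *\<^sub>R a = (\<Prod>i\<in>I. indicator S (x i)) * a"
  by (simp add: prod_indicator_eq)

lemma has_bochner_integral_restricted_pair_prod:
  fixes \<kappa> :: "'a \<Rightarrow> 'a \<Rightarrow> 'b::{real_normed_field,banach,second_countable_topology}"
  assumes M: "sigma_finite_measure M" and S: "S \<in> sets M" "emeasure M S < \<infinity>" and I: "finite I"
    and \<kappa>: "(\<lambda>(x, y). \<kappa> x y) \<in> borel_measurable (M \<Otimes>\<^sub>M M)"
  shows "has_bochner_integral (\<Pi>\<^sub>M i\<in>I. M) (restricted_pair_prod S \<kappa> I) v \<longleftrightarrow>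
    has_bochner_integral (\<Pi>\<^sub>M i\<in>I. density M (indicator S)) (pair_prod \<kappa> I) v"
proof -
  note [measurable] = measurable_pair_prod[OF \<kappa>, of I] S(1)
  have "(\<lambda>x. (\<Prod>i\<in>I. indicator S (x i)) *\<^sub>R pair_prod \<kappa> I x) = restricted_pair_prod S \<kappa> I"
    by (simp add: restricted_pair_prod_def[abs_def] scaleR_prod_indicator_mult[OF I])
  moreover have "(\<lambda>x. (\<Prod>i\<in>I. indicator S (x i)) :: real) \<in> borel_measurable (\<Pi>\<^sub>M i\<in>I. M)"
    by measurable
  ultimately show ?thesis
    unfolding PiM_density_indicator[OF M S I, symmetric] density_prod_indicator_eq[OF I]
    by (simp add: has_bochner_integral_iff integrable_density integral_density prod_nonneg)
qed

lemma PiM_image_density: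
  assumes M: "sigma_finite_measure M" and M1: "sigma_finite_measure M1"
    and T: "T \<in> measurable M1 M" and I: "finite I"
    and eq: "density (distr M1 M T) (\<lambda>_. c) = M2" and M2: "sigma_finite_measure M2"
  shows "density (distr (\<Pi>\<^sub>M i\<in>I. M1) (\<Pi>\<^sub>M i\<in>I. M) (\<lambda>x. \<lambda>i\<in>I. T (x i))) (\<lambda>_. c ^ card I) = (\<Pi>\<^sub>M i\<in>I. M2)"
proof -
  interpret product_sigma_finite "\<lambda>_. M1" by (simp add: product_sigma_finite_def M1)
  interpret D: product_sigma_finite "\<lambda>_. M2" by (simp add: product_sigma_finite_def M2)
  have sets2: "sets M2 = sets M" unfolding eq[symmetric] by simp
  note [measurable] = T
  have T': "(\<lambda>x. \<lambda>i\<in>I. T (x i)) \<in> measurable (\<Pi>\<^sub>M i\<in>I. M1) (\<Pi>\<^sub>M i\<in>I. M)"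
    by measurable
  show ?thesis
  proof (rule D.PiM_eqI[OF I])
    show "sets (density (distr (\<Pi>\<^sub>M i\<in>I. M1) (\<Pi>\<^sub>M i\<in>I. M) (\<lambda>x. \<lambda>i\<in>I. T (x i))) (\<lambda>_. c ^ card I)) = sets (\<Pi>\<^sub>M i\<in>I. M2)"
      using sets2 by (simp cong: sets_PiM_cong)
  next
    fix A assume "\<And>i. i \<in> I \<Longrightarrow> A i \<in> sets M2"
    then have A: "\<And>i. i \<in> I \<Longrightarrow> A i \<in> sets M" by (simp add: sets2)
    then have PA: "Pi\<^sub>E I A \<in> sets (\<Pi>\<^sub>M i\<in>I. M)" using I by (intro sets_PiM_I_finite) auto
    have TA: "T -` A i \<inter> space M1 \<in> sets M1" if "i \<in> I" for i
      using A[OF that] T by (rule measurable_sets[rotated])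
    have pre: "(\<lambda>x. \<lambda>i\<in>I. T (x i)) -` Pi\<^sub>E I A \<inter> space (\<Pi>\<^sub>M i\<in>I. M1) = (\<Pi>\<^sub>E i\<in>I. T -` A i \<inter> space M1)"
      by (auto simp: space_PiM PiE_def Pi_def)
    have "emeasure (density (distr (\<Pi>\<^sub>M i\<in>I. M1) (\<Pi>\<^sub>M i\<in>I. M) (\<lambda>x. \<lambda>i\<in>I. T (x i))) (\<lambda>_. c ^ card I)) (Pi\<^sub>E I A)
       = c ^ card I * emeasure (\<Pi>\<^sub>M i\<in>I. M1) (\<Pi>\<^sub>E i\<in>I. T -` A i \<inter> space M1)"
      using PA T' by (simp add: emeasure_density_const emeasure_distr pre)
    also have "\<dots> = c ^ card I * (\<Prod>i\<in>I. emeasure M1 (T -` A i \<inter> space M1))"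
      using TA I by (subst emeasure_PiM) auto
    also have "\<dots> = (\<Prod>i\<in>I. c * emeasure M1 (T -` A i \<inter> space M1))"
      by (simp add: prod.distrib)
    also have "\<dots> = (\<Prod>i\<in>I. emeasure M2 (A i))"
      using A T by (intro prod.cong refl) (simp add: eq[symmetric] emeasure_density_const emeasure_distr)
    finally show "emeasure (density (distr (\<Pi>\<^sub>M i\<in>I. M1) (\<Pi>\<^sub>M i\<in>I. M) (\<lambda>x. \<lambda>i\<in>I. T (x i))) (\<lambda>_. c ^ card I)) (Pi\<^sub>E I A)
       = (\<Prod>i\<in>I. emeasure M2 (A i))" .
  qed
qed

text \<open>The map \<open>T\<close> enters only through its effect on volume and interaction: each
  particle contributes \<open>c\<close> and each pair contributes \<open>s\<close>. Allowing two
  different kernels covers both the passage between cut-offs and the passage from the absolute value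
  to the spherical metric.\<close>

lemma has_partition_series_image:
  fixes \<kappa> :: "'a \<Rightarrow> 'a \<Rightarrow> 'b::{real_normed_field,banach,second_countable_topology}"
  assumes M: "sigma_finite_measure M" and M': "sigma_finite_measure M'"
    and S: "S \<in> sets M" "emeasure M S < \<infinity>" and S': "S' \<in> sets M'" "emeasure M' S' < \<infinity>"
    and T: "T \<in> measurable M' M" and c: "0 \<le> c"
    and eq: "\<And>A. A \<in> sets M \<Longrightarrow> emeasure M (A \<inter> S) = ennreal c * emeasure M' (T -` A \<inter> S')"
    and \<kappa>: "(\<lambda>(x, y). \<kappa> x y) \<in> borel_measurable (M \<Otimes>\<^sub>M M)"
    and \<kappa>': "\<And>x y. x \<in> S' \<Longrightarrow> y \<in> S' \<Longrightarrow> \<kappa> (T x) (T y) = s * \<kappa>' x y"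
    and A: "has_partition_series M' S' \<kappa>' N A"
  shows "has_partition_series M S \<kappa> N (Abs_fps (\<lambda>n. of_real c ^ n * s ^ (n choose 2) * fps_nth A n))"
  unfolding has_partition_series_def
proof (intro allI impI)
  fix I :: "nat set" assume I: "finite I" "card I \<le> N"
  let ?n = "card I"
  let ?v = "fact ?n * fps_nth A ?n" and ?k = "of_real c ^ ?n * s ^ (?n choose 2)"
  let ?M1 = "density M' (indicator S')" and ?M2 = "density M (indicator S)"
  let ?T = "\<lambda>x. \<lambda>i\<in>I. T (x i)"
  have M1: "sigma_finite_measure ?M1" and M2: "sigma_finite_measure ?M2"
    using S S' by (auto intro: sigma_finite_density_indicator)
  have T1 [measurable]: "T \<in> measurable ?M1 M" using T by simp
  note [measurable] = T S S' measurable_pair_prod[OF \<kappa>, of I]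
  have density_eq: "density (distr ?M1 M T) (\<lambda>_. ennreal c) = ?M2"
  proof (rule measure_eqI)
    fix B assume "B \<in> sets (density (distr ?M1 M T) (\<lambda>_. ennreal c))"
    then have B: "B \<in> sets M" by simp
    have TB: "T -` B \<inter> space M' \<in> sets M'" using B T by (rule measurable_sets[rotated])
    have "emeasure (density (distr ?M1 M T) (\<lambda>_. ennreal c)) B = ennreal c * emeasure ?M1 (T -` B \<inter> space M')"
      using B by (simp add: emeasure_density_const emeasure_distr T1)
    also have "emeasure ?M1 (T -` B \<inter> space M') = emeasure M' ((T -` B \<inter> space M') \<inter> S')"
      using TB S' by (subst emeasure_density) (auto simp: indicator_inter_arith[symmetric] Int_commute)
    also have "(T -` B \<inter> space M') \<inter> S' = T -` B \<inter> S'"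
      using S' sets.sets_into_space by blast
    also have "ennreal c * emeasure M' (T -` B \<inter> S') = emeasure M (B \<inter> S)" using eq[OF B] by simp
    also have "\<dots> = emeasure ?M2 B"
      using B S by (subst emeasure_density) (auto simp: indicator_inter_arith[symmetric] Int_commute)
    finally show "emeasure (density (distr ?M1 M T) (\<lambda>_. ennreal c)) B = emeasure ?M2 B" .
  qed simp
  have "has_bochner_integral (\<Pi>\<^sub>M i\<in>I. M') (restricted_pair_prod S' \<kappa>' I) ?v"
    using A I by (simp add: has_partition_series_def)
  then have "has_bochner_integral (\<Pi>\<^sub>M i\<in>I. M') (\<lambda>x. ?k * restricted_pair_prod S' \<kappa>' I x) (?k * ?v)"
    by (rule has_bochner_integral_mult_right)
  \<comment> \<open>On configurations inside \<open>S'\<close> every pair yields \<open>s\<close>.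
    The power of \<open>c\<close> is kept apart, to be absorbed later as the density of the image of
    the product measure.\<close>
  moreover have "?k * restricted_pair_prod S' \<kappa>' I x =
      (\<Prod>i\<in>I. indicator S' (x i)) *\<^sub>R (c ^ ?n *\<^sub>R pair_prod \<kappa> I (?T x))" for x
  proof (cases "\<forall>i\<in>I. x i \<in> S'")
    case True
    have "pair_prod \<kappa> I (?T x) = (\<Prod>(i, j)\<in>ordered_pairs I. s * \<kappa>' (x i) (x j))"
      unfolding pair_prod_def using True \<kappa>' by (intro prod.cong refl) (auto simp: ordered_pairs_def)
    also have "\<dots> = s ^ (?n choose 2) * pair_prod \<kappa>' I x"
      by (simp add: case_prod_beta prod.distrib card_ordered_pairs[OF I(1)] pair_prod_def)
    finally show ?thesis using True I(1)
      by (simp add: restricted_pair_prod_def prod_indicator_eq scaleR_conv_of_real)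
  next
    case False
    then show ?thesis using I(1) by (auto simp: restricted_pair_prod_def prod_indicator_eq)
  qed
  ultimately have "has_bochner_integral (\<Pi>\<^sub>M i\<in>I. M')
      (\<lambda>x. (\<Prod>i\<in>I. indicator S' (x i)) *\<^sub>R (c ^ ?n *\<^sub>R pair_prod \<kappa> I (?T x))) (?k * ?v)"
    by simp
  then have "has_bochner_integral (density (\<Pi>\<^sub>M i\<in>I. M') (\<lambda>x. ennreal (\<Prod>i\<in>I. indicator S' (x i))))
      (\<lambda>x. c ^ ?n *\<^sub>R pair_prod \<kappa> I (?T x)) (?k * ?v)"
    by (intro has_bochner_integral_density) (auto simp: prod_nonneg)
  then have "has_bochner_integral (\<Pi>\<^sub>M i\<in>I. ?M1) (\<lambda>x. c ^ ?n *\<^sub>R pair_prod \<kappa> I (?T x)) (?k * ?v)"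
    by (simp add: PiM_density_indicator[OF M' S' I(1)] density_prod_indicator_eq[OF I(1), symmetric])
  then have "has_bochner_integral (distr (\<Pi>\<^sub>M i\<in>I. ?M1) (\<Pi>\<^sub>M i\<in>I. M) ?T)
      (\<lambda>x. c ^ ?n *\<^sub>R pair_prod \<kappa> I x) (?k * ?v)"
    by (intro has_bochner_integral_distr) measurable
  then have "has_bochner_integral (density (distr (\<Pi>\<^sub>M i\<in>I. ?M1) (\<Pi>\<^sub>M i\<in>I. M) ?T) (\<lambda>_. ennreal (c ^ ?n)))
      (pair_prod \<kappa> I) (?k * ?v)"
    using c by (intro has_bochner_integral_density) auto
  then have "has_bochner_integral (\<Pi>\<^sub>M i\<in>I. ?M2) (pair_prod \<kappa> I) (?k * ?v)"
    using PiM_image_density[OF M M1 T1 I(1) density_eq M2] c by (simp add: ennreal_power)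
  then show "has_bochner_integral (\<Pi>\<^sub>M i\<in>I. M) (restricted_pair_prod S \<kappa> I)
      (fact ?n * fps_nth (Abs_fps (\<lambda>n. of_real c ^ n * s ^ (n choose 2) * fps_nth A n)) ?n)"
    unfolding has_bochner_integral_restricted_pair_prod[OF M S I(1) \<kappa>] by (simp add: mult_ac)
qed

section \<open>Relabelling of particles\<close>

lemma PiM_reindex:
  fixes h :: "'i \<Rightarrow> 'j"
  assumes M: "sigma_finite_measure M" and J: "finite J" and h: "bij_betw h I J"
  shows "distr (\<Pi>\<^sub>M j\<in>J. M) (\<Pi>\<^sub>M i\<in>I. M) (\<lambda>x. \<lambda>i\<in>I. x (h i)) = (\<Pi>\<^sub>M i\<in>I. M)"
proof -
  interpret product_sigma_finite "\<lambda>_::'i. M" by (simp add: product_sigma_finite_def M)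
  interpret J: product_sigma_finite "\<lambda>_::'j. M" by (simp add: product_sigma_finite_def M)
  have I: "finite I" using bij_betw_finite[OF h] J by simp
  have hI: "h i \<in> J" if "i \<in> I" for i using h that by (auto simp: bij_betw_def)
  have [measurable]: "(\<lambda>x. \<lambda>i\<in>I. x (h i)) \<in> measurable (\<Pi>\<^sub>M j\<in>J. M) (\<Pi>\<^sub>M i\<in>I. M)"
    using hI by (intro measurable_restrict measurable_component_singleton) auto
  show ?thesis
  proof (rule PiM_eqI[OF I])
    fix A assume A: "\<And>i. i \<in> I \<Longrightarrow> A i \<in> sets M"
    let ?g = "inv_into I h"
    have g: "?g j \<in> I" "h (?g j) = j" if "j \<in> J" for j
      using h that by (auto simp: bij_betw_def inv_into_into f_inv_into_f)
    have gh: "?g (h i) = i" if "i \<in> I" for i using h that by (auto simp: bij_betw_def)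
    have sub: "A i \<subseteq> space M" if "i \<in> I" for i using A[OF that] sets.sets_into_space by blast
    have pre: "(\<lambda>x. \<lambda>i\<in>I. x (h i)) -` Pi\<^sub>E I A \<inter> space (\<Pi>\<^sub>M j\<in>J. M) = (\<Pi>\<^sub>E j\<in>J. A (?g j))"
    proof (intro equalityI subsetI)
      fix x assume x: "x \<in> (\<lambda>x. \<lambda>i\<in>I. x (h i)) -` Pi\<^sub>E I A \<inter> space (\<Pi>\<^sub>M j\<in>J. M)"
      have "x j \<in> A (?g j)" if "j \<in> J" for j
      proof -
        have "(\<lambda>i\<in>I. x (h i)) (?g j) \<in> A (?g j)" using x g[OF that] by (intro PiE_mem[of _ I A]) auto
        then show ?thesis using g[OF that] by simp
      qed
      with x show "x \<in> (\<Pi>\<^sub>E j\<in>J. A (?g j))" by (auto simp: space_PiM PiE_def)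
    next
      fix x assume x: "x \<in> (\<Pi>\<^sub>E j\<in>J. A (?g j))"
      have "x (h i) \<in> A i" if "i \<in> I" for i
        using PiE_mem[OF x hI[OF that]] gh[OF that] by simp
      moreover have "x j \<in> space M" if "j \<in> J" for j
        using PiE_mem[OF x that] sub[OF g(1)[OF that]] by auto
      ultimately show "x \<in> (\<lambda>x. \<lambda>i\<in>I. x (h i)) -` Pi\<^sub>E I A \<inter> space (\<Pi>\<^sub>M j\<in>J. M)"
        using x by (auto simp: space_PiM PiE_def Pi_def)
    qed
    have "emeasure (distr (\<Pi>\<^sub>M j\<in>J. M) (\<Pi>\<^sub>M i\<in>I. M) (\<lambda>x. \<lambda>i\<in>I. x (h i))) (Pi\<^sub>E I A) =
        emeasure (\<Pi>\<^sub>M j\<in>J. M) (\<Pi>\<^sub>E j\<in>J. A (?g j))"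
      using A I by (subst emeasure_distr) (auto simp: pre intro!: sets_PiM_I_finite)
    also have "\<dots> = (\<Prod>j\<in>J. emeasure M (A (?g j)))"
      using A g J by (intro J.emeasure_PiM) auto
    also have "\<dots> = (\<Prod>i\<in>I. emeasure M (A i))"
      using prod.reindex_bij_betw[OF h, of "\<lambda>j. emeasure M (A (?g j))"] gh by (simp cong: prod.cong)
    finally show "emeasure (distr (\<Pi>\<^sub>M j\<in>J. M) (\<Pi>\<^sub>M i\<in>I. M) (\<lambda>x. \<lambda>i\<in>I. x (h i))) (Pi\<^sub>E I A) =
        (\<Prod>i\<in>I. emeasure M (A i))" .
  qed simp
qed

text \<open>An increasing \<open>h\<close> maps ordered pairs to ordered pairs, which matters
  because \<kappa> is not assumed symmetric.\<close>

lemma restricted_pair_prod_reindex: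
  fixes \<kappa> :: "'a \<Rightarrow> 'a \<Rightarrow> 'b::comm_semiring_1"
  assumes h: "bij_betw h I J" "strict_mono_on I h"
  shows "restricted_pair_prod S \<kappa> J x = restricted_pair_prod S \<kappa> I (\<lambda>i\<in>I. x (h i))"
proof -
  have "(\<Prod>i\<in>I. indicator S (x (h i))) = (\<Prod>j\<in>J. indicator S (x j) :: 'b)"
    by (rule prod.reindex_bij_betw[OF h(1)])
  moreover have "pair_prod \<kappa> J x = pair_prod \<kappa> I (\<lambda>i. x (h i))"
  proof -
    have "bij_betw (map_prod h h) (ordered_pairs I) (ordered_pairs J)"
    proof (rule bij_betw_imageI)
      show "inj_on (map_prod h h) (ordered_pairs I)"
        using h(1) by (auto simp: inj_on_def ordered_pairs_def bij_betw_def)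
      show "map_prod h h ` ordered_pairs I = ordered_pairs J"
      proof (intro equalityI subsetI)
        fix p assume "p \<in> ordered_pairs J"
        then obtain a b where ab: "p = (a, b)" "a \<in> J" "b \<in> J" "a < b" by (auto simp: ordered_pairs_def)
        then obtain i j where ij: "i \<in> I" "j \<in> I" "a = h i" "b = h j"
          using h(1) by (auto simp: bij_betw_def)
        have "i < j"
          using strict_mono_on_less[OF h(2) ij(1,2)] ab ij by simp
        with ab ij show "p \<in> map_prod h h ` ordered_pairs I"
          by (auto simp: ordered_pairs_def intro!: image_eqI[of _ _ "(i, j)"])
      next
        fix p assume "p \<in> map_prod h h ` ordered_pairs I"
        then obtain i j where ij: "p = (h i, h j)" "i \<in> I" "j \<in> I" "i < j" by (auto simp: ordered_pairs_def)
        then have "h i < h j" using h(2) by (auto simp: strict_mono_on_def)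
        with ij h(1) show "p \<in> ordered_pairs J" by (auto simp: ordered_pairs_def bij_betw_def)
      qed
    qed
    from prod.reindex_bij_betw[OF this, of "\<lambda>(i, j). \<kappa> (x i) (x j)"]
    show ?thesis by (simp add: pair_prod_def case_prod_beta)
  qed
  ultimately show ?thesis
    by (simp add: restricted_pair_prod_def cong: pair_prod_cong prod.cong)
qed

text \<open>One index set of each size suffices: any other is the image of \<open>{..<n}\<close>
  under its increasing enumeration, which respects both the product measure and the
  integrand.\<close>

lemma has_partition_series_Abs_fps:
  fixes \<kappa> :: "'a \<Rightarrow> 'a \<Rightarrow> 'b::{real_normed_field,banach,second_countable_topology}"
  assumes M: "sigma_finite_measure M"
    and int: "\<And>n. n \<le> N \<Longrightarrow> integrable (\<Pi>\<^sub>M i\<in>{..<n}. M) (restricted_pair_prod S \<kappa> {..<n})"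
  shows "has_partition_series M S \<kappa> N
    (Abs_fps (\<lambda>n. integral\<^sup>L (\<Pi>\<^sub>M i\<in>{..<n}. M) (restricted_pair_prod S \<kappa> {..<n}) / fact n))"
  unfolding has_partition_series_def
proof (intro allI impI)
  fix J :: "nat set" assume J: "finite J" "card J \<le> N"
  let ?I = "{..<card J}"
  let ?v = "integral\<^sup>L (\<Pi>\<^sub>M i\<in>?I. M) (restricted_pair_prod S \<kappa> ?I)"
  obtain h where h: "bij_betw h ?I J" "strict_mono_on ?I h"
    using ex_bij_betw_strict_mono_card[OF J(1)] .
  have hJ: "\<And>i. i < card J \<Longrightarrow> h i \<in> J" using h(1) by (auto simp: bij_betw_def)
  have meas: "(\<lambda>x. \<lambda>i\<in>?I. x (h i)) \<in> measurable (\<Pi>\<^sub>M j\<in>J. M) (\<Pi>\<^sub>M i\<in>?I. M)"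
    using hJ by (intro measurable_restrict measurable_component_singleton) auto
  have "has_bochner_integral (\<Pi>\<^sub>M i\<in>?I. M) (restricted_pair_prod S \<kappa> ?I) ?v"
    using int[OF J(2)] by (simp add: has_bochner_integral_iff)
  then have "has_bochner_integral (\<Pi>\<^sub>M j\<in>J. M) (\<lambda>x. restricted_pair_prod S \<kappa> ?I (\<lambda>i\<in>?I. x (h i))) ?v"
    using meas integrable_distr_eq[OF meas, of "restricted_pair_prod S \<kappa> ?I"]
      integral_distr[OF meas, of "restricted_pair_prod S \<kappa> ?I"]
    unfolding has_bochner_integral_iff PiM_reindex[OF M J(1) h(1)] by auto
  moreover have "(\<lambda>x. restricted_pair_prod S \<kappa> ?I (\<lambda>i\<in>?I. x (h i))) = restricted_pair_prod S \<kappa> J"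
    by (intro ext restricted_pair_prod_reindex[OF h, symmetric])
  ultimately show "has_bochner_integral (\<Pi>\<^sub>M i\<in>J. M) (restricted_pair_prod S \<kappa> J)
      (fact (card J) * fps_nth (Abs_fps (\<lambda>n. integral\<^sup>L (\<Pi>\<^sub>M i\<in>{..<n}. M) (restricted_pair_prod S \<kappa> {..<n}) / fact n)) (card J))"
    by simp
qed

lemma has_partition_series_unique:
  assumes "has_partition_series M S \<kappa> N A" "has_partition_series M S \<kappa> N B" "n \<le> N"
  shows "fps_nth A n = fps_nth B n"
proof -
  have "fact n * fps_nth A n = fact n * fps_nth B n"
    using assms has_bochner_integral_eq[of "\<Pi>\<^sub>M i\<in>{..<n}. M" "restricted_pair_prod S \<kappa> {..<n}"]
    unfolding has_partition_series_def by (metis card_lessThan finite_lessThan)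
  then show ?thesis by simp
qed

section \<open>Nonarchimedean local fields\<close>

lemma absv_0 [simp]: "absv (0::'a::nonarch_valued_field) = 0"
  by (simp add: absv_eq_0_iff)

lemma absv_1 [simp]: "absv (1::'a::nonarch_valued_field) = 1"
proof -
  have "absv (1::'a) * absv (1::'a) = absv (1::'a) * 1" by (metis absv_mult mult_1_right)
  then show ?thesis using absv_eq_0_iff[of "1::'a"] by simp
qed

lemma absv_minus [simp]: "absv (- x) = absv (x::'a::nonarch_valued_field)"
proof -
  have "absv (-1::'a) ^ 2 = 1" by (simp add: power2_eq_square absv_mult[symmetric])
  then have "absv (-1::'a) = 1" using absv_nonneg[of "-1::'a"] by (simp add: power2_eq_1_iff)
  then show ?thesis using absv_mult[of "-1" x] by simp
qed

lemma absv_diff_commute: "absv (x - y) = absv (y - x :: 'a::nonarch_valued_field)"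
  by (metis absv_minus minus_diff_eq)

lemma absv_diff_le_max: "absv (x - y) \<le> max (absv x) (absv (y::'a::nonarch_valued_field))"
  using absv_add_le_max[of x "- y"] by simp

lemma absv_diff_le_max3:
  "absv (x - z) \<le> max (absv (x - y)) (absv (y - z :: 'a::nonarch_valued_field))"
  using absv_add_le_max[of "x - y" "y - z"] by simp

lemma absv_pos [simp]: "0 < absv (x::'a::nonarch_valued_field) \<longleftrightarrow> x \<noteq> 0"
  using absv_nonneg[of x] absv_eq_0_iff[of x] by linarith

lemma absv_divide: "absv (x / y) = absv x / absv (y::'a::nonarch_valued_field)"
proof (cases "y = 0")
  case False
  have "absv (x / y) * absv y = absv x" using False by (simp add: absv_mult[symmetric])
  then show ?thesis using False by (simp add: field_simps absv_eq_0_iff)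
qed simp

lemma absv_power: "absv (x ^ n) = absv (x::'a::nonarch_valued_field) ^ n"
  by (induction n) (auto simp: absv_mult)

text \<open>Every ultrametric triangle is isosceles, so a perturbation smaller than
  \<open>absv x\<close> cannot change the absolute value.\<close>

lemma absv_eq_if_close:
  fixes x y :: "'a::nonarch_valued_field"
  assumes "absv (x - y) < absv x"
  shows "absv y = absv x"
  using absv_diff_le_max[of x "x - y"] absv_add_le_max[of y "x - y"] assms by simp

lemma continuous_on_absv: "continuous_on S (absv :: 'a::nonarch_valued_field \<Rightarrow> real)"
proof (rule continuous_onI)
  fix x :: 'a and e :: real assume e: "0 < e"
  have le: "\<bar>absv y - absv x\<bar> \<le> absv (y - x)" for y :: 'a
    using absv_add_le_max[of "y - x" x] absv_add_le_max[of "x - y" y] absv_diff_commute[of x y]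
      absv_nonneg[of x] absv_nonneg[of y] absv_nonneg[of "x - y"] by (auto simp: max_def split: if_splits)
  have "\<forall>y\<in>S. dist y x < e \<longrightarrow> dist (absv y) (absv x) \<le> e"
  proof (intro ballI impI)
    fix y assume "dist y x < e"
    then show "dist (absv y) (absv x) \<le> e" using le[of y] by (simp add: dist_eq_absv dist_real_def)
  qed
  with e show "\<exists>d>0. \<forall>y\<in>S. dist y x < d \<longrightarrow> dist (absv y) (absv x) \<le> e" by blast
qed

lemma continuous_on_affine:
  fixes a c :: "'a::nonarch_valued_field"
  shows "continuous_on S (\<lambda>x. a + c * x)"
proof (cases "c = 0")
  case False
  show ?thesis
  proof (rule continuous_onI)
    fix x :: 'a and e :: real assume e: "0 < e"
    have "dist (a + c * y) (a + c * x) = absv c * dist y x" for y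
      by (simp add: dist_eq_absv absv_mult[symmetric] algebra_simps)
    then show "\<exists>d>0. \<forall>y\<in>S. dist y x < d \<longrightarrow> dist (a + c * y) (a + c * x) \<le> e"
      using False e by (intro exI[of _ "e / absv c"]) (auto simp: field_simps)
  qed
qed simp

lemma exists_small: "\<exists>a::'a::nonarch_local_field. a \<noteq> 0 \<and> absv a < 1"
proof -
  obtain x :: 'a where x: "absv x \<noteq> 0" "absv x \<noteq> 1" using absv_nontrivial by blast
  then have "x \<noteq> 0" by auto
  show ?thesis
  proof (cases "absv x < 1")
    case False
    then have "1 < absv x" using x by simp
    then have "absv (1 / x) < 1" by (auto simp: absv_divide divide_less_eq_1)
    with \<open>x \<noteq> 0\<close> show ?thesis by (intro exI[of _ "1 / x"]) auto
  qed (use \<open>x \<noteq> 0\<close> in auto)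
qed

text \<open>Local compactness gives a compact neighbourhood of 0; dividing by a high power of a
  small element enlarges it until it contains the given ball.\<close>

lemma compact_absv_le: "compact {x :: 'a::nonarch_local_field. absv x \<le> r}"
proof -
  have cball_eq: "{x :: 'a. absv x \<le> r} = cball 0 r" by (auto simp: dist_eq_absv)
  have "locally_compact_space (euclidean :: 'a topology)" by (rule locally_compact)
  then have "\<forall>x::'a. \<exists>U. open U \<and> (\<exists>K. compact K \<and> x \<in> U \<and> U \<subseteq> K)"
    unfolding locally_compact_space_def by simp
  then obtain U K where U: "open U" "compact K" "(0::'a) \<in> U" "U \<subseteq> K" by blast
  obtain e where e: "e > 0" "ball 0 e \<subseteq> U" using U open_contains_ball by blast
  obtain a :: 'a where a: "a \<noteq> 0" "absv a < 1" using exists_small by blast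
  \<comment> \<open>The denominator is |r| + 1 so that it is positive for every real
    \<open>r\<close>.\<close>
  obtain n where n: "absv a ^ n < e / (\<bar>r\<bar> + 1)"
    using real_arch_pow_inv[of "e / (\<bar>r\<bar> + 1)" "absv a"] e a by auto
  let ?f = "\<lambda>x. 0 + (1 / a ^ n) * x"
  have "cball 0 r \<subseteq> ?f ` K"
  proof
    fix x :: 'a assume "x \<in> cball 0 r"
    then have x: "absv x \<le> r" by (simp add: dist_eq_absv)
    have "absv (a ^ n * x) \<le> absv a ^ n * (\<bar>r\<bar> + 1)"
      using x by (simp add: absv_mult absv_power absv_nonneg mult_left_mono)
    also have "\<dots> < e" using n by (simp add: field_simps)
    finally have "a ^ n * x \<in> K" using e U by (auto simp: dist_eq_absv)
    moreover have "x = ?f (a ^ n * x)" using a by simp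
    ultimately show "x \<in> ?f ` K" by blast
  qed
  moreover have "compact (?f ` K)"
    using U by (intro compact_continuous_image continuous_on_affine)
  ultimately have "compact (cball (0::'a) r)"
    by (metis closed_cball closed_Int_compact inf.absorb1)
  then show ?thesis by (simp add: cball_eq)
qed

definition uniformizer :: "'a::nonarch_local_field" where
  "uniformizer = (SOME p. max_ideal = {p * r | r. r \<in> int_ring})"

text \<open>The maximal ideal is closed in the compact unit ball, hence compact, so the absolute
  value attains its maximum on it. An element of maximal absolute value divides all others, which
  justifies the choice in \<open>uniformizer\<close>.\<close>

lemma max_ideal_eq: "(max_ideal :: 'a::nonarch_local_field set) = {uniformizer * r | r. r \<in> int_ring}"
proof -
  obtain a :: 'a where a: "a \<noteq> 0" "absv a < 1" using exists_small by blast
  have "open (- max_ideal :: 'a set)"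
  proof (rule Topological_Spaces.openI)
    fix x :: 'a assume x: "x \<in> - max_ideal"
    then have "x \<noteq> 0" by (auto simp: max_ideal_def)
    moreover have "y \<in> - max_ideal" if "y \<in> ball x (absv x)" for y
      using x absv_eq_if_close[of x y] that by (simp add: dist_eq_absv max_ideal_def)
    ultimately show "\<exists>T. open T \<and> x \<in> T \<and> T \<subseteq> - max_ideal"
      by (intro exI[of _ "ball x (absv x)"]) auto
  qed
  then have "closed (max_ideal :: 'a set)" by (simp add: closed_def)
  moreover have "max_ideal = {x::'a. absv x \<le> 1} \<inter> max_ideal" by (auto simp: max_ideal_def)
  ultimately have comp: "compact (max_ideal :: 'a set)" by (metis compact_Int_closed compact_absv_le)
  have ne: "(max_ideal :: 'a set) \<noteq> {}" using a by (auto simp: max_ideal_def)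
  obtain p :: 'a where p: "p \<in> max_ideal" "\<forall>x\<in>max_ideal :: 'a set. absv x \<le> absv p"
    using continuous_attains_sup[OF comp ne continuous_on_absv] by blast
  have "absv a \<le> absv p" using p(2) a by (simp add: max_ideal_def)
  then have "p \<noteq> 0" using a absv_pos[of a] by (auto simp del: absv_pos)
  have "max_ideal = {p * r | r. r \<in> int_ring}"
  proof (intro equalityI subsetI)
    fix x assume "x \<in> (max_ideal :: 'a set)"
    then have "absv (x / p) \<le> 1" using p(2) \<open>p \<noteq> 0\<close> by (simp add: absv_divide)
    then show "x \<in> {p * r | r. r \<in> int_ring}" using \<open>p \<noteq> 0\<close>
      by (auto simp: int_ring_def intro!: exI[of _ "x / p"])
  next
    fix x assume "x \<in> {p * r | r. r \<in> int_ring}"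
    then obtain r where r: "x = p * r" "absv r \<le> 1" by (auto simp: int_ring_def)
    have "absv p * absv r \<le> absv p * 1" using r absv_nonneg by (intro mult_left_mono) auto
    with r p show "x \<in> max_ideal" by (simp add: max_ideal_def absv_mult)
  qed
  then show ?thesis unfolding uniformizer_def by (rule someI)
qed

lemma absv_uniformizer:
  "absv (uniformizer :: 'a::nonarch_local_field) = 1 / real (residue_card TYPE('a))"
  by (rule absv_generator[OF max_ideal_eq])

lemma uniformizer_nonzero [simp]: "uniformizer \<noteq> (0 :: 'a::nonarch_local_field)"
proof
  assume "uniformizer = (0::'a)"
  then have "max_ideal \<subseteq> {0::'a}" by (subst max_ideal_eq) auto
  moreover obtain a :: 'a where a: "a \<noteq> 0" "absv a < 1" using exists_small by blast
  ultimately show False by (auto simp: max_ideal_def)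
qed

lemma uniformizer_in_max_ideal: "uniformizer \<in> (max_ideal :: 'a::nonarch_local_field set)"
  unfolding max_ideal_eq by (auto intro!: exI[of _ 1] simp: int_ring_def)

text \<open>An infinite quotient would have \<open>card\<close> 0, and the normalisation axiom would
  give the uniformizer the absolute value 1 / 0 = 0. Finiteness of the residue field is thus already
  contained in the axiom.\<close>

lemma residue_card_gt_1: "residue_card TYPE('a::nonarch_local_field) > 1"
proof -
  have "0 < absv (uniformizer :: 'a)" "absv (uniformizer :: 'a) < 1"
    using uniformizer_in_max_ideal[where 'a = 'a] by (simp_all add: max_ideal_def)
  then show ?thesis unfolding absv_uniformizer
    by (cases "residue_card TYPE('a) = 0") (auto simp: field_simps)
qed

text \<open>Discreteness of the valuation: no value lies strictly between 1 / q and 1. Residue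
  classes thereby become discs described by a non-strict inequality.\<close>

lemma absv_lt_1_iff:
  "absv x < 1 \<longleftrightarrow> absv (x::'a::nonarch_local_field) \<le> 1 / real (residue_card TYPE('a))"
proof
  assume "absv x < 1"
  then have "x \<in> max_ideal" by (simp add: max_ideal_def)
  then obtain r where r: "x = uniformizer * r" "absv r \<le> 1"
    unfolding max_ideal_eq by (auto simp: int_ring_def)
  have "absv (uniformizer :: 'a) * absv r \<le> absv (uniformizer :: 'a) * 1"
    using r absv_nonneg by (intro mult_left_mono) auto
  then show "absv x \<le> 1 / real (residue_card TYPE('a))"
    by (simp add: r absv_mult absv_uniformizer)
next
  assume "absv x \<le> 1 / real (residue_card TYPE('a))"
  moreover have "1 / real (residue_card TYPE('a)) < 1" using residue_card_gt_1[where 'a = 'a] by simp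
  ultimately show "absv x < 1" by linarith
qed

definition is_residue_system :: "'a::nonarch_local_field set \<Rightarrow> bool" where
  "is_residue_system D \<longleftrightarrow> finite D \<and> card D = residue_card TYPE('a) \<and> D \<subseteq> int_ring \<and>
     (\<forall>x\<in>int_ring. \<exists>!d\<in>D. absv (x - d) < 1)"

lemma residue_system_exists: "\<exists>D :: 'a::nonarch_local_field set. is_residue_system D"
proof -
  define r where "r = {(x, y :: 'a). x \<in> int_ring \<and> y \<in> int_ring \<and> x - y \<in> max_ideal}"
  have r: "(x, y) \<in> r \<longleftrightarrow> x \<in> int_ring \<and> y \<in> int_ring \<and> absv (x - y) < 1" for x y
    by (simp add: r_def max_ideal_def)
  define Q where "Q = int_ring // r"
  have lt: "absv (x - z) < 1" if "absv (x - y) < 1" "absv (y - z) < 1" for x y z :: 'a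
    using absv_diff_le_max3[of x z y] that by simp
  have eqv: "equiv int_ring r"
  proof (rule equivI)
    show "r \<subseteq> int_ring \<times> int_ring" using r by auto
    show "refl_on int_ring r" using r by (auto simp: refl_on_def)
    show "sym r" unfolding sym_def using r absv_diff_commute by metis
    show "trans r" unfolding trans_def using r lt by blast
  qed
  have card: "card Q = residue_card TYPE('a)" by (simp add: residue_card_def Q_def r_def)
  then have fin: "finite Q" using residue_card_gt_1[where 'a = 'a] card.infinite[of Q] by fastforce
  define s where "s X = (SOME x. x \<in> X)" for X :: "'a set"
  have s: "s X \<in> X" if "X \<in> Q" for X
    using in_quotient_imp_non_empty[OF eqv] that unfolding s_def Q_def by (simp add: some_in_eq)
  have sR: "s X \<in> int_ring" if "X \<in> Q" for X
    using in_quotient_imp_subset[OF eqv] s[OF that] that unfolding Q_def by blast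
  have disj: "X = Y" if "X \<in> Q" "Y \<in> Q" "x \<in> X" "x \<in> Y" for X Y x
    using quotient_disj[OF eqv] that unfolding Q_def by blast
  have inj: "inj_on s Q"
    using disj s by (metis inj_onI)
  have "is_residue_system (s ` Q)"
    unfolding is_residue_system_def
  proof (intro conjI ballI)
    show "card (s ` Q) = residue_card TYPE('a)" using card card_image[OF inj] by simp
    show "finite (s ` Q)" using fin by simp
    show "s ` Q \<subseteq> int_ring" using sR by blast
    fix x :: 'a assume x: "x \<in> int_ring"
    let ?X = "r `` {x}"
    have X: "?X \<in> Q" using x unfolding Q_def by (rule quotientI)
    have sX: "absv (x - s ?X) < 1" using s[OF X] r by blast
    show "\<exists>!d\<in>s ` Q. absv (x - d) < 1"
    proof (rule ex1I[of _ "s ?X"])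
      show "s ?X \<in> s ` Q \<and> absv (x - s ?X) < 1" using X sX by blast
    next
      fix d assume "d \<in> s ` Q \<and> absv (x - d) < 1"
      then obtain Y where Y: "Y \<in> Q" "d = s Y" "absv (x - s Y) < 1" by blast
      then have "s Y \<in> ?X" using x sR[OF Y(1)] r by blast
      then have "Y = ?X" using disj[OF Y(1) X s[OF Y(1)]] by blast
      with Y show "d = s ?X" by simp
    qed
  qed
  then show ?thesis by blast
qed

section \<open>Discs of radius q^(-m) and their splitting into q smaller ones\<close>

definition disc :: "'a::nonarch_local_field \<Rightarrow> nat \<Rightarrow> 'a set" where
  "disc a m = {x. absv (x - a) \<le> (1 / real (residue_card TYPE('a))) ^ m}"

lemma disc_0_0: "disc 0 0 = int_ring"
  by (simp add: disc_def int_ring_def)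

lemma absv_uniformizer_power:
  "absv ((uniformizer :: 'a::nonarch_local_field) ^ m) = (1 / real (residue_card TYPE('a))) ^ m"
  by (simp only: absv_power absv_uniformizer)

lemma disc_radius_pos: "0 < (1 / real (residue_card TYPE('a::nonarch_local_field))) ^ m"
  using residue_card_gt_1[where 'a = 'a] by (intro zero_less_power) simp

lemma disc_radius_mono:
  "m \<le> n \<Longrightarrow> (1 / real (residue_card TYPE('a::nonarch_local_field))) ^ n \<le> (1 / real (residue_card TYPE('a))) ^ m"
  using residue_card_gt_1[where 'a = 'a] by (intro power_decreasing) auto

text \<open>By the ultrametric inequality every point of a disc is a centre of it.\<close>

lemma disc_eq_if_mem:
  assumes "b \<in> disc a m"
  shows "disc b m = disc (a::'a::nonarch_local_field) m"
proof -
  have ab: "absv (b - a) \<le> (1 / real (residue_card TYPE('a))) ^ m" using assms by (simp add: disc_def)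
  have "absv (x - a) \<le> (1 / real (residue_card TYPE('a))) ^ m"
    if "absv (x - b) \<le> (1 / real (residue_card TYPE('a))) ^ m" for x
    by (rule order_trans[OF absv_diff_le_max3[of x a b]]) (simp add: that ab)
  moreover have "absv (x - b) \<le> (1 / real (residue_card TYPE('a))) ^ m"
    if "absv (x - a) \<le> (1 / real (residue_card TYPE('a))) ^ m" for x
    by (rule order_trans[OF absv_diff_le_max3[of x b a]]) (simp add: that ab absv_diff_commute[of a b])
  ultimately show ?thesis unfolding disc_def by blast
qed

lemma disc_subset: "m \<le> n \<Longrightarrow> disc a n \<subseteq> disc a m"
  unfolding disc_def using order_trans[OF _ disc_radius_mono] by blast

text \<open>Two discs are disjoint or nested. Together with the empty set they are therefore stable
  under intersection, as the uniqueness theorem for measures requires.\<close>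

lemma disc_Int:
  assumes "m \<le> n" "disc a m \<inter> disc b n \<noteq> {}"
  shows "disc a m \<inter> disc b n = disc b n"
proof -
  obtain x where x: "x \<in> disc a m" "x \<in> disc b n" using assms by blast
  have "disc b n = disc x n" "disc a m = disc x m"
    using disc_eq_if_mem[OF x(1)] disc_eq_if_mem[OF x(2)] by simp_all
  with disc_subset[OF assms(1), of x] show ?thesis by auto
qed

lemma disc_subset_int_ring: "a \<in> int_ring \<Longrightarrow> disc a m \<subseteq> (int_ring :: 'a::nonarch_local_field set)"
  using disc_subset[of 0 m a] disc_eq_if_mem[of a 0 0] by (simp add: disc_0_0)

lemma open_disc: "open (disc a m :: 'a::nonarch_local_field set)"
proof (rule Topological_Spaces.openI)
  fix x assume x: "x \<in> disc a m"
  let ?B = "ball x ((1 / real (residue_card TYPE('a))) ^ m)"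
  have "x \<in> ?B" using disc_radius_pos by (simp add: centre_in_ball)
  moreover have "?B \<subseteq> disc x m" by (auto simp: disc_def dist_eq_absv absv_diff_commute)
  ultimately show "\<exists>T. open T \<and> x \<in> T \<and> T \<subseteq> disc a m"
    using disc_eq_if_mem[OF x] by (intro exI[of _ ?B]) auto
qed

lemma disc_borel [measurable]: "disc a m \<in> sets borel"
  by (intro borel_open open_disc)

lemma int_ring_borel [measurable]: "(int_ring :: 'a::nonarch_local_field set) \<in> sets borel"
  using disc_borel[of 0 0] by (simp add: disc_0_0)

lemma disc_radius_tendsto: "\<exists>m. (1 / real (residue_card TYPE('a::nonarch_local_field))) ^ m < e" if "0 < e"
  using residue_card_gt_1[where 'a = 'a] that by (intro real_arch_pow_inv) auto

text \<open>Translating by \<open>a\<close> and dividing by the m-th power of the uniformizer turns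
  the subdiscs into the residue classes of \<open>int_ring\<close>.\<close>

lemma disc_split:
  assumes D: "is_residue_system (D :: 'a::nonarch_local_field set)"
  shows "disc a m = (\<Union>d\<in>D. disc (a + uniformizer ^ m * d) (Suc m))"
    and "disjoint_family_on (\<lambda>d. disc (a + uniformizer ^ m * d) (Suc m)) D"
proof -
  let ?p = "(uniformizer :: 'a) ^ m" and ?r = "1 / real (residue_card TYPE('a))"
  have ap: "absv ?p = ?r ^ m" by (rule absv_uniformizer_power)
  have mem: "x \<in> disc (a + ?p * d) (Suc m) \<longleftrightarrow> absv ((x - a) / ?p - d) < 1" for x d
  proof -
    have "?p * ((x - a) / ?p) = x - a" by simp
    then have "x - (a + ?p * d) = ?p * ((x - a) / ?p - d)" by (simp only: right_diff_distrib diff_diff_eq)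
    then have "absv (x - (a + ?p * d)) = ?r ^ m * absv ((x - a) / ?p - d)"
      by (simp only: absv_mult ap)
    moreover have "?r ^ Suc m = ?r ^ m * ?r" by (simp only: power_Suc mult.commute)
    ultimately show ?thesis
      by (simp only: disc_def mem_Collect_eq absv_lt_1_iff mult_le_cancel_left_pos[OF disc_radius_pos])
  qed
  have mem0: "x \<in> disc a m \<longleftrightarrow> (x - a) / ?p \<in> int_ring" for x
    using disc_radius_pos[where 'a = 'a, of m] by (simp add: disc_def int_ring_def absv_divide ap field_simps)
  have D': "D \<subseteq> int_ring" "\<And>x. x \<in> int_ring \<Longrightarrow> \<exists>!d\<in>D. absv (x - d) < 1"
    using D by (auto simp: is_residue_system_def)
  have near: "y \<in> int_ring" if "d \<in> D" "absv (y - d) < 1" for y d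
    using absv_add_le_max[of "y - d" d] that D'(1) by (auto simp: int_ring_def max_def split: if_splits)
  show "disc a m = (\<Union>d\<in>D. disc (a + ?p * d) (Suc m))"
  proof (intro equalityI subsetI)
    fix x assume "x \<in> disc a m"
    then obtain d where "d \<in> D" "absv ((x - a) / ?p - d) < 1" using D'(2) mem0 by blast
    then show "x \<in> (\<Union>d\<in>D. disc (a + ?p * d) (Suc m))" unfolding UN_iff mem by blast
  next
    fix x assume "x \<in> (\<Union>d\<in>D. disc (a + ?p * d) (Suc m))"
    then obtain d where "d \<in> D" "absv ((x - a) / ?p - d) < 1" unfolding UN_iff mem by blast
    then show "x \<in> disc a m" using near mem0 by blast
  qed
  show "disjoint_family_on (\<lambda>d. disc (a + ?p * d) (Suc m)) D"
    unfolding disjoint_family_on_def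
  proof (intro ballI impI)
    fix c d assume cd: "c \<in> D" "d \<in> D" "c \<noteq> d"
    have False if "absv (y - c) < 1" "absv (y - d) < 1" for y
      using D'(2)[OF near[OF cd(1) that(1)]] cd that by blast
    then show "disc (a + ?p * c) (Suc m) \<inter> disc (a + ?p * d) (Suc m) = {}"
      unfolding disjoint_iff mem by blast
  qed
qed

text \<open>Balls of radius \<open>n\<close> are compact and so totally bounded; finite nets of
  scale 1 / (m + 1), collected over all \<open>n\<close> and \<open>m\<close>, are countable and
  dense.\<close>

lemma countable_dense_exists:
  "\<exists>E :: 'a::nonarch_local_field set. countable E \<and> (\<forall>x. \<forall>e>0. \<exists>y\<in>E. absv (x - y) < e)"
proof -
  have "\<exists>k. finite k \<and> {x :: 'a. absv x \<le> real n} \<subseteq> (\<Union>x\<in>k. ball x (1 / real (Suc m)))" for n m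
    using compact_eq_totally_bounded[THEN iffD1, OF compact_absv_le, THEN conjunct2, rule_format, of "1 / real (Suc m)" "real n"]
    by simp
  note ex = this
  define k where "k n m = (SOME k. finite k \<and> {x :: 'a. absv x \<le> real n} \<subseteq> (\<Union>x\<in>k. ball x (1 / real (Suc m))))" for n m
  have k: "finite (k n m)" "{x :: 'a. absv x \<le> real n} \<subseteq> (\<Union>x\<in>k n m. ball x (1 / real (Suc m)))" for n m
    using someI_ex[OF ex[of n m]] unfolding k_def by (rule conjunct1, rule conjunct2)
  let ?E = "\<Union>n m. k n m"
  have "\<exists>y\<in>?E. absv (x - y) < e" if "0 < e" for x and e :: real
  proof -
    obtain n where n: "absv x \<le> real n" using real_arch_simple by blast
    obtain m where m: "1 / real (Suc m) < e" using nat_approx_posE[OF \<open>0 < e\<close>] by metis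
    have "x \<in> (\<Union>x\<in>k n m. ball x (1 / real (Suc m)))" using n k(2)[of n m] by blast
    then obtain y where y: "y \<in> k n m" "dist y x < 1 / real (Suc m)" unfolding UN_iff mem_ball by blast
    then have "absv (x - y) < e" using m unfolding dist_eq_absv absv_diff_commute[of y x] by linarith
    with y(1) show ?thesis by blast
  qed
  moreover have "countable ?E" by (intro countable_UN countableI_type countable_finite k(1))
  ultimately show ?thesis by blast
qed

text \<open>Measurability is required for the product of two Borel sigma-algebras. By the
  ultrametric inequality two points are closer than \<open>r\<close> exactly if one ball of radius
  \<open>r\<close> contains both, and centres in a countable dense set suffice. The sublevel set is
  thus a countable union of squares.\<close>

lemma measurable_absv_diff:
  "(\<lambda>(x, y). absv (x - y)) \<in> borel_measurable (borel \<Otimes>\<^sub>M (borel :: 'a::nonarch_local_field measure))"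
proof (rule borel_measurableI_less)
  fix r :: real
  obtain E :: "'a set" where E: "countable E" "\<And>x e. 0 < e \<Longrightarrow> \<exists>y\<in>E. absv (x - y) < e"
    using countable_dense_exists by blast
  let ?B = "\<lambda>e. {x. absv (x - e) < r}"
  have B: "?B e \<in> sets borel" for e
  proof -
    have "?B e = ball e r" by (auto simp: dist_eq_absv absv_diff_commute)
    then show ?thesis by simp
  qed
  have "{w \<in> space (borel \<Otimes>\<^sub>M (borel :: 'a measure)). (case w of (x, y) \<Rightarrow> absv (x - y)) < r} = (\<Union>e\<in>E. ?B e \<times> ?B e)"
  proof (intro equalityI subsetI)
    fix w assume "w \<in> {w \<in> space (borel \<Otimes>\<^sub>M (borel :: 'a measure)). (case w of (x, y) \<Rightarrow> absv (x - y)) < r}"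
    then obtain x y :: 'a where w: "w = (x, y)" "absv (x - y) < r" by (cases w) auto
    then have "0 < r" using absv_nonneg[of "x - y"] by linarith
    then obtain e where e: "e \<in> E" "absv (x - e) < r" using E(2) by blast
    have "absv (y - e) < r" using absv_diff_le_max3[of y e x] w(2) e(2) absv_diff_commute[of x y] by simp
    with w e show "w \<in> (\<Union>e\<in>E. ?B e \<times> ?B e)" by auto
  next
    fix w assume "w \<in> (\<Union>e\<in>E. ?B e \<times> ?B e)"
    then obtain x y e where w: "w = (x, y)" "absv (x - e) < r" "absv (y - e) < r" by (cases w) auto
    then have "absv (x - y) < r"
      using absv_diff_le_max3[of x y e] absv_diff_commute[of e y] by simp
    with w show "w \<in> {w \<in> space (borel \<Otimes>\<^sub>M (borel :: 'a measure)). (case w of (x, y) \<Rightarrow> absv (x - y)) < r}"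
      by (simp add: space_pair_measure)
  qed
  moreover have "(\<Union>e\<in>E. ?B e \<times> ?B e) \<in> sets (borel \<Otimes>\<^sub>M borel)"
    using B by (intro sets.countable_UN'[OF E(1)] subsetI) auto
  ultimately show "{w \<in> space (borel \<Otimes>\<^sub>M (borel :: 'a measure)). (case w of (x, y) \<Rightarrow> absv (x - y)) < r} \<in> sets (borel \<Otimes>\<^sub>M (borel :: 'a measure))"
    by simp
qed

section \<open>Haar measure\<close>

lemma disc_cover_exists: "\<exists>a :: nat \<Rightarrow> 'a::nonarch_local_field. (\<Union>i. disc (a i) 0) = UNIV"
proof -
  obtain E :: "'a set" where E: "countable E" "\<And>x e. 0 < e \<Longrightarrow> \<exists>y\<in>E. absv (x - y) < e"
    using countable_dense_exists by blast
  then have "E \<noteq> {}" using zero_less_one by blast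
  have "x \<in> (\<Union>i. disc (from_nat_into E i) 0)" for x
  proof -
    obtain y where y: "y \<in> E" "absv (x - y) < 1" using E(2)[of 1 x] by auto
    then have "x \<in> disc y 0" by (simp add: disc_def)
    moreover obtain i where "from_nat_into E i = y" using from_nat_into_surj[OF E(1) y(1)] by blast
    ultimately show ?thesis by blast
  qed
  then show ?thesis by (intro exI[of _ "from_nat_into E"]) auto
qed

text \<open>An open set is the union of the discs inside it whose centres lie in a countable dense
  set, and there are only countably many of those.\<close>

lemma borel_eq_sigma_sets_disc:
  "sets (borel :: 'a::nonarch_local_field measure) = sigma_sets UNIV (insert {} (range (\<lambda>(a, m). disc a m)))"
    (is "_ = sigma_sets UNIV ?E")
proof (rule antisym)
  have op: "U \<in> sigma_sets UNIV ?E" if U: "open U" for U :: "'a set"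
  proof -
    obtain E :: "'a set" where E: "countable E" "\<And>x e. 0 < e \<Longrightarrow> \<exists>y\<in>E. absv (x - y) < e"
      using countable_dense_exists by blast
    define F where "F = {(y, m). y \<in> E \<and> disc y m \<subseteq> U}"
    have "F \<subseteq> E \<times> UNIV" by (auto simp: F_def)
    then have cF: "countable F" using E(1) by (metis countable_SIGMA countableI_type countable_subset)
    have "U = (\<Union>p\<in>F. case p of (y, m) \<Rightarrow> disc y m)"
    proof (intro equalityI subsetI)
      fix x assume x: "x \<in> U"
      then obtain e where e: "e > 0" "ball x e \<subseteq> U" using U open_contains_ball by blast
      obtain m where m: "(1 / real (residue_card TYPE('a))) ^ m < e" using disc_radius_tendsto[OF e(1)] by blast
      obtain y where y: "y \<in> E" "absv (x - y) < (1 / real (residue_card TYPE('a))) ^ m"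
        using E(2)[OF disc_radius_pos] by blast
      then have xy: "x \<in> disc y m" by (simp add: disc_def)
      have "disc y m = disc x m" using disc_eq_if_mem[OF xy] by simp
      moreover have "disc x m \<subseteq> ball x e" using m by (auto simp: disc_def dist_eq_absv absv_diff_commute)
      ultimately have "(y, m) \<in> F" using y(1) e(2) by (auto simp: F_def)
      with xy show "x \<in> (\<Union>p\<in>F. case p of (y, m) \<Rightarrow> disc y m)" by blast
    qed (auto simp: F_def)
    moreover have "(\<Union>p\<in>F. case p of (y, m) \<Rightarrow> disc y m) \<in> sigma_sets UNIV ?E"
    proof (rule sigma_sets_UNION)
      fix B assume "B \<in> (\<lambda>p. case p of (y, m) \<Rightarrow> disc y m) ` F"
      then have "B \<in> ?E" by blast
      then show "B \<in> sigma_sets UNIV ?E" by (rule sigma_sets.Basic)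
    qed (use cF in simp)
    ultimately show ?thesis by simp
  qed
  then have "sigma_sets UNIV {U :: 'a set. open U} \<subseteq> sigma_sets UNIV ?E"
    by (intro sigma_sets_mono) auto
  then show "sets (borel :: 'a measure) \<subseteq> sigma_sets UNIV ?E"
    by (simp add: borel_def)
  have E: "?E \<subseteq> sets (borel :: 'a measure)"
  proof
    fix B assume "B \<in> ?E"
    then consider "B = {}" | a m where "B = disc a m" by auto
    then show "B \<in> sets borel" by cases auto
  qed
  show "sigma_sets UNIV ?E \<subseteq> sets (borel :: 'a measure)"
    using sets.sigma_sets_subset[of ?E "borel :: 'a measure"] E by simp
qed

lemma measure_eqI_disc:
  fixes M1 M2 :: "'a::nonarch_local_field measure"
  assumes sets: "sets M1 = sets borel" "sets M2 = sets borel"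
    and eq: "\<And>a m. emeasure M1 (disc a m) = emeasure M2 (disc a m)"
    and fin: "\<And>a. emeasure M1 (disc a 0) \<noteq> \<infinity>"
  shows "M1 = M2"
proof -
  obtain a :: "nat \<Rightarrow> 'a" where a: "(\<Union>i. disc (a i) 0) = UNIV" using disc_cover_exists by blast
  let ?E = "insert {} (range (\<lambda>(a :: 'a, m). disc a m))"
  show ?thesis
  proof (rule measure_eqI_generator_eq[of ?E UNIV M1 M2 "\<lambda>i. disc (a i) 0"])
    have dd: "disc b m \<inter> disc c n \<in> ?E" for b c :: 'a and m n
    proof (cases "disc b m \<inter> disc c n = {}")
      case False
      then have "disc b m \<inter> disc c n = disc c n \<or> disc b m \<inter> disc c n = disc b m"
        using disc_Int[of m n b c] disc_Int[of n m c b] by (cases "m \<le> n") (auto simp: Int_commute)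
      moreover have "disc c n \<in> ?E" "disc b m \<in> ?E" by auto
      ultimately show ?thesis by metis
    qed simp
    show "Int_stable ?E"
    proof (rule Int_stableI)
      fix X Y assume "X \<in> ?E" "Y \<in> ?E"
      then consider "X = {} \<or> Y = {}" | b m c n where "X = disc b m" "Y = disc c n" by auto
      then show "X \<inter> Y \<in> ?E" using dd by cases auto
    qed
    show "emeasure M1 X = emeasure M2 X" if "X \<in> ?E" for X
      using that eq by auto
    show "sets M1 = sigma_sets UNIV ?E" "sets M2 = sigma_sets UNIV ?E"
      using sets borel_eq_sigma_sets_disc by blast+
  qed (use fin a in auto)
qed

text \<open>A disc of level \<open>m\<close> splits into q translates of level \<open>m + 1\<close>,
  so each level costs a factor q. Invariance is assumed only for centres in \<open>int_ring\<close>,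
  so that the lemma serves the Haar measure as well as the part of the invariant measure carried by
  the affine chart.\<close>

lemma emeasure_disc_eq_power:
  fixes M :: "'a::nonarch_local_field measure"
  assumes sets: "sets M = sets borel"
    and trans: "\<And>a m. a \<in> int_ring \<Longrightarrow> emeasure M (disc a m) = emeasure M (disc 0 m)"
  shows "emeasure M (disc 0 m) = ennreal ((1 / real (residue_card TYPE('a))) ^ m) * emeasure M int_ring"
proof (induction m)
  case 0
  then show ?case by (simp add: disc_0_0)
next
  case (Suc m)
  let ?q = "residue_card TYPE('a)"
  let ?r = "1 / real ?q"
  have q: "real ?q > 1" using residue_card_gt_1[where 'a = 'a] by simp
  obtain D :: "'a set" where D: "is_residue_system D" using residue_system_exists by blast
  then have fin: "finite D" "card D = ?q" "D \<subseteq> int_ring" by (auto simp: is_residue_system_def)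
  \<comment> \<open>The new centres stay in \<open>int_ring\<close>, where invariance is
    available.\<close>
  have R: "0 + uniformizer ^ m * d \<in> int_ring" if "d \<in> D" for d
  proof -
    have "?r ^ m * absv d \<le> 1 * 1"
      using that fin(3) q by (intro mult_mono power_le_one) (auto simp: int_ring_def absv_nonneg)
    then show ?thesis by (simp only: int_ring_def mem_Collect_eq add_0 absv_mult absv_uniformizer_power mult_1)
  qed
  have "emeasure M (disc 0 m) = (\<Sum>d\<in>D. emeasure M (disc (0 + uniformizer ^ m * d) (Suc m)))"
    by (subst disc_split(1)[OF D], rule sum_emeasure[symmetric])
      (use disc_split(2)[OF D, of 0 m] fin in \<open>auto simp: sets\<close>)
  also have "\<dots> = (\<Sum>d\<in>D. emeasure M (disc 0 (Suc m)))"
    by (intro sum.cong refl trans R)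
  also have "\<dots> = ennreal (real ?q) * emeasure M (disc 0 (Suc m))"
    using fin by (simp add: ennreal_of_nat_eq_real_of_nat)
  finally have "ennreal ?r * emeasure M (disc 0 m) = ennreal ?r * ennreal (real ?q) * emeasure M (disc 0 (Suc m))"
    by (simp only: mult.assoc)
  also have "ennreal ?r * ennreal (real ?q) = 1"
    using q by (simp add: ennreal_mult[symmetric])
  finally have "emeasure M (disc 0 (Suc m)) = ennreal ?r * (ennreal (?r ^ m) * emeasure M int_ring)"
    unfolding Suc by simp
  also have "\<dots> = ennreal (?r ^ Suc m) * emeasure M int_ring"
    using q by (simp only: power_Suc mult.assoc[symmetric]) (subst ennreal_mult, auto)
  finally show ?case .
qed

lemma measurable_affine: "(\<lambda>x. a + c * x) \<in> borel_measurable (borel :: 'a::nonarch_local_field measure)"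
  by (intro borel_measurable_continuous_onI continuous_on_affine)

context
  fixes \<mu> :: "'k::nonarch_local_field measure"
  assumes haar: "is_normalized_haar \<mu>"
begin

lemma haar_sets [simp, measurable_cong]: "sets \<mu> = sets borel"
  using haar by (simp add: is_normalized_haar_def)

lemma haar_space [simp]: "space \<mu> = UNIV"
  using sets_eq_imp_space_eq[OF haar_sets] by simp

lemma haar_int_ring: "emeasure \<mu> int_ring = 1"
  using haar by (simp add: is_normalized_haar_def)

lemma haar_disc_translate: "emeasure \<mu> (disc a m) = emeasure \<mu> (disc 0 m)"
proof -
  have "(\<lambda>x. a + x) ` disc 0 m = disc a m"
  proof (intro equalityI subsetI)
    fix x assume "x \<in> disc a m"
    then show "x \<in> (\<lambda>x. a + x) ` disc 0 m"
      by (intro image_eqI[of _ _ "x - a"]) (auto simp: disc_def)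
  qed (auto simp: disc_def)
  moreover have "emeasure \<mu> ((\<lambda>x. a + x) ` disc 0 m) = emeasure \<mu> (disc 0 m)"
    using haar by (simp add: is_normalized_haar_def)
  ultimately show ?thesis by simp
qed

lemma haar_disc: "emeasure \<mu> (disc a m) = ennreal ((1 / real (residue_card TYPE('k))) ^ m)"
  using emeasure_disc_eq_power[OF haar_sets haar_disc_translate, of m] haar_disc_translate[of a m]
  by (simp add: haar_int_ring)

lemma haar_sigma_finite: "sigma_finite_measure \<mu>"
proof
  obtain a :: "nat \<Rightarrow> 'k" where a: "(\<Union>i. disc (a i) 0) = UNIV" using disc_cover_exists by blast
  show "\<exists>A. countable A \<and> A \<subseteq> sets \<mu> \<and> \<Union> A = space \<mu> \<and> (\<forall>a\<in>A. emeasure \<mu> a \<noteq> \<infinity>)"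
    using a by (intro exI[of _ "range (\<lambda>i. disc (a i) 0)"]) (auto simp: haar_disc)
qed

text \<open>The image of \<mu> under the inverse map agrees with 1 / q times \<mu> on all discs,
  because that map shifts the level by one; hence the two measures are equal.\<close>

lemma haar_scale:
  assumes A: "A \<in> sets borel"
  shows "emeasure \<mu> (A \<inter> disc a 1) =
    ennreal (1 / real (residue_card TYPE('k))) * emeasure \<mu> ((\<lambda>x. a + uniformizer * x) -` A \<inter> int_ring)"
proof -
  let ?r = "1 / real (residue_card TYPE('k))"
  \<comment> \<open>The inverse of \<open>x \<mapsto> a + uniformizer * x\<close>, in a form to
    which \<open>measurable_affine\<close> applies.\<close>
  let ?T = "\<lambda>x::'k. (- a / uniformizer) + (1 / uniformizer) * x"
  have T [measurable]: "?T \<in> measurable \<mu> borel"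
    unfolding measurable_cong_sets[OF haar_sets refl] by (rule measurable_affine)
  have r: "0 < ?r" using disc_radius_pos[where 'a = 'k, of 1] by simp
  have T_eq: "?T x = (x - a) / uniformizer" for x by (simp add: diff_divide_distrib)
  have Tdisc: "?T -` disc b n = disc (a + uniformizer * b) (Suc n)" for b n
  proof -
    have "absv ((x - a) / uniformizer - b) \<le> ?r ^ n \<longleftrightarrow> absv (x - (a + uniformizer * b)) \<le> ?r ^ Suc n" for x
    proof -
      have "uniformizer * ((x - a) / uniformizer) = x - a" by simp
      then have "x - (a + uniformizer * b) = uniformizer * ((x - a) / uniformizer - b)"
        by (simp only: right_diff_distrib diff_diff_eq)
      then have "absv (x - (a + uniformizer * b)) = ?r * absv ((x - a) / uniformizer - b)"
        by (simp only: absv_mult absv_uniformizer)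
      then show ?thesis using r by (simp only: power_Suc mult_le_cancel_left_pos)
    qed
    then show ?thesis unfolding T_eq by (auto simp only: disc_def vimage_def mem_Collect_eq)
  qed
  have "distr \<mu> borel ?T = density \<mu> (\<lambda>_. ennreal ?r)"
  proof (rule measure_eqI_disc)
    fix b n
    have "emeasure (distr \<mu> borel ?T) (disc b n) = ennreal (?r ^ Suc n)"
      by (subst emeasure_distr) (simp_all only: T disc_borel haar_space Int_UNIV_right Tdisc haar_disc)
    also have "\<dots> = ennreal ?r * emeasure \<mu> (disc b n)"
      by (simp only: haar_disc power_Suc) (rule ennreal_mult; use r in simp)
    finally show "emeasure (distr \<mu> borel ?T) (disc b n) = emeasure (density \<mu> (\<lambda>_. ennreal ?r)) (disc b n)"
      by (simp add: emeasure_density_const)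
    then show "emeasure (distr \<mu> borel ?T) (disc b 0) \<noteq> \<infinity>"
      by (subst emeasure_distr) (simp_all only: T disc_borel haar_space Int_UNIV_right Tdisc haar_disc, simp)
  qed simp_all
  then have distr_eq: "emeasure (distr \<mu> borel ?T) B = ennreal ?r * emeasure \<mu> B" if "B \<in> sets borel" for B
    using that by (simp add: emeasure_density_const)
  have scale: "emeasure \<mu> (?T -` B) = ennreal ?r * emeasure \<mu> B" if "B \<in> sets borel" for B
    using distr_eq[OF that] emeasure_distr[OF T that] by (simp only: haar_space Int_UNIV_right)
  have B: "(\<lambda>x. a + uniformizer * x) -` A \<inter> int_ring \<in> sets borel"
    using measurable_sets[OF measurable_affine A, of a uniformizer] by (simp add: int_ring_borel)
  have "a + uniformizer * ?T x = x" for x by (simp only: T_eq) simp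
  then have "?T -` ((\<lambda>x. a + uniformizer * x) -` A \<inter> int_ring) = A \<inter> ?T -` disc 0 0"
    by (auto simp only: disc_0_0 vimage_def)
  also have "?T -` disc 0 0 = disc a 1" using Tdisc[of 0 0] by simp
  finally show ?thesis using scale[OF B] by simp
qed

end

section \<open>Self-similarity and finiteness\<close>

text \<open>Multiplying by \<open>fps_X\<close> turns differentiation into the operator that weights
  the n-th coefficient by n, so that equal indices face each other. Of the two convolutions the
  terms \<open>i = 0\<close> and \<open>i = n\<close> are split off, since they contain the unknown
  top coefficients.\<close>

lemma fps_power_coeff_rec:
  fixes B :: "'b::field_char_0 fps"
  assumes B0: "fps_nth B 0 = 1" and n: "1 \<le> n"
  shows "of_nat n * fps_nth (B ^ q) n = of_nat q * of_nat n * fps_nth B n +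
    (\<Sum>i=1..<n. of_nat q * of_nat i * fps_nth B i * fps_nth (B ^ q) (n - i)
                - of_nat i * fps_nth (B ^ q) i * fps_nth B (n - i))"
proof -
  let ?A = "B ^ q"
  have A0: "fps_nth ?A 0 = 1" using B0 by (simp add: startsby_one_power)
  have "fps_deriv ?A * B = of_nat q * (fps_deriv B * ?A)"
  proof (induction q)
    case (Suc p)
    have "fps_deriv (B ^ Suc p) * B = B * (fps_deriv (B ^ p) * B) + fps_deriv B * B ^ Suc p"
      by (simp add: algebra_simps)
    then show ?case unfolding Suc by (simp add: algebra_simps)
  qed simp
  then have "fps_X * fps_deriv ?A * B = of_nat q * (fps_X * fps_deriv B * ?A)"
    by (metis mult.assoc mult.left_commute)
  then have "fps_nth (fps_X * fps_deriv ?A * B) n = of_nat q * fps_nth (fps_X * fps_deriv B * ?A) n"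
    by (simp only: fps_of_nat[symmetric] fps_mult_left_const_nth)
  moreover have X: "fps_nth (fps_X * fps_deriv F) i = of_nat i * fps_nth F i" for F :: "'b fps" and i
    by (cases i) simp_all
  ultimately have "(\<Sum>i=0..n. of_nat i * fps_nth ?A i * fps_nth B (n - i)) =
      of_nat q * (\<Sum>i=0..n. of_nat i * fps_nth B i * fps_nth ?A (n - i))"
    by (simp only: fps_mult_nth[of "fps_X * _"] X)
  moreover have split: "(\<Sum>i=0..n. f i) = f 0 + f n + (\<Sum>i=1..<n. f i)" for f :: "nat \<Rightarrow> 'b"
  proof -
    have "{0..n} = insert 0 (insert n {1..<n})" using n by auto
    then show ?thesis using n by simp
  qed
  ultimately have "of_nat n * fps_nth ?A n + (\<Sum>i=1..<n. of_nat i * fps_nth ?A i * fps_nth B (n - i)) =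
      of_nat q * (of_nat n * fps_nth B n + (\<Sum>i=1..<n. of_nat i * fps_nth B i * fps_nth ?A (n - i)))"
    by (simp only: split) (simp add: A0 B0)
  then show ?thesis
    by (simp add: sum_subtractf sum_distrib_left algebra_simps)
qed

lemma affine_recursion_bounded:
  fixes x :: "nat \<Rightarrow> real"
  assumes "\<And>m. x (Suc m) \<le> \<rho> * x m + C" "0 \<le> \<rho>" "\<rho> < 1"
  shows "\<exists>K. \<forall>m. x m \<le> K"
proof -
  \<comment> \<open>The second entry is the fixed point of
    \<open>x \<mapsto> \<rho> * x + C\<close>; every bound at or above it is inherited by the next
    term.\<close>
  let ?K = "max (x 0) (C / (1 - \<rho>))"
  have "x m \<le> ?K" for m
  proof (induction m)
    case (Suc m)
    have "C \<le> (1 - \<rho>) * ?K"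
    proof -
      have "C = (1 - \<rho>) * (C / (1 - \<rho>))" using assms by simp
      also have "\<dots> \<le> (1 - \<rho>) * ?K" using assms by (intro mult_left_mono) auto
      finally show ?thesis .
    qed
    moreover have "\<rho> * x m \<le> \<rho> * ?K" using Suc assms by (intro mult_left_mono) auto
    ultimately have "\<rho> * x m + C \<le> \<rho> * ?K + (1 - \<rho>) * ?K" by linarith
    also have "\<dots> = ?K" by (simp only: distrib_right[symmetric]) simp
    finally show ?case using assms(1)[of m] by linarith
  qed simp
  then show ?thesis by blast
qed

text \<open>Since (n choose 2) * 2 / n = n - 1, the exact threshold for positivity is -2/n.\<close>

lemma exponent_minus_1_pos:
  fixes \<sigma> :: real
  assumes n: "2 \<le> n" and \<sigma>: "\<sigma> > - 2 / real n"
  shows "0 < real n - 1 + \<sigma> * real (n choose 2)"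
proof -
  have "even (n * (n - 1))" by (cases n) auto
  then have "2 * (n choose 2) = n * (n - 1)" by (simp add: choose_two)
  then have "2 * real (n choose 2) = real n * real (n - 1)" by (metis of_nat_mult of_nat_numeral)
  then have c: "real (n choose 2) = real n * (real n - 1) / 2" using n by (simp add: of_nat_diff)
  have "- 2 / real n * real (n choose 2) < \<sigma> * real (n choose 2)"
    using \<sigma> n by (intro mult_strict_right_mono) (auto simp: zero_less_binomial_iff)
  moreover have "- 2 / real n * real (n choose 2) = - (real n - 1)"
    unfolding c using n by (simp add: field_simps)
  ultimately show ?thesis by linarith
qed

text \<open>The left side is q to the power \<open>1 - n - \<sigma> * (n choose 2)\<close>. It is
  the factor with which the n-th coefficient at one cut-off enters the n-th coefficient at the
  next.\<close>

lemma contraction_ratio: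
  fixes q \<sigma> :: real
  assumes q: "1 < q" and n: "2 \<le> n" and \<sigma>: "\<sigma> > - 2 / real n"
  shows "q * (1 / q) ^ n * ((1 / q) powr \<sigma>) ^ (n choose 2) < 1"
proof -
  have "0 < real n - 1 + \<sigma> * real (n choose 2)" by (rule exponent_minus_1_pos[OF n \<sigma>])
  moreover have "q * (1 / q) ^ n * ((1 / q) powr \<sigma>) ^ (n choose 2) = q powr (1 - real n - \<sigma> * real (n choose 2))"
  proof -
    have "(1 / q) ^ n = q powr (- real n)"
      using q by (simp add: powr_minus powr_realpow power_one_over inverse_eq_divide)
    moreover have "(1 / q) powr \<sigma> = q powr (- \<sigma>)"
      using q by (simp add: powr_divide powr_minus_divide)
    then have "((1 / q) powr \<sigma>) ^ (n choose 2) = q powr (- \<sigma> * real (n choose 2))"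
      using q powr_realpow[of "q powr (- \<sigma>)" "n choose 2"] by (simp add: powr_powr)
    moreover have "q = q powr 1" using q by simp
    ultimately have "q * (1 / q) ^ n * ((1 / q) powr \<sigma>) ^ (n choose 2) =
        q powr 1 * q powr (- real n) * q powr (- \<sigma> * real (n choose 2))" by simp
    also have "\<dots> = q powr (1 + - real n + - \<sigma> * real (n choose 2))" by (simp only: powr_add)
    also have "1 + - real n + - \<sigma> * real (n choose 2) = 1 - real n - \<sigma> * real (n choose 2)" by simp
    finally show ?thesis .
  qed
  ultimately show ?thesis using q by (simp add: powr_less_one)
qed

lemma partition_series_nth_0:
  assumes "has_partition_series M S \<kappa> N A"
  shows "fps_nth A 0 = 1"
proof -
  interpret e: prob_space "\<Pi>\<^sub>M i\<in>{}::nat set. M" by (rule prob_space_PiM) simp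
  have "restricted_pair_prod S \<kappa> {} = (\<lambda>_. 1)"
    by (auto simp: restricted_pair_prod_def pair_prod_def ordered_pairs_def)
  moreover have "has_bochner_integral (\<Pi>\<^sub>M i\<in>{}. M) (restricted_pair_prod S \<kappa> {}) (fps_nth A 0)"
    using assms by (auto simp: has_partition_series_def dest!: spec[of _ "{}"])
  ultimately show ?thesis by (simp add: has_bochner_integral_iff e.prob_space)
qed

context
  fixes \<mu> :: "'k::nonarch_local_field measure"
  assumes haar: "is_normalized_haar \<mu>"
begin

lemma haar_pair_measurable:
  assumes "f \<in> borel_measurable borel"
  shows "(\<lambda>(x, y). f (absv (x - y))) \<in> borel_measurable (\<mu> \<Otimes>\<^sub>M \<mu>)"
proof -
  have "sets (\<mu> \<Otimes>\<^sub>M \<mu>) = sets (borel \<Otimes>\<^sub>M borel)"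
    by (intro sets_pair_measure_cong haar_sets[OF haar])
  then have "(\<lambda>(x, y). absv (x - y)) \<in> borel_measurable (\<mu> \<Otimes>\<^sub>M \<mu>)"
    using measurable_absv_diff[where 'a = 'k] by (simp cong: measurable_cong_sets)
  from measurable_compose[OF this assms] show ?thesis by (simp add: case_prod_beta)
qed

text \<open>Here \<open>f\<close> is the kernel before rescaling and \<open>g\<close> the kernel on
  the union of the rescaled copies. Keeping them apart covers the step from one cut-off to the next
  along with exact self-similarity, where they coincide. The condition \<open>g 1 = 1\<close> says
  that points of different residue classes do not interact.\<close>

lemma partition_series_self_similar:
  fixes f g :: "real \<Rightarrow> 'b::{real_normed_field,banach,second_countable_topology}"
  defines "r \<equiv> 1 / real (residue_card TYPE('k))"
  assumes g: "g \<in> borel_measurable borel" "g 1 = 1"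
    and fg: "\<And>t. 0 \<le> t \<Longrightarrow> g (r * t) = s * f t"
    and A: "has_partition_series \<mu> int_ring (\<lambda>x y. f (absv (x - y))) N A"
  shows "has_partition_series \<mu> int_ring (\<lambda>x y. g (absv (x - y))) N
    (Abs_fps (\<lambda>n. of_real r ^ n * s ^ (n choose 2) * fps_nth A n) ^ residue_card TYPE('k))"
proof -
  obtain D :: "'k set" where D: "is_residue_system D" using residue_system_exists by blast
  then have fin: "finite D" "card D = residue_card TYPE('k)" "D \<subseteq> int_ring"
    "\<And>x. x \<in> int_ring \<Longrightarrow> \<exists>!d\<in>D. absv (x - d) < 1" by (auto simp: is_residue_system_def)
  have R: "int_ring = (\<Union>d\<in>D. disc d 1)" and disj: "disjoint_family_on (\<lambda>d. disc d 1) D"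
    using disc_split[OF D, of 0 0] by (simp_all add: disc_0_0)
  note sf = haar_sigma_finite[OF haar] and sets = haar_sets[OF haar]
  have "has_partition_series \<mu> (disc d 1) (\<lambda>x y. g (absv (x - y))) N
      (Abs_fps (\<lambda>n. of_real r ^ n * s ^ (n choose 2) * fps_nth A n))" for d
  proof (rule has_partition_series_image[OF sf sf])
    show "(\<lambda>x. d + uniformizer * x) \<in> measurable \<mu> \<mu>"
      unfolding measurable_cong_sets[OF sets sets] by (rule measurable_affine)
    show "emeasure \<mu> (B \<inter> disc d 1) = ennreal r * emeasure \<mu> ((\<lambda>x. d + uniformizer * x) -` B \<inter> int_ring)"
      if "B \<in> sets \<mu>" for B
      using haar_scale[OF haar] that sets by (simp add: r_def)
    show "g (absv ((d + uniformizer * x) - (d + uniformizer * y))) = s * f (absv (x - y))" for x y :: 'k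
    proof -
      have "(d + uniformizer * x) - (d + uniformizer * y) = uniformizer * (x - y)"
        by (simp add: algebra_simps)
      then have "absv ((d + uniformizer * x) - (d + uniformizer * y)) = r * absv (x - y)"
        by (simp only: absv_mult absv_uniformizer r_def)
      then show ?thesis using fg[OF absv_nonneg] by simp
    qed
    show "(\<lambda>(x, y). g (absv (x - y))) \<in> borel_measurable (\<mu> \<Otimes>\<^sub>M \<mu>)"
      by (rule haar_pair_measurable[OF g(1)])
  qed (use A in \<open>auto simp: haar_disc[OF haar] haar_int_ring[OF haar] sets r_def\<close>)
  then have "has_partition_series \<mu> (\<Union>d\<in>D. disc d 1) (\<lambda>x y. g (absv (x - y))) N
      (Abs_fps (\<lambda>n. of_real r ^ n * s ^ (n choose 2) * fps_nth A n) ^ card D)"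
  proof (intro has_partition_series_UN[OF sf fin(1) disj])
    fix c d x y :: 'k assume cd: "c \<in> D" "d \<in> D" "c \<noteq> d" "x \<in> disc c 1" "y \<in> disc d 1"
    have R': "x \<in> int_ring" "y \<in> int_ring" using cd R by blast+
    have xc: "absv (x - c) < 1" "absv (y - d) < 1" using cd by (simp_all add: disc_def absv_lt_1_iff)
    \<comment> \<open>Otherwise \<open>x\<close> would lie in the residue classes of both
      \<open>c\<close> and \<open>d\<close>.\<close>
    have "\<not> absv (x - y) < 1"
    proof
      assume "absv (x - y) < 1"
      then have "absv (x - d) < 1" using absv_diff_le_max3[of x d y] xc by simp
      then show False using fin(4)[OF R'(1)] xc cd by blast
    qed
    moreover have "absv (x - y) \<le> 1"
      using absv_diff_le_max[of x y] R' by (simp add: int_ring_def)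
    ultimately show "g (absv (x - y)) = 1" using g(2) by simp
  qed
  then show ?thesis unfolding R[symmetric] fin(2) .
qed

text \<open>
  The recursion for the integrals only makes sense once they are finite. With the truncated kernel
  they trivially are, and self-similarity relates the cut-offs \<open>m\<close> and \<open>m + 1\<close> by a contraction, which
  bounds them uniformly in \<open>m\<close>.
\<close>

definition truncated_kernel :: "real \<Rightarrow> nat \<Rightarrow> real \<Rightarrow> real" where
  "truncated_kernel \<sigma> m t = max t ((1 / real (residue_card TYPE('k))) ^ m) powr \<sigma>"

lemma truncated_kernel_measurable [measurable]: "truncated_kernel \<sigma> m \<in> borel_measurable borel"
  unfolding truncated_kernel_def[abs_def] by measurable

lemma truncated_kernel_nonneg: "0 \<le> truncated_kernel \<sigma> m t"
  by (simp add: truncated_kernel_def)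

text \<open>For nonnegative \<sigma> the kernel is at most 1, for negative \<sigma> it is largest at
  the cut-off. The bound depends on \<open>m\<close>, so it yields integrability but no uniform
  estimate.\<close>

lemma truncated_kernel_le:
  assumes "t \<le> 1"
  shows "truncated_kernel \<sigma> m t \<le> max 1 (((1 / real (residue_card TYPE('k))) ^ m) powr \<sigma>)"
proof -
  let ?e = "(1 / real (residue_card TYPE('k))) ^ m"
  have e: "0 < ?e" "?e \<le> 1"
    using disc_radius_pos[where 'a = 'k, of m] disc_radius_mono[where 'a = 'k, of 0 m] by auto
  show ?thesis
  proof (cases "0 \<le> \<sigma>")
    case True
    then have "max t ?e powr \<sigma> \<le> 1 powr \<sigma>" using assms e by (intro powr_mono2) auto
    then show ?thesis by (simp add: truncated_kernel_def)
  next
    case False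
    then have "max t ?e powr \<sigma> \<le> ?e powr \<sigma>" using e by (intro powr_mono2') auto
    then show ?thesis by (simp add: truncated_kernel_def)
  qed
qed

lemma integrable_truncated:
  assumes I: "finite I"
  shows "integrable (\<Pi>\<^sub>M i\<in>I. \<mu>) (restricted_pair_prod int_ring (\<lambda>x y. truncated_kernel \<sigma> m (absv (x - y))) I)"
proof (rule Bochner_Integration.integrable_bound)
  let ?K = "max 1 (((1 / real (residue_card TYPE('k))) ^ m) powr \<sigma>)"
  interpret product_sigma_finite "\<lambda>_::nat. \<mu>"
    using haar_sigma_finite[OF haar] by (simp add: product_sigma_finite_def)
  have "integrable \<mu> (indicator int_ring :: 'k \<Rightarrow> real)"
    using haar_int_ring[OF haar] by (intro integrable_real_indicator) (auto simp: haar_sets[OF haar])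
  then show "integrable (\<Pi>\<^sub>M i\<in>I. \<mu>) (\<lambda>x. ?K ^ card (ordered_pairs I) * (\<Prod>i\<in>I. indicator int_ring (x i)))"
    using product_integrable_prod[OF I, of "\<lambda>_. indicator int_ring :: 'k \<Rightarrow> real"] by simp
  show "restricted_pair_prod int_ring (\<lambda>x y. truncated_kernel \<sigma> m (absv (x - y))) I \<in> borel_measurable (\<Pi>\<^sub>M i\<in>I. \<mu>)"
    by (intro measurable_restricted_pair_prod haar_pair_measurable) (auto simp: haar_sets[OF haar])
  have "\<bar>restricted_pair_prod int_ring (\<lambda>x y. truncated_kernel \<sigma> m (absv (x - y))) I x\<bar>
      \<le> ?K ^ card (ordered_pairs I) * (\<Prod>i\<in>I. indicator int_ring (x i))" for x
  proof (cases "\<forall>i\<in>I. x i \<in> int_ring")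
    case True
    have le: "truncated_kernel \<sigma> m (absv (x i - x j)) \<le> ?K" if "i \<in> I" "j \<in> I" for i j
    proof (rule truncated_kernel_le)
      show "absv (x i - x j) \<le> 1"
        by (rule order_trans[OF absv_diff_le_max]) (use True that in \<open>simp add: int_ring_def\<close>)
    qed
    have "pair_prod (\<lambda>x y. truncated_kernel \<sigma> m (absv (x - y))) I x \<le> (\<Prod>p\<in>ordered_pairs I. ?K)"
      unfolding pair_prod_def using le
      by (intro prod_mono) (auto simp: truncated_kernel_nonneg ordered_pairs_def)
    moreover have "0 \<le> pair_prod (\<lambda>x y. truncated_kernel \<sigma> m (absv (x - y))) I x"
      unfolding pair_prod_def by (intro prod_nonneg) (auto simp: truncated_kernel_nonneg)
    ultimately show ?thesis using True I by (simp add: restricted_pair_prod_def prod_indicator_eq)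
  qed (use I in \<open>auto simp: restricted_pair_prod_def prod_indicator_eq\<close>)
  moreover have "0 \<le> (\<Prod>i\<in>I. indicator int_ring (x i) :: real)" for x :: "nat \<Rightarrow> 'k"
    by (intro prod_nonneg) simp
  ultimately show "AE x in \<Pi>\<^sub>M i\<in>I. \<mu>. norm (restricted_pair_prod int_ring (\<lambda>x y. truncated_kernel \<sigma> m (absv (x - y))) I x)
      \<le> norm (?K ^ card (ordered_pairs I) * (\<Prod>i\<in>I. indicator int_ring (x i)) :: real)"
    by (intro AE_I2) (simp add: abs_mult)
qed

text \<open>Induction on the degree. By self-similarity the coefficient at cut-off
  \<open>m + 1\<close> is at most \<open>q * w n\<close> times the one at cut-off \<open>m\<close>
  plus a contribution of lower degrees, which the induction hypothesis bounds uniformly.\<close>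

lemma truncated_series_bounded:
  assumes \<sigma>: "\<And>n. 2 \<le> n \<Longrightarrow> n \<le> N \<Longrightarrow> \<sigma> > - 2 / real n"
    and A: "\<And>m. has_partition_series \<mu> int_ring (\<lambda>x y. truncated_kernel \<sigma> m (absv (x - y))) N (A m)"
    and nonneg: "\<And>m n. 0 \<le> fps_nth (A m) n"
    and n: "n \<le> N"
  shows "\<exists>K. \<forall>m. fps_nth (A m) n \<le> K"
  using n
proof (induction n rule: less_induct)
  case (less n)
  let ?q = "residue_card TYPE('k)"
  let ?r = "1 / real ?q"
  have q: "real ?q > 1" using residue_card_gt_1[where 'a = 'k] by simp
  define s where "s = ?r powr \<sigma>"
  define w where "w n = ?r ^ n * s ^ (n choose 2)" for n
  have w: "0 \<le> w n" for n using q by (simp add: w_def s_def)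
  define B where "B m = Abs_fps (\<lambda>n. w n * fps_nth (A m) n)" for m
  have rec: "fps_nth (A (Suc m)) i = fps_nth (B m ^ ?q) i" if "i \<le> N" for m i
  proof (rule has_partition_series_unique[OF A _ that])
    have "has_partition_series \<mu> int_ring (\<lambda>x y. truncated_kernel \<sigma> (Suc m) (absv (x - y))) N
      (Abs_fps (\<lambda>n. of_real ?r ^ n * s ^ (n choose 2) * fps_nth (A m) n) ^ ?q)"
    proof (rule partition_series_self_similar)
      have "?r ^ Suc m \<le> 1" using disc_radius_mono[where 'a = 'k, of 0 "Suc m"] by simp
      then show "truncated_kernel \<sigma> (Suc m) 1 = 1" unfolding truncated_kernel_def by (simp only: max_absorb1 powr_one_eq_one)
      show "truncated_kernel \<sigma> (Suc m) (?r * t) = s * truncated_kernel \<sigma> m t" if "0 \<le> t" for t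
      proof -
        \<comment> \<open>The maximum scales as a whole: shrinking all distances by 1 / q turns
          cut-off \<open>m\<close> into cut-off \<open>m + 1\<close>.\<close>
        have "max (?r * t) (?r ^ Suc m) = ?r * max t (?r ^ m)"
          using q by (simp only: power_Suc max_mult_distrib_left) simp
        moreover have "0 \<le> max t (?r ^ m)" using that by simp
        ultimately show ?thesis unfolding truncated_kernel_def s_def using q by (simp only: powr_mult)
      qed
    qed (use A in auto)
    then show "has_partition_series \<mu> int_ring (\<lambda>x y. truncated_kernel \<sigma> (Suc m) (absv (x - y))) N (B m ^ ?q)"
      by (simp add: B_def w_def)
  qed
  have A0: "fps_nth (A m) 0 = 1" for m using partition_series_nth_0[OF A] .
  have B0: "fps_nth (B m) 0 = 1" for m by (simp add: B_def w_def A0 numeral_2_eq_2)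
  consider "n = 0" | "n = 1" | "2 \<le> n" by linarith
  then show ?case
  proof cases
    case 1
    then show ?thesis by (auto simp: A0)
  next
    \<comment> \<open>Here \<open>q * w 1 = 1\<close>, so there is no contraction; but the sum over
      lower degrees is empty and the coefficient does not depend on \<open>m\<close>.\<close>
    case 2
    have "fps_nth (A (Suc m)) 1 = fps_nth (A m) 1" for m
      using fps_power_coeff_rec[OF B0, of 1 m ?q] rec[of 1 m] less.prems 2 q
      by (simp add: B_def w_def numeral_2_eq_2)
    then have "fps_nth (A m) 1 = fps_nth (A 0) 1" for m by (induction m) auto
    then show ?thesis using 2 by (metis order_refl)
  next
    case 3
    have "\<exists>K. \<forall>m. fps_nth (A m) i \<le> K" if "i < n" for i
      using less that by simp
    then obtain K where K: "\<And>i m. i < n \<Longrightarrow> fps_nth (A m) i \<le> K i" by metis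
    have K0: "0 \<le> K i" if "i < n" for i using K[OF that] nonneg order_trans by blast
    \<comment> \<open>Bounds the positive parts of the summands. The subtracted parts are
      nonnegative and are dropped.\<close>
    define C where "C = (\<Sum>i=1..<n. real ?q * real i * (w i * K i) * K (n - i)) / real n"
    have "fps_nth (A (Suc m)) n \<le> (real ?q * w n) * fps_nth (A m) n + C" for m
    proof -
      have "real n * fps_nth (A (Suc m)) n = real ?q * real n * fps_nth (B m) n +
        (\<Sum>i=1..<n. real ?q * real i * fps_nth (B m) i * fps_nth (A (Suc m)) (n - i)
                - real i * fps_nth (A (Suc m)) i * fps_nth (B m) (n - i))"
        using fps_power_coeff_rec[OF B0, of n m ?q] rec[of _ m] less.prems 3 by simp
      also have "\<dots> \<le> real ?q * real n * fps_nth (B m) n +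
        (\<Sum>i=1..<n. real ?q * real i * (w i * K i) * K (n - i))"
      proof (intro add_left_mono sum_mono)
        fix i assume i: "i \<in> {1..<n}"
        have "0 \<le> real i * fps_nth (A (Suc m)) i * fps_nth (B m) (n - i)"
          by (simp add: B_def nonneg w)
        moreover have "real ?q * real i * fps_nth (B m) i * fps_nth (A (Suc m)) (n - i)
            \<le> real ?q * real i * (w i * K i) * K (n - i)"
          using i K K0 nonneg w by (intro mult_mono mult_left_mono) (auto simp: B_def intro!: mult_left_mono)
        ultimately show "real ?q * real i * fps_nth (B m) i * fps_nth (A (Suc m)) (n - i)
            - real i * fps_nth (A (Suc m)) i * fps_nth (B m) (n - i)
            \<le> real ?q * real i * (w i * K i) * K (n - i)" by linarith
      qed
      also have "\<dots> = real n * ((real ?q * w n) * fps_nth (A m) n + C)"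
        using 3 by (simp add: B_def C_def algebra_simps)
      finally show ?thesis using 3 by simp
    qed
    then show ?thesis
    proof (rule affine_recursion_bounded)
      show "0 \<le> real ?q * w n" using w by simp
      show "real ?q * w n < 1"
        using contraction_ratio[OF q 3 \<sigma>[OF 3 less.prems]] by (simp add: w_def s_def mult.assoc)
    qed
  qed
qed

text \<open>Fatou's lemma carries the bound that is uniform in the cut-off over to the untruncated
  kernel.\<close>

lemma nn_integral_powr_finite:
  assumes \<sigma>: "\<And>n. 2 \<le> n \<Longrightarrow> n \<le> N \<Longrightarrow> \<sigma> > - 2 / real n" and n: "n \<le> N"
  shows "(\<integral>\<^sup>+x. ennreal (restricted_pair_prod int_ring (\<lambda>x y. absv (x - y) powr \<sigma>) {..<n} x) \<partial>(\<Pi>\<^sub>M i\<in>{..<n}. \<mu>)) < \<infinity>"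
proof -
  let ?k = "\<lambda>m x y. truncated_kernel \<sigma> m (absv (x - y))"
  let ?u = "\<lambda>m x. ennreal (restricted_pair_prod int_ring (?k m) {..<n} x)"
  let ?P = "\<Pi>\<^sub>M i\<in>{..<n}. \<mu>"
  define A where "A m = Abs_fps (\<lambda>n. integral\<^sup>L (\<Pi>\<^sub>M i\<in>{..<n}. \<mu>) (restricted_pair_prod int_ring (?k m) {..<n}) / fact n)" for m
  have rnn: "0 \<le> restricted_pair_prod int_ring (?k m) J x" for m x and J :: "nat set"
    unfolding restricted_pair_prod_def pair_prod_def
    by (intro mult_nonneg_nonneg prod_nonneg) (auto simp: truncated_kernel_nonneg)
  have hA: "has_partition_series \<mu> int_ring (?k m) N (A m)" for m
    unfolding A_def by (intro has_partition_series_Abs_fps haar_sigma_finite[OF haar] integrable_truncated) simp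
  have "0 \<le> fps_nth (A m) n" for m n
    unfolding A_def by (simp add: rnn)
  from truncated_series_bounded[OF \<sigma> hA this n] obtain K where K: "\<And>m. fps_nth (A m) n \<le> K" by blast
  have int: "(\<integral>\<^sup>+x. ?u m x \<partial>?P) \<le> ennreal (fact n * K)" for m
  proof -
    have "(\<integral>\<^sup>+x. ?u m x \<partial>?P) = ennreal (fact n * fps_nth (A m) n)"
      by (subst nn_integral_eq_integral[OF integrable_truncated AE_I2[OF rnn]]) (simp_all add: A_def)
    also have "\<dots> \<le> ennreal (fact n * K)" using K by (intro ennreal_leI mult_left_mono) auto
    finally show ?thesis .
  qed
  have lim: "ennreal (restricted_pair_prod int_ring (\<lambda>x y. absv (x - y) powr \<sigma>) {..<n} x) \<le> liminf (\<lambda>m. ?u m x)" for x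
  proof (cases "\<exists>i<n. \<exists>j<n. i < j \<and> x i = x j")
    \<comment> \<open>A coincidence makes the untruncated integrand 0, as
      \<open>0 powr \<sigma> = 0\<close>. The truncated ones need not converge to it, but only a
      lower bound for their \<open>liminf\<close> is wanted.\<close>
    case True
    then obtain i j where "i < n" "j < n" "i < j" "x i = x j" by blast
    then have ij: "(i, j) \<in> ordered_pairs {..<n}" "x i = x j" by (simp_all add: ordered_pairs_def)
    then have "pair_prod (\<lambda>x y. absv (x - y) powr \<sigma>) {..<n} x = 0"
      unfolding pair_prod_def by (intro prod_zero bexI[OF _ ij(1)]) auto
    then show ?thesis by (simp add: restricted_pair_prod_def)
  next
    case False
    have "(\<lambda>m. truncated_kernel \<sigma> m (absv (x i - x j))) \<longlonglongrightarrow> absv (x i - x j) powr \<sigma>"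
      if "(i, j) \<in> ordered_pairs {..<n}" for i j
    proof (rule tendsto_eventually)
      have "x i \<noteq> x j" using that False by (auto simp: ordered_pairs_def)
      then have "0 < absv (x i - x j)" by simp
      \<comment> \<open>Once the cut-off is below the distance, the truncated kernel is
        stationary.\<close>
      then obtain M where M: "(1 / real (residue_card TYPE('k))) ^ M < absv (x i - x j)"
        using disc_radius_tendsto by blast
      have "truncated_kernel \<sigma> m (absv (x i - x j)) = absv (x i - x j) powr \<sigma>" if "M \<le> m" for m
        using M disc_radius_mono[where 'a = 'k, OF that] unfolding truncated_kernel_def by (simp only: max_absorb1)
      then show "\<forall>\<^sub>F m in sequentially. truncated_kernel \<sigma> m (absv (x i - x j)) = absv (x i - x j) powr \<sigma>"
        unfolding eventually_sequentially by blast
    qed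
    then have pairs: "(\<lambda>m. case p of (i, j) \<Rightarrow> truncated_kernel \<sigma> m (absv (x i - x j))) \<longlonglongrightarrow>
        (case p of (i, j) \<Rightarrow> absv (x i - x j) powr \<sigma>)" if "p \<in> ordered_pairs {..<n}" for p
      using that by (cases p) simp
    have "(\<lambda>m. restricted_pair_prod int_ring (?k m) {..<n} x) \<longlonglongrightarrow>
        restricted_pair_prod int_ring (\<lambda>x y. absv (x - y) powr \<sigma>) {..<n} x"
      unfolding restricted_pair_prod_def pair_prod_def
      by (intro tendsto_mult_left tendsto_prod pairs)
    then have "(\<lambda>m. ?u m x) \<longlonglongrightarrow> ennreal (restricted_pair_prod int_ring (\<lambda>x y. absv (x - y) powr \<sigma>) {..<n} x)"
      by (rule tendsto_ennrealI)
    then show ?thesis by (simp add: lim_imp_Liminf)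
  qed
  have "(\<integral>\<^sup>+x. ennreal (restricted_pair_prod int_ring (\<lambda>x y. absv (x - y) powr \<sigma>) {..<n} x) \<partial>?P)
      \<le> (\<integral>\<^sup>+x. liminf (\<lambda>m. ?u m x) \<partial>?P)"
    by (intro nn_integral_mono lim)
  also have "\<dots> \<le> liminf (\<lambda>m. \<integral>\<^sup>+x. ?u m x \<partial>?P)"
    by (intro nn_integral_liminf measurable_compose[OF borel_measurable_integrable[OF integrable_truncated] measurable_ennreal])
      simp
  also have "\<dots> \<le> liminf (\<lambda>m::nat. ennreal (fact n * K))"
    by (intro Liminf_mono) (simp add: int)
  also have "\<dots> < \<infinity>" by (simp add: Liminf_const)
  finally show ?thesis .
qed

end

section \<open>The recurrence\<close>

lemma sinh_nonzero:
  fixes z :: complex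
  assumes "Re z \<noteq> 0"
  shows "sinh z \<noteq> 0"
proof
  assume "sinh z = 0"
  then have "exp z = exp (- z)" by (simp add: sinh_field_def)
  then have "norm (exp z) = norm (exp (- z))" by simp
  then have "Re z = - Re z" by (simp only: norm_exp_eq_Re exp_inj_iff uminus_complex.sel)
  with assms show False by simp
qed

lemma exp_mult_sinh: "2 * p * sinh z = p * exp z - p * exp (- z :: complex)"
  by (simp add: sinh_field_def right_diff_distrib)

text \<open>Together with \<open>sinh_nonzero\<close> this is why no denominator of the recurrence
  vanishes at nonzero \<open>t\<close>.\<close>

lemma Re_recE_gt_1:
  assumes "2 \<le> n" "Re \<beta> > - 2 / real n"
  shows "1 < Re (recE n \<beta>)"
  using exponent_minus_1_pos[OF assms] by (simp add: recE_def mult.commute)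

lemma exponent_bound_mono:
  fixes \<sigma> :: real
  assumes "\<sigma> > - 2 / real N" "2 \<le> n" "n \<le> N"
  shows "\<sigma> > - 2 / real n"
proof -
  have "- 2 / real n \<le> - 2 / real N" using assms by (simp add: frac_le)
  with assms(1) show ?thesis by linarith
qed

lemma recE_eq: "recE n \<beta> = of_nat n * (1 + (of_nat n - 1) / 2 * \<beta>)"
proof -
  have "even (n * (n - 1))" by (cases n) auto
  then have "2 * (n choose 2) = n * (n - 1)" by (simp add: choose_two)
  then have "(2 * of_nat (n choose 2) :: complex) = of_nat n * of_nat (n - 1)"
    by (metis of_nat_mult of_nat_numeral)
  also have "of_nat n * of_nat (n - 1) = (of_nat n * (of_nat n - 1) :: complex)" by (cases n) auto
  finally have c: "of_nat (n choose 2) = (of_nat n * (of_nat n - 1) / 2 :: complex)" by (simp add: mult.commute)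
  show ?thesis unfolding recE_def c by (simp add: field_simps)
qed

text \<open>As \<open>recE n \<beta>\<close> is n times an affine function of n, both sides equal (n
  - 2k)(1 + (n - 1) \<beta> / 2). The arguments of the hyperbolic functions in both formulas come
  from here.\<close>

lemma recE_diff:
  assumes "k \<le> n" "1 \<le> n"
  shows "recE (n - k) \<beta> - recE k \<beta> = recE n \<beta> * (1 - 2 * of_nat k / of_nat n)"
proof -
  let ?n = "of_nat n :: complex" and ?k = "of_nat k :: complex"
  have "?n * (1 - 2 * ?k / ?n) = ?n - 2 * ?k" using assms by (simp add: right_diff_distrib)
  moreover have "recE n \<beta> * (1 - 2 * ?k / ?n) = (?n * (1 - 2 * ?k / ?n)) * (1 + (?n - 1) / 2 * \<beta>)"
    unfolding recE_eq by (simp only: mult_ac)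
  ultimately have a: "recE n \<beta> * (1 - 2 * ?k / ?n) = (?n - 2 * ?k) * (1 + (?n - 1) / 2 * \<beta>)"
    by (simp only:)
  have b: "recE (n - k) \<beta> = (?n - ?k) * (1 + (?n - ?k - 1) / 2 * \<beta>)"
    using assms by (simp add: recE_eq of_nat_diff)
  show ?thesis unfolding a b recE_eq[of k] by (simp add: field_simps)
qed

text \<open>Agrees with the complex \<open>powr\<close> on nonnegative reals, including the value 0
  at 0, but goes through the real logarithm, which makes measurability and multiplicativity
  elementary.\<close>

definition real_cpowr :: "complex \<Rightarrow> real \<Rightarrow> complex" where
  "real_cpowr \<beta> t = (if 0 < t then exp (\<beta> * of_real (ln t)) else 0)"

lemma real_cpowr_eq: "0 \<le> t \<Longrightarrow> complex_of_real t powr \<beta> = real_cpowr \<beta> t"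
  by (auto simp: real_cpowr_def powr_def Ln_of_real)

lemma real_cpowr_measurable [measurable]: "real_cpowr \<beta> \<in> borel_measurable borel"
  unfolding real_cpowr_def[abs_def] by measurable

lemma real_cpowr_1 [simp]: "real_cpowr \<beta> 1 = 1"
  by (simp add: real_cpowr_def)

lemma real_cpowr_mult:
  assumes "0 < r" "0 \<le> t"
  shows "real_cpowr \<beta> (r * t) = real_cpowr \<beta> r * real_cpowr \<beta> t"
  using assms by (auto simp: real_cpowr_def ln_mult exp_add[symmetric] distrib_left)

lemma norm_real_cpowr: "0 \<le> t \<Longrightarrow> norm (real_cpowr \<beta> t) = t powr Re \<beta>"
  by (auto simp: real_cpowr_def powr_def)

lemma recF_unfold:
  assumes "2 \<le> n" "t \<noteq> 0"
  shows "recF n t \<beta> = (\<Sum>k=1..<n. of_nat k / of_nat n *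
           (sinh (of_real t / 2 * (recE n \<beta> * (1 - 2 * of_nat k / of_nat n) + 1)) /
            sinh (of_real t / 2 * (recE n \<beta> - 1))) * recF (n - k) t \<beta> * recF k t \<beta>)"
  using assms by (subst recF.simps) simp

lemma recF_0 [simp]: "recF 0 t \<beta> = 1" and recF_1 [simp]: "recF (Suc 0) t \<beta> = 1"
  by (simp_all add: recF.simps)

text \<open>With \<open>L = log q\<close>, factoring \<open>exp (L (1 - n) / 2)\<close> out of both sides turns the differences of
  exponentials into hyperbolic sines.\<close>

lemma recF_closed_form:
  fixes a :: "nat \<Rightarrow> complex" and \<beta> :: complex
  defines "w \<equiv> \<lambda>L n. exp (- complex_of_real L * recE n \<beta>)"
  assumes L: "0 < L" and a0: "a 0 = 1" and a1: "a 1 = 1"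
    and \<beta>: "\<And>n. 2 \<le> n \<Longrightarrow> n \<le> N \<Longrightarrow> Re \<beta> > - 2 / real n"
    and rec: "\<And>n. 2 \<le> n \<Longrightarrow> n \<le> N \<Longrightarrow> of_nat n * a n = exp (of_real L) * of_nat n * (w L n * a n) +
      (\<Sum>i=1..<n. exp (of_real L) * of_nat i * (w L i * a i) * a (n - i) - of_nat i * a i * (w L (n - i) * a (n - i)))"
    and n: "n \<le> N"
  shows "a n = recF n L \<beta> * exp (of_real L * (recE n \<beta> - of_nat n) / 2)"
  using n
proof (induction n rule: less_induct)
  case (less n)
  let ?L = "complex_of_real L"
  let ?e = "\<lambda>n. recE n \<beta>"
  define E where "E n = exp (?L * (?e n - of_nat n) / 2)" for n
  consider "n = 0" | "n = 1" | "2 \<le> n" by linarith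
  then show ?case
  proof cases
    \<comment> \<open>\<open>recE\<close> is 0 at index 0 and 1 at index 1, so in both small cases
      the exponential factor is 1.\<close>
    case 1
    then show ?thesis by (simp add: a0 recE_def numeral_2_eq_2)
  next
    case 2
    then show ?thesis using a1 by (simp add: recE_def numeral_2_eq_2)
  next
    case 3
    define S where "S = sinh (?L / 2 * (?e n - 1))"
    define s where "s k = sinh (?L / 2 * (?e n * (1 - 2 * of_nat k / of_nat n) + 1))" for k
    define c where "c = 2 * exp (?L * (1 - of_nat n) / 2)"
    have "Re (?L / 2 * (?e n - 1)) = L / 2 * (Re (?e n) - 1)" by simp
    moreover have "1 < Re (?e n)" using Re_recE_gt_1[OF 3 \<beta>[OF 3 less.prems]] .
    ultimately have S0: "S \<noteq> 0" unfolding S_def using L by (intro sinh_nonzero) auto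
    \<comment> \<open>Moving the term with \<open>a n\<close> to the left leaves the coefficient
      \<open>1 - exp ?L * w L n\<close>; scaled by \<open>E n\<close> it becomes the denominator of
      the recurrence.\<close>
    have ES: "E n * (1 - exp ?L * w L n) = c * S"
    proof -
      have "E n * (1 - exp ?L * w L n) = exp (?L * (?e n - of_nat n) / 2) - exp (?L * (?e n - of_nat n) / 2 + (?L + - ?L * ?e n))"
        unfolding exp_add by (simp add: E_def w_def right_diff_distrib)
      also have "?L * (?e n - of_nat n) / 2 = ?L * (1 - of_nat n) / 2 + ?L / 2 * (?e n - 1)"
        by (simp add: field_simps)
      also have "?L * (1 - of_nat n) / 2 + ?L / 2 * (?e n - 1) + (?L + - ?L * ?e n) = ?L * (1 - of_nat n) / 2 + - (?L / 2 * (?e n - 1))"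
        by (simp add: field_simps)
      finally show ?thesis
        unfolding exp_add S_def c_def exp_mult_sinh .
    qed
    \<comment> \<open>By \<open>recE_diff\<close> the two exponents lie symmetrically about
      \<open>L * (1 - n) / 2\<close>, so their difference gives the numerator of the
      recurrence.\<close>
    have Es: "E k * E (n - k) * (exp ?L * w L k - w L (n - k)) = c * s k" if k: "k \<in> {1..<n}" for k
    proof -
      let ?D = "?e n * (1 - 2 * of_nat k / of_nat n)"
      have D: "?e (n - k) = ?e k + ?D" using recE_diff[of k n \<beta>] k by (simp add: algebra_simps)
      have nk: "(of_nat (n - k) :: complex) = of_nat n - of_nat k" using k by (simp add: of_nat_diff)
      have "E k * E (n - k) * (exp ?L * w L k - w L (n - k)) =
        exp (?L * (?e k - of_nat k) / 2 + ?L * (?e (n - k) - of_nat (n - k)) / 2 + (?L + - ?L * ?e k)) -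
        exp (?L * (?e k - of_nat k) / 2 + ?L * (?e (n - k) - of_nat (n - k)) / 2 + - ?L * ?e (n - k))"
        unfolding exp_add by (simp add: E_def w_def right_diff_distrib)
      also have "?L * (?e k - of_nat k) / 2 + ?L * (?e (n - k) - of_nat (n - k)) / 2 + (?L + - ?L * ?e k) =
          ?L * (1 - of_nat n) / 2 + ?L / 2 * (?D + 1)"
        unfolding D nk by (simp add: add_divide_distrib diff_divide_distrib distrib_left right_diff_distrib)
      also have "?L * (?e k - of_nat k) / 2 + ?L * (?e (n - k) - of_nat (n - k)) / 2 + - ?L * ?e (n - k) =
          ?L * (1 - of_nat n) / 2 + - (?L / 2 * (?D + 1))"
        unfolding D nk by (simp add: add_divide_distrib diff_divide_distrib distrib_left right_diff_distrib)
      finally show ?thesis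
        unfolding exp_add s_def c_def exp_mult_sinh .
    qed
    have IH: "a k = recF k L \<beta> * E k" if "k < n" for k
      using less.IH[OF that] that less.prems by (simp add: E_def)
    have "of_nat n * a n * (1 - exp ?L * w L n) = of_nat n * a n - exp ?L * of_nat n * (w L n * a n)"
      by (simp add: algebra_simps)
    also have "\<dots> = (\<Sum>i=1..<n. exp ?L * of_nat i * (w L i * a i) * a (n - i) - of_nat i * a i * (w L (n - i) * a (n - i)))"
      by (subst rec[OF 3 less.prems]) (rule add_diff_cancel_left')
    also have "\<dots> = (\<Sum>i=1..<n. of_nat i * (recF i L \<beta> * recF (n - i) L \<beta>) * (c * s i))"
    proof (rule sum.cong[OF refl])
      fix i assume i: "i \<in> {1..<n}"
      then have "i < n" "n - i < n" by auto
      then show "exp ?L * of_nat i * (w L i * a i) * a (n - i) - of_nat i * a i * (w L (n - i) * a (n - i)) =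
          of_nat i * (recF i L \<beta> * recF (n - i) L \<beta>) * (c * s i)"
        unfolding Es[OF i, symmetric] by (simp add: IH algebra_simps)
    qed
    also have "\<dots> = c * S * of_nat n * (\<Sum>k=1..<n. of_nat k / of_nat n * (s k / S) * recF (n - k) L \<beta> * recF k L \<beta>)"
      unfolding sum_distrib_left using S0 3 by (intro sum.cong refl) (simp add: field_simps)
    also have "(\<Sum>k=1..<n. of_nat k / of_nat n * (s k / S) * recF (n - k) L \<beta> * recF k L \<beta>) = recF n L \<beta>"
      using recF_unfold[of n L \<beta>] 3 L by (simp add: s_def S_def)
    also have "c * S * of_nat n * recF n L \<beta> = of_nat n * (recF n L \<beta> * E n) * (1 - exp ?L * w L n)"
      unfolding ES[symmetric] by (simp add: algebra_simps)
    finally have eq: "of_nat n * a n * (1 - exp ?L * w L n) = of_nat n * (recF n L \<beta> * E n) * (1 - exp ?L * w L n)" .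
    have "c * S \<noteq> 0" using S0 by (simp add: c_def)
    then have "1 - exp ?L * w L n \<noteq> 0" using ES by auto
    with eq have "a n = recF n L \<beta> * E n" using 3 by simp
    then show ?thesis by (simp add: E_def)
  qed
qed

context
  fixes \<mu> :: "'k::nonarch_local_field measure" and N :: nat and \<beta> :: complex
  assumes haar: "is_normalized_haar \<mu>"
    and \<beta>: "\<And>n. 2 \<le> n \<Longrightarrow> n \<le> N \<Longrightarrow> Re \<beta> > - 2 / real n"
begin

text \<open>The modulus of the integrand is the same product with \<beta> replaced by its real part,
  for which finiteness is known.\<close>

lemma integrable_restricted_pair_prod:
  assumes n: "n \<le> N"
  shows "integrable (\<Pi>\<^sub>M i\<in>{..<n}. \<mu>) (restricted_pair_prod int_ring (\<lambda>x y. real_cpowr \<beta> (absv (x - y))) {..<n})"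
proof (rule integrableI_bounded)
  show "restricted_pair_prod int_ring (\<lambda>x y. real_cpowr \<beta> (absv (x - y))) {..<n} \<in> borel_measurable (\<Pi>\<^sub>M i\<in>{..<n}. \<mu>)"
    by (intro measurable_restricted_pair_prod haar_pair_measurable[OF haar] real_cpowr_measurable)
      (simp add: haar_sets[OF haar])
  have "norm (restricted_pair_prod int_ring (\<lambda>x y. real_cpowr \<beta> (absv (x - y))) {..<n} x) =
      restricted_pair_prod int_ring (\<lambda>x y. absv (x - y) powr Re \<beta>) {..<n} x" for x :: "nat \<Rightarrow> 'k"
    by (simp add: restricted_pair_prod_def pair_prod_def norm_mult prod_norm[symmetric] prod_indicator_eq
        case_prod_beta norm_real_cpowr absv_nonneg)
  then show "(\<integral>\<^sup>+x. norm (restricted_pair_prod int_ring (\<lambda>x y. real_cpowr \<beta> (absv (x - y))) {..<n} x) \<partial>(\<Pi>\<^sub>M i\<in>{..<n}. \<mu>)) < \<infinity>"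
    using nn_integral_powr_finite[OF haar \<beta> n] by simp
qed

text \<open>Exact self-similarity, with the same kernel on both sides. Each of the n particles
  contributes 1 / q and each of the (n choose 2) pairs q^(-\<beta>), which together make up
  \<open>w n\<close>.\<close>

lemma partition_series_R:
  defines "L \<equiv> ln (real (residue_card TYPE('k)))"
  shows "has_partition_series \<mu> int_ring (\<lambda>x y. real_cpowr \<beta> (absv (x - y))) N
    (Abs_fps (\<lambda>n. recF n L \<beta> * exp (of_real L * (recE n \<beta> - of_nat n) / 2)))"
proof -
  let ?q = "residue_card TYPE('k)"
  let ?r = "1 / real ?q"
  let ?\<kappa> = "\<lambda>x y :: 'k. real_cpowr \<beta> (absv (x - y))"
  have q: "real ?q > 1" using residue_card_gt_1[where 'a = 'k] by simp
  have L: "0 < L" using q by (simp add: L_def)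
  have qL: "of_nat ?q = exp (complex_of_real L)"
    using q by (simp add: L_def exp_of_real)
  define A where "A = Abs_fps (\<lambda>n. integral\<^sup>L (\<Pi>\<^sub>M i\<in>{..<n}. \<mu>) (restricted_pair_prod int_ring ?\<kappa> {..<n}) / fact n)"
  have A: "has_partition_series \<mu> int_ring ?\<kappa> N A"
    unfolding A_def by (intro has_partition_series_Abs_fps haar_sigma_finite[OF haar] integrable_restricted_pair_prod)
  define w where "w n = exp (- complex_of_real L * recE n \<beta>)" for n
  define B where "B = Abs_fps (\<lambda>n. w n * fps_nth A n)"
  have w_eq: "of_real ?r ^ n * real_cpowr \<beta> ?r ^ (n choose 2) = w n" for n
  proof -
    have "complex_of_real ?r = exp (- of_real L)"
      using q by (simp add: qL exp_minus inverse_eq_divide)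
    moreover have "real_cpowr \<beta> ?r = exp (- (\<beta> * of_real L))"
      using q by (simp add: real_cpowr_def L_def ln_div)
    ultimately have "of_real ?r ^ n * real_cpowr \<beta> ?r ^ (n choose 2) =
        exp (of_nat n * (- of_real L) + of_nat (n choose 2) * (- (\<beta> * of_real L)))"
      by (simp only: exp_of_nat_mult[symmetric] exp_add)
    also have "of_nat n * (- of_real L) + of_nat (n choose 2) * (- (\<beta> * of_real L)) = - of_real L * recE n \<beta>"
      by (simp add: recE_def algebra_simps)
    finally show ?thesis by (simp add: w_def)
  qed
  have "has_partition_series \<mu> int_ring ?\<kappa> N
      (Abs_fps (\<lambda>n. of_real ?r ^ n * real_cpowr \<beta> ?r ^ (n choose 2) * fps_nth A n) ^ ?q)"
    using q by (intro partition_series_self_similar[OF haar _ _ _ A] real_cpowr_mult) auto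
  then have "has_partition_series \<mu> int_ring ?\<kappa> N (B ^ ?q)"
    by (simp only: w_eq B_def)
  then have rec: "fps_nth A n = fps_nth (B ^ ?q) n" if "n \<le> N" for n
    using has_partition_series_unique[OF A _ that] by blast
  have A0: "fps_nth A 0 = 1" using partition_series_nth_0[OF A] .
  have B0: "fps_nth B 0 = 1" by (simp add: B_def A0 w_def recE_def numeral_2_eq_2)
  \<comment> \<open>The recursion says nothing in degree one, where q times \<open>w 1\<close> is 1;
    the value is the total mass of \<open>int_ring\<close>.\<close>
  have A1: "fps_nth A 1 = 1"
  proof -
    interpret product_sigma_finite "\<lambda>_::nat. \<mu>"
      using haar_sigma_finite[OF haar] by (simp add: product_sigma_finite_def)
    have "ordered_pairs {..<1} = {}" by (auto simp: ordered_pairs_def)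
    then have "restricted_pair_prod int_ring ?\<kappa> {..<1} = (\<lambda>x. \<Prod>i\<in>{..<1}. indicator int_ring (x i))"
      by (simp add: restricted_pair_prod_def[abs_def] pair_prod_def)
    moreover have "has_bochner_integral \<mu> (indicator int_ring :: 'k \<Rightarrow> complex) 1"
    proof -
      have "(\<lambda>x. indicator int_ring x *\<^sub>R 1) = (indicator int_ring :: 'k \<Rightarrow> complex)"
        by (auto simp: indicator_def)
      then show ?thesis
        using has_bochner_integral_indicator[of int_ring \<mu> "1 :: complex"]
        by (simp add: measure_def haar_int_ring[OF haar] haar_sets[OF haar])
    qed
    ultimately show ?thesis
      using product_integral_prod[of "{..<1}" "\<lambda>_. indicator int_ring :: 'k \<Rightarrow> complex"]
      by (simp add: A_def has_bochner_integral_iff)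
  qed
  have closed: "fps_nth A n = recF n L \<beta> * exp (of_real L * (recE n \<beta> - of_nat n) / 2)" if "n \<le> N" for n
  proof (rule recF_closed_form[OF L A0 A1 \<beta> _ that])
    fix n assume n: "2 \<le> n" "n \<le> N"
    have "of_nat n * fps_nth A n = exp (of_real L) * of_nat n * fps_nth B n +
      (\<Sum>i=1..<n. exp (of_real L) * of_nat i * fps_nth B i * fps_nth A (n - i)
                - of_nat i * fps_nth A i * fps_nth B (n - i))"
      using fps_power_coeff_rec[OF B0, of n ?q] n by (simp add: rec qL)
    then show "of_nat n * fps_nth A n = exp (of_real L) * of_nat n * (exp (- complex_of_real L * recE n \<beta>) * fps_nth A n) +
      (\<Sum>i=1..<n. exp (of_real L) * of_nat i * (exp (- complex_of_real L * recE i \<beta>) * fps_nth A i) * fps_nth A (n - i)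
                - of_nat i * fps_nth A i * (exp (- complex_of_real L * recE (n - i) \<beta>) * fps_nth A (n - i)))"
      by (simp add: B_def w_def)
  qed
  show ?thesis
    unfolding has_partition_series_def
  proof (intro allI impI)
    fix I :: "nat set" assume I: "finite I" "card I \<le> N"
    then have "has_bochner_integral (\<Pi>\<^sub>M i\<in>I. \<mu>) (restricted_pair_prod int_ring ?\<kappa> I) (fact (card I) * fps_nth A (card I))"
      using A by (simp add: has_partition_series_def)
    then show "has_bochner_integral (\<Pi>\<^sub>M i\<in>I. \<mu>) (restricted_pair_prod int_ring ?\<kappa> I)
        (fact (card I) * fps_nth (Abs_fps (\<lambda>n. recF n L \<beta> * exp (of_real L * (recE n \<beta> - of_nat n) / 2))) (card I))"
      using closed[OF I(2)] by simp
  qed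
qed

end

section \<open>The projective line\<close>

text \<open>The points [x : 1] with |x| \<le> 1 and [1 : z] with |z| < 1 make up the projective line
  without overlap; strictness in the second condition assigns the points with |x| = 1 to one chart
  only.\<close>

definition affine_pt :: "'a::field \<Rightarrow> 'a proj_line" where
  "affine_pt x = abs_proj_line (vector [x, 1])"

definition infinite_pt :: "'a::field \<Rightarrow> 'a proj_line" where
  "infinite_pt z = abs_proj_line (vector [1, z])"

text \<open>Division by 0 gives the value 0 at [1 : 0]; the slope is consulted only on the affine
  disc, which does not contain that point.\<close>

lift_definition slope :: "'a::field proj_line \<Rightarrow> 'a" is "\<lambda>x. x $ 1 / x $ 2"
  by (auto simp: proj_rel_def)

lift_definition inverse_slope :: "'a::field proj_line \<Rightarrow> 'a" is "\<lambda>x. x $ 2 / x $ 1"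
  by (auto simp: proj_rel_def)

lift_definition in_affine_disc :: "'a::nonarch_valued_field proj_line \<Rightarrow> bool" is
  "\<lambda>x. absv (x $ 1) \<le> absv (x $ 2)"
  by (auto simp: proj_rel_def absv_mult)

definition affine_disc :: "'a::nonarch_valued_field proj_line set" where
  "affine_disc = {p. in_affine_disc p}"

text \<open>A single coordinate for both charts, in which the spherical distance within either piece
  is an absolute difference.\<close>

definition chart_coord :: "'a::nonarch_valued_field proj_line \<Rightarrow> 'a" where
  "chart_coord p = (if p \<in> affine_disc then slope p else inverse_slope p)"

lemma vec2_eq_iff: "x = (y :: 'a ^ 2) \<longleftrightarrow> x $ 1 = y $ 1 \<and> x $ 2 = y $ 2"
  by (simp add: vec_eq_iff forall_2)

lemma proj_rel_refl_iff: "proj_rel x x \<longleftrightarrow> x \<noteq> (0 :: 'a::field ^ 2)"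
  by (metis proj_rel_def vector_smult_lid zero_neq_one)

lemma vector2_nonzero [simp]:
  "vector [x, 1] \<noteq> (0 :: 'a::field ^ 2)" "vector [1, x] \<noteq> (0 :: 'a::field ^ 2)"
  by (simp_all add: vec2_eq_iff)

lemma proj_rel_refl_vector [simp]:
  "proj_rel (vector [x, 1]) (vector [x, 1 :: 'a::field])" "proj_rel (vector [1, x]) (vector [1, x :: 'a])"
  by (simp_all add: proj_rel_refl_iff)

lemma abs_proj_line_eqI: "proj_rel x y \<Longrightarrow> abs_proj_line x = abs_proj_line y"
  using Quotient_rel[OF Quotient_proj_line, of x y] by blast

text \<open>A representative is divided by its coordinate of larger absolute value; ties go to the
  affine chart.\<close>

lemma proj_line_cases:
  fixes p :: "'a::nonarch_valued_field proj_line"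
  obtains (affine) x where "absv x \<le> 1" "p = affine_pt x" | (infinite) z where "absv z < 1" "p = infinite_pt z"
proof -
  have "abs_proj_line (rep_proj_line p) = p" by (rule Quotient_abs_rep[OF Quotient_proj_line])
  moreover have "proj_rel (rep_proj_line p) (rep_proj_line p)" by (rule Quotient_rep_reflp[OF Quotient_proj_line])
  ultimately obtain v where v: "v \<noteq> 0" "p = abs_proj_line v" by (metis proj_rel_refl_iff)
  show thesis
  proof (cases "absv (v $ 1) \<le> absv (v $ 2)")
    case True
    have nz: "v $ 2 \<noteq> 0"
    proof
      assume "v $ 2 = 0"
      with True have "v $ 1 = 0" using absv_nonneg[of "v $ 1"] absv_eq_0_iff[of "v $ 1"] by simp
      with \<open>v $ 2 = 0\<close> v(1) show False by (simp add: vec2_eq_iff)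
    qed
    have "vector [v $ 1 / v $ 2, 1] = (1 / v $ 2) *s v"
      using nz by (simp add: vec2_eq_iff)
    then have "proj_rel v (vector [v $ 1 / v $ 2, 1])"
      using nz v(1) unfolding proj_rel_def by (intro conjI exI[of _ "1 / v $ 2"]) simp_all
    then have "p = affine_pt (v $ 1 / v $ 2)"
      using v(2) by (simp add: affine_pt_def abs_proj_line_eqI)
    moreover have "absv (v $ 1 / v $ 2) \<le> 1" using True nz by (simp add: absv_divide)
    ultimately show thesis by (rule affine[rotated])
  next
    case False
    then have nz: "v $ 1 \<noteq> 0" using absv_nonneg[of "v $ 2"] by auto
    have "vector [1, v $ 2 / v $ 1] = (1 / v $ 1) *s v"
      using nz by (simp add: vec2_eq_iff)
    then have "proj_rel v (vector [1, v $ 2 / v $ 1])"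
      using nz v(1) unfolding proj_rel_def by (intro conjI exI[of _ "1 / v $ 1"]) simp_all
    then have "p = infinite_pt (v $ 2 / v $ 1)"
      using v(2) by (simp add: infinite_pt_def abs_proj_line_eqI)
    moreover have "absv (v $ 2 / v $ 1) < 1" using False nz by (simp add: absv_divide)
    ultimately show thesis by (rule infinite[rotated])
  qed
qed

lemma affine_pt_in_affine_disc [simp]:
  "affine_pt x \<in> affine_disc \<longleftrightarrow> absv (x :: 'a::nonarch_valued_field) \<le> 1"
  by (simp add: affine_disc_def affine_pt_def in_affine_disc.abs_eq)

lemma infinite_pt_in_affine_disc [simp]:
  "infinite_pt z \<in> affine_disc \<longleftrightarrow> 1 \<le> absv (z :: 'a::nonarch_valued_field)"
  by (simp add: affine_disc_def infinite_pt_def in_affine_disc.abs_eq)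

lemma chart_coord_affine_pt [simp]:
  "absv (x :: 'a::nonarch_valued_field) \<le> 1 \<Longrightarrow> chart_coord (affine_pt x) = x"
  by (simp add: chart_coord_def) (simp add: affine_pt_def slope.abs_eq)

lemma chart_coord_infinite_pt [simp]:
  "absv (z :: 'a::nonarch_valued_field) < 1 \<Longrightarrow> chart_coord (infinite_pt z) = z"
  by (simp add: chart_coord_def) (simp add: infinite_pt_def inverse_slope.abs_eq)

lemma spherical_dist_affine_pt:
  assumes "absv x \<le> 1" "absv y \<le> 1"
  shows "spherical_dist (affine_pt x) (affine_pt y) = absv (x - y)"
  using assms unfolding affine_pt_def by (subst spherical_dist.abs_eq) simp_all

lemma spherical_dist_infinite_pt:
  assumes "absv x < 1" "absv y < 1"
  shows "spherical_dist (infinite_pt x) (infinite_pt y) = absv (x - y)"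
  using assms absv_diff_commute[of x y] unfolding infinite_pt_def by (subst spherical_dist.abs_eq) simp_all

text \<open>The determinant of the representatives is xz - 1 up to sign, of absolute value 1 because
  |xz| < 1, and both maxima in the denominator are 1.\<close>

lemma spherical_dist_cross:
  assumes "absv x \<le> 1" "absv z < 1"
  shows "spherical_dist (affine_pt x) (infinite_pt z) = 1" "spherical_dist (infinite_pt z) (affine_pt x) = 1"
proof -
  have "absv x * absv z \<le> 1 * absv z" using assms by (intro mult_right_mono absv_nonneg)
  with assms have lt: "absv (x * z) < 1" by (simp add: absv_mult)
  have "absv (x * z - 1) = 1" using absv_eq_if_close[of 1 "x * z - 1 + 1 + (1 - x * z) - x * z"] absv_eq_if_close[of 1 "1 - x * z"] lt
    by (simp add: absv_diff_commute[of "x * z" 1])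
  then show "spherical_dist (affine_pt x) (infinite_pt z) = 1" "spherical_dist (infinite_pt z) (affine_pt x) = 1"
    using assms absv_diff_commute[of "x * z" 1] unfolding infinite_pt_def affine_pt_def
    by (subst spherical_dist.abs_eq; simp add: mult.commute)+
qed

text \<open>The names \<open>a\<close> and \<open>b\<close> stand for the two coordinates in either
  order, so that both charts are served. Vectors carry the product topology, so a box of balls
  around each point has to be found.\<close>

lemma open_slope_preimage:
  fixes U :: "'a::nonarch_valued_field set"
  assumes U: "open U" and ab: "{a, b} = (UNIV :: 2 set)"
  shows "open {x :: 'a ^ 2. x \<noteq> 0 \<and> absv (x $ a) \<le> absv (x $ b) \<and> x $ a / x $ b \<in> U}" (is "open ?V")
  unfolding open_vec_def
proof (intro ballI)
  fix x assume x: "x \<in> ?V"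
  have nz: "x $ b \<noteq> 0"
  proof
    assume b: "x $ b = 0"
    with x have a: "x $ a = 0" using absv_nonneg[of "x $ a"] absv_eq_0_iff[of "x $ a"] by simp
    have "x $ i = 0" for i using a b ab by (metis UNIV_I insertE singletonD)
    with x show False by (simp add: vec_eq_iff)
  qed
  obtain e where e: "e > 0" "ball (x $ a / x $ b) e \<subseteq> U" using U x open_contains_ball by blast
  \<comment> \<open>Being at most \<open>absv (x $ b)\<close> preserves the inequality between the
    coordinates and the absolute value of the denominator; being at most
    \<open>e * absv (x $ b)\<close> keeps the quotient within \<open>e\<close>.\<close>
  define \<rho> where "\<rho> = min e 1 * absv (x $ b)"
  have \<rho>: "0 < \<rho>" "\<rho> \<le> absv (x $ b)" "\<rho> \<le> e * absv (x $ b)"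
    using e nz absv_pos[of "x $ b"] by (auto simp: \<rho>_def min_def mult_le_cancel_right1)
  have "y \<in> ?V" if "\<forall>i. y $ i \<in> ball (x $ i) \<rho>" for y
  proof -
    have close: "absv (x $ i - y $ i) < \<rho>" for i using that by (simp add: dist_eq_absv)
    then have yb: "absv (y $ b) = absv (x $ b)" using absv_eq_if_close[of "x $ b" "y $ b"] \<rho> by (meson less_le_trans)
    then have nzy: "y $ b \<noteq> 0" using nz absv_eq_0_iff by metis
    have "absv (y $ a) \<le> max (absv (x $ a)) (absv (x $ a - y $ a))"
      using absv_diff_le_max[of "x $ a" "x $ a - y $ a"] by simp
    then have ya: "absv (y $ a) \<le> absv (y $ b)" using x yb \<rho> close[of a] by auto
    \<comment> \<open>Clearing denominators writes the difference of the quotients as a combination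
      of the two coordinate differences.\<close>
    have "absv (y $ b) * absv (x $ b) * absv (x $ a / x $ b - y $ a / y $ b) =
        absv (y $ b * x $ b * (x $ a / x $ b - y $ a / y $ b))" by (simp only: absv_mult)
    also have "y $ b * x $ b * (x $ a / x $ b - y $ a / y $ b) = (x $ a - y $ a) * x $ b - x $ a * (x $ b - y $ b)"
      using nz nzy by (simp add: field_simps)
    also have "absv \<dots> \<le> max (absv (x $ a - y $ a) * absv (x $ b)) (absv (x $ a) * absv (x $ b - y $ b))"
      using absv_diff_le_max by (metis absv_mult)
    also have "\<dots> < \<rho> * absv (x $ b)"
    proof -
      have "absv (x $ a - y $ a) * absv (x $ b) < \<rho> * absv (x $ b)"
        using close nz by simp
      moreover have "absv (x $ a) * absv (x $ b - y $ b) \<le> absv (x $ b) * absv (x $ b - y $ b)"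
        using x by (intro mult_right_mono absv_nonneg) auto
      moreover have "absv (x $ b) * absv (x $ b - y $ b) < absv (x $ b) * \<rho>"
        using close nz by simp
      ultimately show ?thesis by (simp add: mult.commute)
    qed
    finally have "absv (x $ b) * absv (x $ b) * absv (x $ a / x $ b - y $ a / y $ b) < absv (x $ b) * absv (x $ b) * e"
      unfolding yb using mult_right_mono[OF \<rho>(3) absv_nonneg[of "x $ b"]] by (simp add: mult_ac)
    then have "absv (x $ a / x $ b - y $ a / y $ b) < e"
      using nz by (simp add: mult_less_cancel_left_pos)
    then have "y $ a / y $ b \<in> U" using e by (auto simp: dist_eq_absv)
    moreover have "y \<noteq> 0" using nzy by auto
    ultimately show ?thesis using ya by simp
  qed
  then show "\<exists>A. (\<forall>i. open (A i) \<and> x $ i \<in> A i) \<and> (\<forall>y. (\<forall>i. y $ i \<in> A i) \<longrightarrow> y \<in> ?V)"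
    using \<rho>(1) by (intro exI[of _ "\<lambda>i. ball (x $ i) \<rho>"]) auto
qed

lemma open_proj_lineI:
  assumes "open {x :: 'a::{field,topological_space} ^ 2. x \<noteq> 0 \<and> abs_proj_line x \<in> U}"
  shows "open U"
  unfolding open_proj_line_def openin_open
  by (rule exI[of _ "{x :: 'a ^ 2. x \<noteq> 0 \<and> abs_proj_line x \<in> U}"]) (use assms in auto)

lemma open_affine_disc_slope:
  assumes "open (U :: 'a::nonarch_valued_field set)"
  shows "open {p \<in> affine_disc. slope p \<in> U}"
proof (rule open_proj_lineI)
  have "{x :: 'a ^ 2. x \<noteq> 0 \<and> abs_proj_line x \<in> {p \<in> affine_disc. slope p \<in> U}} =
    {x. x \<noteq> 0 \<and> absv (x $ 1) \<le> absv (x $ 2) \<and> x $ 1 / x $ 2 \<in> U}"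
    by (auto simp: affine_disc_def in_affine_disc.abs_eq slope.abs_eq proj_rel_refl_iff)
  then show "open {x :: 'a ^ 2. x \<noteq> 0 \<and> abs_proj_line x \<in> {p \<in> affine_disc. slope p \<in> U}}"
    using open_slope_preimage[OF assms, of 1 2] by (simp add: UNIV_2)
qed

text \<open>Larger than the complement of \<open>affine_disc\<close>: with the non-strict inequality
  the openness lemma applies with exchanged coordinates, and the overlap is removed
  afterwards.\<close>

lift_definition in_infinite_disc :: "'a::nonarch_valued_field proj_line \<Rightarrow> bool" is
  "\<lambda>x. absv (x $ 2) \<le> absv (x $ 1)"
  by (auto simp: proj_rel_def absv_mult)

lemma open_infinite_disc_slope:
  assumes "open (U :: 'a::nonarch_valued_field set)"
  shows "open {p. in_infinite_disc p \<and> inverse_slope p \<in> U}"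
proof (rule open_proj_lineI)
  have "{x :: 'a ^ 2. x \<noteq> 0 \<and> abs_proj_line x \<in> {p. in_infinite_disc p \<and> inverse_slope p \<in> U}} =
    {x. x \<noteq> 0 \<and> absv (x $ 2) \<le> absv (x $ 1) \<and> x $ 2 / x $ 1 \<in> U}"
    by (auto simp: in_infinite_disc.abs_eq inverse_slope.abs_eq proj_rel_refl_iff)
  then show "open {x :: 'a ^ 2. x \<noteq> 0 \<and> abs_proj_line x \<in> {p. in_infinite_disc p \<and> inverse_slope p \<in> U}}"
    using open_slope_preimage[OF assms, of 2 1] by (simp add: UNIV_2 insert_commute)
qed

lemma affine_disc_borel [measurable]: "affine_disc \<in> sets (borel :: 'a::nonarch_valued_field proj_line measure)"
  using open_affine_disc_slope[of "UNIV :: 'a set"] by (simp add: borel_open)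

lemma chart_coord_measurable [measurable]:
  "chart_coord \<in> borel_measurable (borel :: 'a::nonarch_valued_field proj_line measure)"
proof (rule borel_measurableI)
  fix U :: "'a set" assume U: "open U"
  have inf: "in_infinite_disc p" if "p \<notin> affine_disc" for p :: "'a proj_line"
    using that by (cases p rule: proj_line_cases) (auto simp: infinite_pt_def in_infinite_disc.abs_eq)
  have "chart_coord -` U \<inter> space borel = {p \<in> affine_disc. slope p \<in> U} \<union>
      ({p. in_infinite_disc p \<and> inverse_slope p \<in> U} - affine_disc)"
    using inf by (auto simp: chart_coord_def split: if_splits)
  then show "chart_coord -` U \<inter> space borel \<in> sets (borel :: 'a proj_line measure)"
    using open_affine_disc_slope[OF U] open_infinite_disc_slope[OF U] by auto
qed

lemma measurable_abs_proj_line_comp: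
  fixes v :: "'a::nonarch_valued_field \<Rightarrow> 'a ^ 2"
  assumes "continuous_on UNIV (\<lambda>x. v x $ 1)" "continuous_on UNIV (\<lambda>x. v x $ 2)" "\<And>x. v x \<noteq> 0"
  shows "(\<lambda>x. abs_proj_line (v x)) \<in> borel_measurable borel"
proof (rule borel_measurableI)
  fix W :: "'a proj_line set" assume "open W"
  then obtain T :: "('a ^ 2) set" where T: "open T" "{x. x \<noteq> 0 \<and> abs_proj_line x \<in> W} = {x. x \<noteq> 0} \<inter> T"
    unfolding open_proj_line_def openin_open by blast
  have "continuous_on UNIV (\<lambda>x. v x $ i)" for i using assms(1,2) exhaust_2[of i] by auto
  then have "continuous_on UNIV (\<lambda>x. \<chi> i. v x $ i)" by (rule continuous_on_vec_lambda)
  then have "continuous_on UNIV v" by simp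
  then have "open (v -` T)" using T(1) by (simp add: open_vimage)
  moreover have "(\<lambda>x. abs_proj_line (v x)) -` W = v -` T"
    using T(2) assms(3) by blast
  ultimately show "(\<lambda>x. abs_proj_line (v x)) -` W \<inter> space borel \<in> sets borel" by simp
qed

lemma affine_pt_measurable [measurable]:
  "affine_pt \<in> borel_measurable (borel :: 'a::nonarch_valued_field measure)"
  unfolding affine_pt_def[abs_def] by (rule measurable_abs_proj_line_comp) auto

lemma infinite_pt_measurable [measurable]:
  "infinite_pt \<in> borel_measurable (borel :: 'a::nonarch_valued_field measure)"
  unfolding infinite_pt_def[abs_def] by (rule measurable_abs_proj_line_comp) auto

text \<open>Through the charts, measurability of the metric for the product sigma-algebra reduces to
  that of the absolute difference on K.\<close>

lemma spherical_dist_eq_chart: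
  "spherical_dist p p' = (if p \<in> affine_disc \<longleftrightarrow> p' \<in> affine_disc then absv (chart_coord p - chart_coord p') else 1)"
  by (cases p rule: proj_line_cases; cases p' rule: proj_line_cases)
    (simp_all add: spherical_dist_affine_pt spherical_dist_infinite_pt spherical_dist_cross)

lemma spherical_dist_nonneg: "0 \<le> spherical_dist p p'"
  by (simp add: spherical_dist_eq_chart absv_nonneg)

lemma measurable_spherical_dist:
  "(\<lambda>(p, p'). spherical_dist p p') \<in> borel_measurable (borel \<Otimes>\<^sub>M (borel :: 'a::nonarch_local_field proj_line measure))"
proof -
  have "(\<lambda>w. (chart_coord (fst w), chart_coord (snd w))) \<in>
      measurable (borel \<Otimes>\<^sub>M (borel :: 'a proj_line measure)) (borel \<Otimes>\<^sub>M borel)"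
    by measurable
  from measurable_compose[OF this measurable_absv_diff]
  have [measurable]: "(\<lambda>w. absv (chart_coord (fst w) - chart_coord (snd w))) \<in>
      borel_measurable (borel \<Otimes>\<^sub>M (borel :: 'a proj_line measure))" by simp
  show ?thesis unfolding spherical_dist_eq_chart case_prod_beta by measurable
qed

section \<open>Translations and the coordinate swap as elements of GL_2(R)\<close>

lemma GL2_int_ring_invertible: "A \<in> GL2_int_ring \<Longrightarrow> invertible A"
  by (auto simp: GL2_int_ring_def invertible_def)

definition translation_matrix :: "'a::field \<Rightarrow> 'a ^ 2 ^ 2" where
  "translation_matrix a = vector [vector [1, a], vector [0, 1]]"

definition swap_matrix :: "'a::field ^ 2 ^ 2" where
  "swap_matrix = vector [vector [0, 1], vector [1, 0]]"

lemma translation_matrix_GL2: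
  assumes "a \<in> int_ring"
  shows "translation_matrix a \<in> GL2_int_ring"
proof -
  have "translation_matrix a ** translation_matrix (- a) = mat 1"
    "translation_matrix (- a) ** translation_matrix a = mat 1"
    by (simp_all add: translation_matrix_def vec_eq_iff forall_2 matrix_matrix_mult_def sum_2 mat_def)
  moreover have "translation_matrix b $ i $ j \<in> int_ring" if "b \<in> int_ring" for b :: 'a and i j
    using that exhaust_2[of i] exhaust_2[of j] by (auto simp: translation_matrix_def int_ring_def)
  moreover have "- a \<in> int_ring" using assms by (simp add: int_ring_def)
  ultimately show ?thesis using assms unfolding GL2_int_ring_def by blast
qed

lemma swap_matrix_GL2: "swap_matrix \<in> GL2_int_ring"
proof -
  have "swap_matrix ** swap_matrix = (mat 1 :: 'a ^ 2 ^ 2)"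
    by (simp add: swap_matrix_def vec_eq_iff forall_2 matrix_matrix_mult_def sum_2 mat_def)
  moreover have "(swap_matrix :: 'a ^ 2 ^ 2) $ i $ j \<in> int_ring" for i j
    using exhaust_2[of i] exhaust_2[of j] by (auto simp: swap_matrix_def int_ring_def)
  ultimately show ?thesis unfolding GL2_int_ring_def by blast
qed

lemma proj_act_translation:
  "a \<in> int_ring \<Longrightarrow> proj_act (translation_matrix a) (affine_pt x) = affine_pt (a + x)"
  using GL2_int_ring_invertible[OF translation_matrix_GL2, of a]
  unfolding affine_pt_def
  by (subst proj_act.abs_eq)
    (auto intro!: arg_cong[of _ _ abs_proj_line] simp: translation_matrix_def vec_eq_iff forall_2 matrix_vector_mult_def sum_2)

lemma proj_act_swap:
  "proj_act swap_matrix (infinite_pt z) = affine_pt (z :: 'a::nonarch_valued_field)"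
  using GL2_int_ring_invertible[OF swap_matrix_GL2[where 'a = 'a]]
  unfolding affine_pt_def infinite_pt_def
  by (subst proj_act.abs_eq)
    (auto intro!: arg_cong[of _ _ abs_proj_line] simp: swap_matrix_def vec_eq_iff forall_2 matrix_vector_mult_def sum_2)

lemma affine_image_eq:
  assumes "(B :: 'a::nonarch_local_field set) \<subseteq> int_ring"
  shows "affine_pt ` B = chart_coord -` B \<inter> affine_disc"
proof (intro equalityI subsetI)
  fix p assume "p \<in> chart_coord -` B \<inter> affine_disc"
  then show "p \<in> affine_pt ` B" by (cases p rule: proj_line_cases) auto
qed (use assms in \<open>auto simp: int_ring_def\<close>)

lemma affine_image_borel: "B \<in> sets borel \<Longrightarrow> B \<subseteq> int_ring \<Longrightarrow> affine_pt ` B \<in> sets (borel :: 'a::nonarch_local_field proj_line measure)"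
  using measurable_sets[OF chart_coord_measurable, of B] affine_image_eq[of B] by simp

lemma infinite_image_eq: "- affine_disc = infinite_pt ` disc (0 :: 'a::nonarch_local_field) 1"
proof (intro equalityI subsetI)
  fix p :: "'a proj_line" assume "p \<in> - affine_disc"
  then show "p \<in> infinite_pt ` disc 0 1"
    by (cases p rule: proj_line_cases) (auto simp: disc_def absv_lt_1_iff[symmetric])
qed (auto simp: disc_def absv_lt_1_iff[symmetric])

section \<open>The invariant measure on the projective line\<close>

context
  fixes \<mu> :: "'k::nonarch_local_field measure" and \<nu> :: "'k proj_line measure"
  assumes haar: "is_normalized_haar \<mu>" and inv: "is_PGL2_invariant_prob \<nu>"
begin

lemma proj_sets [simp, measurable_cong]: "sets \<nu> = sets borel"
  using inv by (simp add: is_PGL2_invariant_prob_def)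

lemma proj_space [simp]: "space \<nu> = UNIV"
  using sets_eq_imp_space_eq[OF proj_sets] by simp

lemma proj_prob_space: "prob_space \<nu>"
  using inv by (simp add: is_PGL2_invariant_prob_def)

lemma proj_invariant:
  "A \<in> GL2_int_ring \<Longrightarrow> B \<in> sets borel \<Longrightarrow> emeasure \<nu> (proj_act A ` B) = emeasure \<nu> B"
  using inv by (simp add: is_PGL2_invariant_prob_def)

lemma proj_emeasure_affine_disc_translate:
  assumes a: "a \<in> int_ring"
  shows "emeasure \<nu> (affine_pt ` disc a m) = emeasure \<nu> (affine_pt ` disc 0 m)"
proof -
  have "disc a m = (\<lambda>x. a + x) ` disc 0 m"
  proof (intro equalityI subsetI)
    fix x assume "x \<in> disc a m"
    then show "x \<in> (\<lambda>x. a + x) ` disc 0 m"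
      by (intro image_eqI[of _ _ "x - a"]) (auto simp: disc_def)
  qed (auto simp: disc_def)
  then have "affine_pt ` disc a m = proj_act (translation_matrix a) ` affine_pt ` disc 0 m"
    by (simp add: image_image proj_act_translation[OF a])
  moreover have "affine_pt ` disc 0 m \<in> sets (borel :: 'k proj_line measure)"
    by (intro affine_image_borel disc_borel disc_subset_int_ring) (simp add: int_ring_def)
  ultimately show ?thesis
    using proj_invariant[OF translation_matrix_GL2[OF a]] by simp
qed

text \<open>Transports the invariant measure from the affine disc to K, where it can be compared
  with the Haar measure on discs.\<close>

definition affine_part :: "'k measure" where
  "affine_part = distr (density \<nu> (indicator affine_disc)) borel chart_coord"

lemma affine_part_sets: "sets affine_part = sets borel"
  by (simp add: affine_part_def)

lemma emeasure_affine_part: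
  assumes "B \<in> sets borel"
  shows "emeasure affine_part B = emeasure \<nu> (affine_pt ` (B \<inter> int_ring))"
proof -
  have "chart_coord -` B \<inter> affine_disc = affine_pt ` (B \<inter> int_ring)"
  proof (intro equalityI subsetI)
    fix p :: "'k proj_line" assume "p \<in> chart_coord -` B \<inter> affine_disc"
    then show "p \<in> affine_pt ` (B \<inter> int_ring)"
      by (cases p rule: proj_line_cases) (auto simp: int_ring_def)
  qed (auto simp: int_ring_def)
  moreover have m: "chart_coord -` B \<in> sets (borel :: 'k proj_line measure)"
    using measurable_sets[OF chart_coord_measurable assms] by simp
  moreover have "emeasure affine_part B = emeasure \<nu> (chart_coord -` B \<inter> affine_disc)"
    unfolding affine_part_def using assms m
    by (subst emeasure_distr; simp)
      (subst emeasure_density; simp add: indicator_inter_arith[symmetric] Int_commute)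
  ultimately show ?thesis by simp
qed

lemma emeasure_affine_part_disc:
  assumes "a \<in> int_ring"
  shows "emeasure affine_part (disc a m) = emeasure \<nu> (affine_pt ` disc a m)"
  using disc_subset_int_ring[OF assms, of m] by (subst emeasure_affine_part) (auto simp: Int_absorb2)

lemma affine_part_disc_translate:
  assumes "a \<in> int_ring"
  shows "emeasure affine_part (disc a m) = emeasure affine_part (disc 0 m)"
proof -
  have "(0 :: 'k) \<in> int_ring" by (simp add: int_ring_def)
  then show ?thesis
    using assms proj_emeasure_affine_disc_translate[OF assms, of m] by (simp only: emeasure_affine_part_disc)
qed

text \<open>The swap carries the complement of the affine disc onto the points [z : 1] with |z| < 1,
  a disc of level 1 in the affine chart.\<close>

lemma emeasure_infinite_disc:
  assumes A: "A \<in> sets borel"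
  shows "emeasure \<nu> (A \<inter> - affine_disc) = emeasure affine_part (infinite_pt -` A \<inter> disc 0 1)"
proof -
  have "A \<inter> - affine_disc = infinite_pt ` (infinite_pt -` A \<inter> disc 0 1)"
    unfolding infinite_image_eq by auto
  then have "proj_act swap_matrix ` (A \<inter> - affine_disc) = affine_pt ` (infinite_pt -` A \<inter> disc 0 1)"
    by (simp only: image_image proj_act_swap)
  moreover have "emeasure \<nu> (proj_act swap_matrix ` (A \<inter> - affine_disc)) = emeasure \<nu> (A \<inter> - affine_disc)"
    using A by (intro proj_invariant swap_matrix_GL2) auto
  moreover have "infinite_pt -` A \<inter> disc 0 1 \<in> sets (borel :: 'k measure)"
    using measurable_sets[OF infinite_pt_measurable A] by auto
  moreover have "disc 0 1 \<subseteq> (int_ring :: 'k set)"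
    by (intro disc_subset_int_ring) (simp add: int_ring_def)
  ultimately show ?thesis
    by (subst emeasure_affine_part) (auto simp: Int_absorb2 Int_assoc)
qed

text \<open>The complement of the affine disc has the mass of a disc of level 1, hence 1 / q of the
  mass of the affine disc, and the two masses add up to 1.\<close>

lemma emeasure_affine_part_int_ring:
  "emeasure affine_part int_ring = ennreal (real (residue_card TYPE('k)) / (real (residue_card TYPE('k)) + 1))"
proof -
  let ?q = "real (residue_card TYPE('k))"
  interpret prob_space \<nu> by (rule proj_prob_space)
  have q: "1 < ?q" using residue_card_gt_1[where 'a = 'k] by simp
  have "affine_pt ` int_ring = (affine_disc :: 'k proj_line set)"
  proof (intro equalityI subsetI)
    fix p :: "'k proj_line" assume "p \<in> affine_disc"
    then show "p \<in> affine_pt ` int_ring" by (cases p rule: proj_line_cases) (auto simp: int_ring_def)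
  qed (auto simp: int_ring_def)
  then have R: "emeasure affine_part int_ring = emeasure \<nu> affine_disc"
    by (simp add: emeasure_affine_part)
  have "emeasure \<nu> (- affine_disc) = ennreal (1 / ?q) * emeasure affine_part int_ring"
    using emeasure_infinite_disc[of UNIV] emeasure_disc_eq_power[OF affine_part_sets affine_part_disc_translate, of 1]
    by simp
  moreover have "emeasure \<nu> affine_disc + emeasure \<nu> (- affine_disc) = 1"
  proof -
    have "emeasure \<nu> affine_disc + emeasure \<nu> (- affine_disc) = emeasure \<nu> (affine_disc \<union> - affine_disc)"
      by (intro plus_emeasure) auto
    then show ?thesis using emeasure_space_1 by simp
  qed
  ultimately have "emeasure \<nu> affine_disc + ennreal (1 / ?q) * emeasure \<nu> affine_disc = 1" using R by simp
  then have "ennreal (measure \<nu> affine_disc + 1 / ?q * measure \<nu> affine_disc) = ennreal 1"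
    using q by (simp add: emeasure_eq_measure ennreal_mult[symmetric] ennreal_plus[symmetric] del: ennreal_plus)
  then have "measure \<nu> affine_disc + 1 / ?q * measure \<nu> affine_disc = 1"
    using q by (subst (asm) ennreal_inj) auto
  then have "measure \<nu> affine_disc = ?q / (?q + 1)" using q by (simp add: field_simps)
  then show ?thesis using R by (simp add: emeasure_eq_measure)
qed

text \<open>The two measures agree on every disc: one that meets \<open>int_ring\<close> has a
  centre there, so translation invariance determines its mass; any other has mass 0 on both
  sides.\<close>

lemma affine_part_eq:
  assumes B: "B \<in> sets borel" "B \<subseteq> int_ring"
  shows "emeasure affine_part B = ennreal (real (residue_card TYPE('k)) / (real (residue_card TYPE('k)) + 1)) * emeasure \<mu> B"
proof -
  let ?q = "real (residue_card TYPE('k))"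
  let ?c = "ennreal (?q / (?q + 1))"
  let ?M = "density \<mu> (\<lambda>x. ?c * indicator int_ring x)"
  have q: "1 < ?q" using residue_card_gt_1[where 'a = 'k] by simp
  have R [measurable]: "int_ring \<in> sets \<mu>" by (simp add: haar_sets[OF haar])
  have meas: "(\<lambda>x. ?c * indicator int_ring x) \<in> borel_measurable \<mu>" by measurable
  have M: "emeasure ?M A = ?c * emeasure \<mu> (A \<inter> int_ring)" if "A \<in> sets borel" for A
  proof -
    have "emeasure ?M A = (\<integral>\<^sup>+x. ?c * indicator (A \<inter> int_ring) x \<partial>\<mu>)"
      using that haar_sets[OF haar]
      by (subst emeasure_density[OF meas]) (auto simp: indicator_inter_arith mult_ac intro!: nn_integral_cong)
    also have "\<dots> = ?c * emeasure \<mu> (A \<inter> int_ring)"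
      using that haar_sets[OF haar] by (intro nn_integral_cmult_indicator) auto
    finally show ?thesis .
  qed
  have eq: "emeasure affine_part (disc a m) = emeasure ?M (disc a m)" for a m
  proof (cases "disc a m \<inter> int_ring = {}")
    case True
    then show ?thesis by (simp add: M emeasure_affine_part)
  next
    case False
    then obtain b where b: "b \<in> int_ring" "b \<in> disc a m" by blast
    then have ab: "disc a m = disc b m" using disc_eq_if_mem by blast
    have "emeasure affine_part (disc b m) = ennreal ((1 / ?q) ^ m) * ?c"
      using affine_part_disc_translate[OF b(1)] emeasure_disc_eq_power[OF affine_part_sets affine_part_disc_translate]
      by (simp add: emeasure_affine_part_int_ring)
    also have "\<dots> = ?c * ennreal ((1 / ?q) ^ m)" by (rule mult.commute)
    also have "\<dots> = emeasure ?M (disc b m)"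
      by (simp only: M[OF disc_borel] Int_absorb2[OF disc_subset_int_ring[OF b(1)]] haar_disc[OF haar])
    finally show ?thesis by (simp add: ab)
  qed
  have "affine_part = ?M"
  proof (rule measure_eqI_disc)
    show "emeasure affine_part (disc a 0) \<noteq> \<infinity>" for a
    proof -
      have "emeasure \<mu> (disc a 0 \<inter> int_ring) \<le> emeasure \<mu> int_ring"
        by (intro emeasure_mono) (auto simp: haar_sets[OF haar])
      then have "emeasure ?M (disc a 0) \<le> ?c * 1"
        by (simp only: M[OF disc_borel] haar_int_ring[OF haar]) (rule mult_left_mono, auto)
      also have "?c * 1 < \<infinity>" by simp
      finally show ?thesis unfolding eq by simp
    qed
  qed (simp_all add: affine_part_sets haar_sets[OF haar] eq)
  then show ?thesis using M[OF B(1)] B(2) by (simp add: Int_absorb2)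
qed

lemma proj_emeasure_affine:
  assumes A: "A \<in> sets borel"
  shows "emeasure \<nu> (A \<inter> affine_disc) =
    ennreal (real (residue_card TYPE('k)) / (real (residue_card TYPE('k)) + 1)) * emeasure \<mu> (affine_pt -` A \<inter> int_ring)"
proof -
  let ?B = "affine_pt -` A \<inter> int_ring"
  have B: "?B \<in> sets borel" using measurable_sets[OF affine_pt_measurable A] by auto
  have "A \<inter> affine_disc = affine_pt ` (?B \<inter> int_ring)"
  proof (intro equalityI subsetI)
    fix p assume "p \<in> A \<inter> affine_disc"
    then show "p \<in> affine_pt ` (?B \<inter> int_ring)"
      by (cases p rule: proj_line_cases) (auto simp: int_ring_def)
  qed (auto simp: int_ring_def)
  then show ?thesis
    using affine_part_eq[OF B] emeasure_affine_part[OF B] by simp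
qed

text \<open>The constant is q / (q + 1) from the affine part times 1 / q from contracting
  \<open>int_ring\<close> to the maximal ideal. The summand \<open>0\<close> keeps the map in the
  form of \<open>haar_scale\<close>.\<close>

lemma proj_emeasure_infinite:
  assumes A: "A \<in> sets borel"
  shows "emeasure \<nu> (A \<inter> - affine_disc) = ennreal (1 / (real (residue_card TYPE('k)) + 1)) *
    emeasure \<mu> ((\<lambda>x. infinite_pt (0 + uniformizer * x)) -` A \<inter> int_ring)"
proof -
  let ?q = "real (residue_card TYPE('k))"
  have q: "1 < ?q" using residue_card_gt_1[where 'a = 'k] by simp
  have IA: "infinite_pt -` A \<in> sets (borel :: 'k measure)" using measurable_sets[OF infinite_pt_measurable A] by simp
  have "disc 0 1 \<subseteq> (int_ring :: 'k set)"
    by (intro disc_subset_int_ring) (simp add: int_ring_def)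
  then have "emeasure \<nu> (A \<inter> - affine_disc) = ennreal (?q / (?q + 1)) * emeasure \<mu> (infinite_pt -` A \<inter> disc 0 1)"
    unfolding emeasure_infinite_disc[OF A] using IA by (intro affine_part_eq) auto
  also have "\<dots> = (ennreal (?q / (?q + 1)) * ennreal (1 / ?q)) *
      emeasure \<mu> ((\<lambda>x. 0 + uniformizer * x) -` (infinite_pt -` A) \<inter> int_ring)"
    by (simp only: haar_scale[OF haar IA] mult.assoc)
  also have "ennreal (?q / (?q + 1)) * ennreal (1 / ?q) = ennreal (1 / (?q + 1))"
    using q by (simp add: ennreal_mult[symmetric])
  finally show ?thesis by (simp only: vimage_def mem_Collect_eq)
qed

text \<open>The affine disc is an isometric copy of \<open>int_ring\<close>, so its pairs carry the
  factor 1. The complement is a copy contracted by 1 / q, so its pairs carry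
  \<open>real_cpowr \<beta> (1 / q)\<close>.\<close>

lemma partition_series_P1:
  fixes \<beta> :: complex
  defines "L \<equiv> ln (real (residue_card TYPE('k)))" and "q \<equiv> real (residue_card TYPE('k))"
  assumes \<beta>: "\<And>n. 2 \<le> n \<Longrightarrow> n \<le> N \<Longrightarrow> Re \<beta> > - 2 / real n"
  defines "a \<equiv> \<lambda>n. recF n L \<beta> * exp (of_real L * (recE n \<beta> - of_nat n) / 2)"
  shows "has_partition_series \<nu> UNIV (\<lambda>p p'. real_cpowr \<beta> (spherical_dist p p')) N
    (Abs_fps (\<lambda>n. of_real (q / (q + 1)) ^ n * 1 ^ (n choose 2) * a n) *
     Abs_fps (\<lambda>n. of_real (1 / (q + 1)) ^ n * real_cpowr \<beta> (1 / q) ^ (n choose 2) * a n))"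
proof -
  interpret prob_space \<nu> by (rule proj_prob_space)
  have sf: "sigma_finite_measure \<nu>" by unfold_locales
  have q: "1 < q" using residue_card_gt_1[where 'a = 'k] by (simp add: q_def)
  note R = partition_series_R[OF haar \<beta>, folded L_def]
  have A: "has_partition_series \<mu> int_ring (\<lambda>x y. real_cpowr \<beta> (absv (x - y))) N (Abs_fps a)"
    using R unfolding a_def by simp
  have sets_pair: "sets (\<nu> \<Otimes>\<^sub>M \<nu>) = sets (borel \<Otimes>\<^sub>M borel)"
    by (intro sets_pair_measure_cong proj_sets)
  have meas: "(\<lambda>(p, p'). real_cpowr \<beta> (spherical_dist p p')) \<in> borel_measurable (\<nu> \<Otimes>\<^sub>M \<nu>)"
    unfolding measurable_cong_sets[OF sets_pair refl]
    using measurable_compose[OF measurable_spherical_dist[where 'a = 'k] real_cpowr_measurable]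
    by (simp add: case_prod_beta)
  have fin: "emeasure \<nu> S < \<infinity>" for S using emeasure_finite[of S] by (metis infinity_ennreal_def top.not_eq_extremum)
  have R': "int_ring \<in> sets \<mu>" "emeasure \<mu> int_ring < \<infinity>"
    by (simp_all add: haar_sets[OF haar] haar_int_ring[OF haar])
  have "has_partition_series \<nu> affine_disc (\<lambda>p p'. real_cpowr \<beta> (spherical_dist p p')) N
    (Abs_fps (\<lambda>n. of_real (q / (q + 1)) ^ n * 1 ^ (n choose 2) * fps_nth (Abs_fps a) n))"
  proof (rule has_partition_series_image[OF sf haar_sigma_finite[OF haar] _ fin R' _ _ _ meas _ A])
    show "affine_pt \<in> measurable \<mu> \<nu>"
      unfolding measurable_cong_sets[OF haar_sets[OF haar] proj_sets] by (rule affine_pt_measurable)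
    show "emeasure \<nu> (B \<inter> affine_disc) = ennreal (q / (q + 1)) * emeasure \<mu> (affine_pt -` B \<inter> int_ring)"
      if "B \<in> sets \<nu>" for B
      using proj_emeasure_affine[of B] that by (simp add: q_def)
    show "real_cpowr \<beta> (spherical_dist (affine_pt x) (affine_pt y)) = 1 * real_cpowr \<beta> (absv (x - y))"
      if "x \<in> int_ring" "y \<in> int_ring" for x y :: 'k
      using that by (simp add: spherical_dist_affine_pt int_ring_def)
  qed (use q in auto)
  moreover have "has_partition_series \<nu> (- affine_disc) (\<lambda>p p'. real_cpowr \<beta> (spherical_dist p p')) N
    (Abs_fps (\<lambda>n. of_real (1 / (q + 1)) ^ n * real_cpowr \<beta> (1 / q) ^ (n choose 2) * fps_nth (Abs_fps a) n))"
  proof (rule has_partition_series_image[OF sf haar_sigma_finite[OF haar] _ fin R' _ _ _ meas _ A])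
    show "(\<lambda>x. infinite_pt (0 + uniformizer * x)) \<in> measurable \<mu> \<nu>"
      unfolding measurable_cong_sets[OF haar_sets[OF haar] proj_sets]
      by (rule measurable_compose[OF measurable_affine infinite_pt_measurable])
    show "emeasure \<nu> (B \<inter> - affine_disc) = ennreal (1 / (q + 1)) *
        emeasure \<mu> ((\<lambda>x. infinite_pt (0 + uniformizer * x)) -` B \<inter> int_ring)"
      if "B \<in> sets \<nu>" for B
      using proj_emeasure_infinite[of B] that by (simp add: q_def)
    show "real_cpowr \<beta> (spherical_dist (infinite_pt (0 + uniformizer * x)) (infinite_pt (0 + uniformizer * y))) =
        real_cpowr \<beta> (1 / q) * real_cpowr \<beta> (absv (x - y))"
      if "x \<in> int_ring" "y \<in> int_ring" for x y :: 'k
    proof -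
      have lt: "absv (0 + uniformizer * z) < 1" if "z \<in> int_ring" for z :: 'k
      proof -
        have "0 + uniformizer * z \<in> max_ideal" using that unfolding max_ideal_eq by auto
        then show ?thesis by (simp add: max_ideal_def)
      qed
      have "(0 + uniformizer * x) - (0 + uniformizer * y) = uniformizer * (x - y)" by (simp add: algebra_simps)
      then have "spherical_dist (infinite_pt (0 + uniformizer * x)) (infinite_pt (0 + uniformizer * y)) =
          1 / q * absv (x - y)"
        by (simp only: spherical_dist_infinite_pt[OF lt[OF that(1)] lt[OF that(2)]] absv_mult absv_uniformizer q_def)
      then show ?thesis using q real_cpowr_mult[of "1 / q" "absv (x - y)" \<beta>] by (simp add: absv_nonneg)
    qed
  qed (use q in auto)
  ultimately have "has_partition_series \<nu> (affine_disc \<union> - affine_disc) (\<lambda>p p'. real_cpowr \<beta> (spherical_dist p p')) N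
    (Abs_fps (\<lambda>n. of_real (q / (q + 1)) ^ n * 1 ^ (n choose 2) * fps_nth (Abs_fps a) n) *
     Abs_fps (\<lambda>n. of_real (1 / (q + 1)) ^ n * real_cpowr \<beta> (1 / q) ^ (n choose 2) * fps_nth (Abs_fps a) n))"
    by (intro has_partition_series_Un sf) (auto simp: spherical_dist_eq_chart)
  then show ?thesis by simp
qed

end

section \<open>Smoothness and the functional equations\<close>

text \<open>Numerator and denominator in the recurrence are both odd in \<open>t\<close>.\<close>

lemma recF_minus: "recF n (- t) \<beta> = recF n t \<beta>"
proof (induction n rule: less_induct)
  case (less n)
  show ?case
  proof (cases "2 \<le> n \<and> t \<noteq> 0")
    case True
    have neg: "sinh (of_real (- t) / 2 * z) = - sinh (of_real t / 2 * z)" for z :: complex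
      by (simp add: sinh_minus[symmetric] del: sinh_minus)
    show ?thesis
      using True unfolding recF_unfold[of n t, OF conjunct1[OF True] conjunct2[OF True]]
      by (subst recF_unfold; (intro sum.cong)?; simp only: neg; simp add: less.IH)
  next
    case False
    then consider "n \<le> 1" | "t = 0" by linarith
    then show ?thesis by cases (simp_all add: recF.simps)
  qed
qed

text \<open>Derivatives along the real axis are restrictions of complex derivatives, and these are
  analytic again, so the induction on the order of differentiation never leaves the class.\<close>

lemma smooth_on_if_analytic:
  assumes U: "open U" and g: "g analytic_on of_real ` U"
    and fg: "\<And>x. x \<in> U \<Longrightarrow> f x = g (of_real x)"
  shows "smooth_on U f"
proof -
  let ?D = "\<lambda>h y. vector_derivative h (at (y::real)) :: complex"
  have step: "(h has_vector_derivative deriv G (of_real x)) (at x)"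
    if "G analytic_on of_real ` U" "\<And>x. x \<in> U \<Longrightarrow> h x = G (of_real x)" "x \<in> U" for h :: "real \<Rightarrow> complex" and G x
  proof -
    have "G analytic_on {of_real x}" using that(1,3) by (meson analytic_on_subset empty_subsetI image_eqI insert_subset)
    then have "(G has_field_derivative deriv G (of_real x)) (at (of_real x))" by (rule analytic_derivI)
    then have "((\<lambda>y. G (of_real y)) has_vector_derivative deriv G (of_real x)) (at x)"
      by (rule has_vector_derivative_real_field)
    then show ?thesis
      using that U by (auto intro: has_vector_derivative_transform_within_open)
  qed
  have iter: "(deriv ^^ n) g analytic_on of_real ` U \<and> (\<forall>x\<in>U. (?D ^^ n) f x = (deriv ^^ n) g (of_real x))" for n
  proof (induction n)
    case (Suc n)
    have "(?D ^^ Suc n) f x = (deriv ^^ Suc n) g (of_real x)" if "x \<in> U" for x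
      using vector_derivative_at[OF step[of "(deriv ^^ n) g" "(?D ^^ n) f" x]] Suc that by simp
    moreover have "(deriv ^^ Suc n) g analytic_on of_real ` U" using Suc by (simp add: analytic_deriv)
    ultimately show ?case by blast
  qed (use g fg in simp)
  show ?thesis
    unfolding smooth_on_def
  proof (intro allI ballI)
    fix n x assume x: "x \<in> U"
    show "(?D ^^ n) f differentiable at x"
      using step[of "(deriv ^^ n) g" "(?D ^^ n) f" x] iter[of n] x by (blast intro: differentiableI_vector)
  qed
qed

text \<open>Replacing sinh (t c) / sinh (t d) by c sinhc (t c) / (d sinhc (t d)) brings the separate
  clause of the recurrence at \<open>t = 0\<close> under the same formula.\<close>

definition sinhc :: "complex \<Rightarrow> complex" where
  "sinhc z = (if z = 0 then 1 else sinh z / z)"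

lemma sinh_eq_mult_sinhc: "sinh z = z * sinhc z"
  by (simp add: sinhc_def)

lemma sinhc_analytic: "sinhc analytic_on S"
proof -
  have "sinh holomorphic_on (UNIV :: complex set)"
    by (intro analytic_imp_holomorphic analytic_intros)
  then have "(\<lambda>z. if z = 0 then deriv sinh 0 else (sinh z - sinh 0) / (z - 0)) holomorphic_on (UNIV :: complex set)"
    by (rule pole_lemma_open) simp
  moreover have "deriv sinh (0 :: complex) = 1"
    using DERIV_imp_deriv[OF has_field_derivative_sinh[OF DERIV_ident], of "0 :: complex"] by simp
  ultimately have "sinhc holomorphic_on UNIV" by (simp add: sinhc_def[abs_def] cong: if_cong)
  then have "sinhc analytic_on UNIV" by (simp add: analytic_on_open)
  then show ?thesis by (rule analytic_on_subset) simp
qed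

lemma sinhc_comp_analytic: "f analytic_on S \<Longrightarrow> (\<lambda>z. sinhc (f z)) analytic_on S"
  using analytic_on_compose[OF _ sinhc_analytic, of f S] by (simp add: o_def)

text \<open>The recurrence is read in a complex variable. Its denominators do not vanish on the real
  axis: \<open>d\<close> has positive real part, so \<open>sinh\<close> is nonzero at nonzero real
  multiples of \<open>d\<close>, and \<open>sinhc\<close> is 1 at 0.\<close>

lemma recF_analytic:
  assumes "\<And>m. 2 \<le> m \<Longrightarrow> m \<le> n \<Longrightarrow> Re \<beta> > - 2 / real m"
  shows "\<exists>g. g analytic_on \<real> \<and> (\<forall>t. recF n t \<beta> = g (of_real t))"
  using assms
proof (induction n rule: less_induct)
  case (less n)
  show ?case
  proof (cases "2 \<le> n")
    case False
    then show ?thesis by (intro exI[of _ "\<lambda>_. 1"]) (simp add: recF.simps)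
  next
    case True
    have "\<exists>g. g analytic_on \<real> \<and> (\<forall>t. recF k t \<beta> = g (of_real t))" if "k < n" for k
      using less.IH[OF that] less.prems that by simp
    then obtain G where G: "\<And>k. k < n \<Longrightarrow> G k analytic_on \<real>"
      "\<And>k t. k < n \<Longrightarrow> recF k t \<beta> = G k (of_real t)" by metis
    define c where "c k = recE n \<beta> * (1 - 2 * of_nat k / of_nat n) + 1" for k
    define d where "d = recE n \<beta> - 1"
    have d: "0 < Re d" using Re_recE_gt_1[OF True less.prems[OF True]] by (simp add: d_def)
    then have d0: "d \<noteq> 0" by auto
    have nz: "sinhc (of_real t / 2 * d) \<noteq> 0" for t
    proof (cases "t = 0")
      case False
      have "Re (of_real t / 2 * d) \<noteq> 0" using False d by simp
      then have "sinh (of_real t / 2 * d) \<noteq> 0" by (rule sinh_nonzero)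
      then show ?thesis by (simp add: sinh_eq_mult_sinhc)
    qed (simp add: sinhc_def)
    define g where "g z = (\<Sum>k\<in>{1..<n}. of_nat k / of_nat n *
        (c k * sinhc (z / 2 * c k) / (d * sinhc (z / 2 * d))) * G (n - k) z * G k z)" for z
    have "g analytic_on \<real>"
      unfolding g_def
    proof (intro analytic_on_sum analytic_on_mult analytic_on_divide analytic_on_const sinhc_comp_analytic analytic_on_ident)
      fix k z assume "k \<in> {1..<n}" "z \<in> (\<real> :: complex set)"
      then show "d * sinhc (z / 2 * d) \<noteq> 0" using d0 nz by (auto elim!: Reals_cases)
    qed (use G(1) in auto)
    moreover have "recF n t \<beta> = g (of_real t)" for t
    proof (cases "t = 0")
      case True
      have "recF n 0 \<beta> = (\<Sum>k\<in>{1..<n}. of_nat k / of_nat n * (c k / d) * recF (n - k) 0 \<beta> * recF k 0 \<beta>)"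
        using \<open>2 \<le> n\<close> by (subst recF.simps) (simp add: c_def d_def)
      also have "\<dots> = g (of_real 0)"
        unfolding g_def using d0 by (intro sum.cong refl) (auto simp: G(2) sinhc_def)
      finally show ?thesis using True by simp
    next
      case False
      have "recF n t \<beta> = (\<Sum>k\<in>{1..<n}. of_nat k / of_nat n *
          (sinh (of_real t / 2 * c k) / sinh (of_real t / 2 * d)) * recF (n - k) t \<beta> * recF k t \<beta>)"
        using recF_unfold[OF \<open>2 \<le> n\<close> False] by (simp add: c_def d_def)
      also have "\<dots> = g (of_real t)"
        unfolding g_def
      proof (rule sum.cong[OF refl])
        fix k assume k: "k \<in> {1..<n}"
        have "sinh (of_real t / 2 * c k) / sinh (of_real t / 2 * d) =
            c k * sinhc (of_real t / 2 * c k) / (d * sinhc (of_real t / 2 * d))"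
          using False d0 nz[of t] unfolding sinh_eq_mult_sinhc by (simp add: field_simps)
        then show "of_nat k / of_nat n * (sinh (of_real t / 2 * c k) / sinh (of_real t / 2 * d)) * recF (n - k) t \<beta> * recF k t \<beta> =
          of_nat k / of_nat n * (c k * sinhc (of_real t / 2 * c k) / (d * sinhc (of_real t / 2 * d))) * G (n - k) (of_real t) * G k (of_real t)"
          using k by (simp add: G(2))
      qed
      finally show ?thesis .
    qed
    ultimately show ?thesis by blast
  qed
qed

lemma smooth_on_comp_ln:
  assumes h: "h analytic_on \<real>" and f: "\<And>q. 0 < q \<Longrightarrow> f q = h (of_real (ln q))"
  shows "smooth_on {0<..} f"
proof (rule smooth_on_if_analytic)
  have "Ln analytic_on (of_real ` {0<..})"
    by (intro analytic_on_ln analytic_on_ident) (auto elim!: nonpos_Reals_cases)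
  moreover have "h analytic_on (Ln ` of_real ` {0<..})"
    by (rule analytic_on_subset[OF h]) (auto simp: Ln_of_real)
  ultimately show "h \<circ> Ln analytic_on of_real ` {0<..}" by (rule analytic_on_compose)
  show "f x = (h \<circ> Ln) (of_real x)" if "x \<in> {0<..}" for x
    using f that by (simp add: Ln_of_real)
qed simp

lemma of_real_powr_eq_exp: "0 < q \<Longrightarrow> complex_of_real q powr w = exp (w * of_real (ln q))"
  by (simp add: powr_def Ln_of_real)

lemma cosh_half_nonzero: "cosh (complex_of_real t / 2) \<noteq> 0"
proof -
  have "cosh (complex_of_real t / 2) = of_real (cosh (t / 2))"
    by (simp add: cosh_field_def exp_of_real[symmetric])
  then show ?thesis by (simp add: less_imp_neq[OF cosh_real_pos, symmetric])
qed

lemma Z_R_ext_smooth: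
  assumes "\<And>m. 2 \<le> m \<Longrightarrow> m \<le> N \<Longrightarrow> Re \<beta> > - 2 / real m"
  shows "smooth_on {0<..} (Z_R_ext N \<beta>)"
proof -
  obtain g where g: "g analytic_on \<real>" "\<And>t. recF N t \<beta> = g (of_real t)"
    using recF_analytic[OF assms] by blast
  show ?thesis
  proof (rule smooth_on_comp_ln)
    show "(\<lambda>z. fact N * exp (1 / 2 * of_nat (N choose 2) * \<beta> * z) * g z) analytic_on \<real>"
      by (intro analytic_intros g)
  qed (simp add: Z_R_ext_def of_real_powr_eq_exp g(2))
qed

lemma Z_P1_ext_smooth:
  assumes "\<And>m. 2 \<le> m \<Longrightarrow> m \<le> N \<Longrightarrow> Re \<beta> > - 2 / real m"
  shows "smooth_on {0<..} (Z_P1_ext N \<beta>)"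
proof -
  have "\<exists>g. g analytic_on \<real> \<and> (\<forall>t. recF k t \<beta> = g (of_real t))" if "k \<le> N" for k
    using recF_analytic[of k \<beta>] assms that by simp
  then obtain G where G: "\<And>k. k \<le> N \<Longrightarrow> G k analytic_on \<real>"
    "\<And>k t. k \<le> N \<Longrightarrow> recF k t \<beta> = G k (of_real t)" by metis
  show ?thesis
  proof (rule smooth_on_comp_ln)
    show "(\<lambda>z. fact N * (\<Sum>k\<in>{0..N}. cosh (z / 2 * recE N \<beta> * (1 - 2 * of_nat k / of_nat N)) /
       (2 * cosh (z / 2)) ^ N * G (N - k) z * G k z)) analytic_on \<real>"
    proof (intro analytic_on_sum analytic_on_mult analytic_on_divide analytic_on_power analytic_on_const
        analytic_on_cosh analytic_on_ident)
      fix k z assume "z \<in> (\<real> :: complex set)"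
      then show "(2 * cosh (z / 2)) ^ N \<noteq> 0" using cosh_half_nonzero by (auto elim!: Reals_cases)
    qed (use G(1) in auto)
  qed (simp add: Z_P1_ext_def G(2))
qed

text \<open>The recursive factor is even in log q, so only the prefactor changes.\<close>

lemma Z_R_ext_inverse:
  assumes "0 < q"
  shows "Z_R_ext N \<beta> (inverse q) = complex_of_real q powr (- (of_nat (N choose 2) * \<beta>)) * Z_R_ext N \<beta> q"
proof -
  let ?L = "complex_of_real (ln q)" and ?c = "of_nat (N choose 2) * \<beta>"
  have "exp (1 / 2 * of_nat (N choose 2) * \<beta> * - ?L) = exp (- ?c * ?L) * exp (1 / 2 * of_nat (N choose 2) * \<beta> * ?L)"
    by (simp add: exp_add[symmetric] field_simps)
  then show ?thesis
    using assms recF_minus[of N "ln q" \<beta>]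
    by (simp add: Z_R_ext_def of_real_powr_eq_exp[of "inverse q"] of_real_powr_eq_exp[of q] ln_inverse del: of_real_inverse)
qed

lemma Z_P1_ext_inverse:
  assumes "0 < q"
  shows "Z_P1_ext N \<beta> (inverse q) = Z_P1_ext N \<beta> q"
  using assms by (simp add: Z_P1_ext_def ln_inverse recF_minus cosh_minus)

text \<open>Averaging the sum with its reversal replaces the exponential by its even part.\<close>

lemma sum_exp_symmetrize:
  fixes g D :: "nat \<Rightarrow> complex"
  assumes "\<And>k. k \<le> N \<Longrightarrow> g (N - k) = g k" "\<And>k. k \<le> N \<Longrightarrow> D (N - k) = - D k"
  shows "(\<Sum>k=0..N. g k * exp (- D k)) = (\<Sum>k=0..N. g k * cosh (D k))"
proof -
  have "(\<Sum>k=0..N. g k * exp (- D k)) = (\<Sum>k=0..N. g (N - k) * exp (- D (N - k)))"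
    using sum.atLeastAtMost_rev[of "\<lambda>k. g k * exp (- D k)" 0 N] by simp
  also have "\<dots> = (\<Sum>k=0..N. g k * exp (D k))"
    using assms by (intro sum.cong) auto
  finally have "(\<Sum>k=0..N. g k * exp (- D k)) = ((\<Sum>k=0..N. g k * exp (D k)) + (\<Sum>k=0..N. g k * exp (- D k))) / 2"
    by simp
  also have "\<dots> = (\<Sum>k=0..N. g k * cosh (D k))"
    by (simp add: sum.distrib[symmetric] sum_divide_distrib cosh_field_def distrib_left add_divide_distrib)
  finally show ?thesis .
qed

text \<open>For the affine piece the half powers of q in the mass cancel those in \<open>a\<close>,
  leaving exp (L E_k / 2), where E_k is \<open>recE k \<beta>\<close>. For the other piece mass and
  kernel factor together reverse the sign, giving exp (- L E_(N-k) / 2). Symmetrising the product in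
  k yields the hyperbolic cosine.\<close>

lemma P1_coefficient:
  fixes q :: real and \<beta> :: complex
  assumes q: "1 < q" and N: "1 \<le> N"
  defines "L \<equiv> ln q"
  defines "a \<equiv> \<lambda>n. recF n L \<beta> * exp (of_real L * (recE n \<beta> - of_nat n) / 2)"
  shows "fact N * fps_nth (Abs_fps (\<lambda>n. of_real (q / (q + 1)) ^ n * 1 ^ (n choose 2) * a n) *
     Abs_fps (\<lambda>n. of_real (1 / (q + 1)) ^ n * real_cpowr \<beta> (1 / q) ^ (n choose 2) * a n)) N = Z_P1_ext N \<beta> q"
proof -
  let ?L = "complex_of_real L"
  define C where "C = 2 * cosh (?L / 2)"
  have C0: "C \<noteq> 0" using cosh_half_nonzero[of L] by (simp add: C_def)
  have qL: "complex_of_real q = exp ?L" using q by (simp add: L_def exp_of_real)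
  have q1: "exp (?L / 2) * C = complex_of_real (q + 1)"
  proof -
    have "C = exp (?L / 2) + exp (- (?L / 2))" by (simp add: C_def cosh_field_def)
    then have "exp (?L / 2) * C = exp (?L / 2) * exp (?L / 2) + exp (?L / 2) * exp (- (?L / 2))"
      by (simp only: distrib_left)
    also have "\<dots> = exp ?L + 1" unfolding exp_add[symmetric] by simp
    finally show ?thesis by (simp add: qL)
  qed
  have q1': "complex_of_real (q + 1) \<noteq> 0" using q by (metis add_pos_pos less_irrefl less_trans of_real_eq_0_iff zero_less_one)
  have c1: "complex_of_real (q / (q + 1)) = exp (?L / 2) / C"
  proof -
    have "complex_of_real (q / (q + 1)) = exp ?L / (exp (?L / 2) * C)" by (simp only: of_real_divide q1 qL)
    also have "exp ?L = exp (?L / 2) * exp (?L / 2)" by (simp add: exp_add[symmetric])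
    finally show ?thesis by simp
  qed
  have c2: "complex_of_real (1 / (q + 1)) = exp (- ?L / 2) / C"
    by (simp only: of_real_divide q1[symmetric]) (simp add: exp_minus field_simps)
  have s: "real_cpowr \<beta> (1 / q) = exp (- (\<beta> * ?L))"
    using q by (simp add: real_cpowr_def L_def ln_div)
  define g where "g k = recF (N - k) L \<beta> * recF k L \<beta> / C ^ N" for k
  define D where "D k = ?L / 2 * (recE (N - k) \<beta> - recE k \<beta>)" for k
  have summand: "of_real (q / (q + 1)) ^ k * 1 ^ (k choose 2) * a k *
      (of_real (1 / (q + 1)) ^ (N - k) * real_cpowr \<beta> (1 / q) ^ ((N - k) choose 2) * a (N - k)) = g k * exp (- D k)"
    if k: "k \<le> N" for k
  proof -
    let ?m = "N - k"
    have "of_real (q / (q + 1)) ^ k * 1 ^ (k choose 2) * a k *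
      (of_real (1 / (q + 1)) ^ ?m * real_cpowr \<beta> (1 / q) ^ (?m choose 2) * a ?m) =
      recF ?m L \<beta> * recF k L \<beta> / (C ^ k * C ^ ?m) * exp (of_nat k * (?L / 2) + ?L * (recE k \<beta> - of_nat k) / 2 +
        (of_nat ?m * (- ?L / 2) + of_nat (?m choose 2) * (- (\<beta> * ?L)) + ?L * (recE ?m \<beta> - of_nat ?m) / 2))"
      unfolding exp_add exp_of_nat_mult c1 c2 s a_def power_divide by simp
    also have "C ^ k * C ^ ?m = C ^ N" using k by (simp add: power_add[symmetric])
    also have "of_nat k * (?L / 2) + ?L * (recE k \<beta> - of_nat k) / 2 +
        (of_nat ?m * (- ?L / 2) + of_nat (?m choose 2) * (- (\<beta> * ?L)) + ?L * (recE ?m \<beta> - of_nat ?m) / 2) = - D k"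
      by (simp add: D_def recE_def field_simps)
    finally show ?thesis by (simp add: g_def)
  qed
  have "fact N * fps_nth (Abs_fps (\<lambda>n. of_real (q / (q + 1)) ^ n * 1 ^ (n choose 2) * a n) *
     Abs_fps (\<lambda>n. of_real (1 / (q + 1)) ^ n * real_cpowr \<beta> (1 / q) ^ (n choose 2) * a n)) N =
     fact N * (\<Sum>k=0..N. g k * exp (- D k))"
    unfolding fps_mult_nth fps_nth_Abs_fps by (intro arg_cong[of _ _ "(*) (fact N)"] sum.cong refl summand) simp
  also have "(\<Sum>k=0..N. g k * exp (- D k)) = (\<Sum>k=0..N. g k * cosh (D k))"
    by (rule sum_exp_symmetrize) (simp_all add: g_def D_def mult.commute minus_mult_right[symmetric] algebra_simps)
  also have "fact N * (\<Sum>k=0..N. g k * cosh (D k)) = Z_P1_ext N \<beta> q"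
    unfolding Z_P1_ext_def
  proof (intro arg_cong[of _ _ "(*) (fact N)"] sum.cong refl)
    fix k assume "k \<in> {0..N}"
    then have Dk: "D k = of_real (ln q) / 2 * recE N \<beta> * (1 - 2 * of_nat k / of_nat N)"
      using recE_diff[of k N \<beta>] N by (simp add: D_def L_def)
    then show "g k * cosh (D k) = cosh (of_real (ln q) / 2 * recE N \<beta> * (1 - 2 * of_nat k / of_nat N)) /
       (2 * cosh (of_real (ln q) / 2)) ^ N * recF (N - k) (ln q) \<beta> * recF k (ln q) \<beta>"
      unfolding Dk[symmetric] by (simp add: g_def C_def L_def)
  qed
  finally show ?thesis .
qed

theorem theorem2p5:
  fixes \<mu> :: "'k::nonarch_local_field measure"
    and \<nu> :: "'k proj_line measure"
    and N :: nat
    and \<beta> :: complex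
  assumes "is_normalized_haar \<mu>"
    and "is_PGL2_invariant_prob \<nu>"
    and "N \<ge> 2"
    and "Re \<beta> > - 2 / real N"
  shows
    "set_integrable (\<Pi>\<^sub>M i\<in>{1..N}. \<mu>) (\<Pi>\<^sub>E i\<in>{1..N}. int_ring) (integrand_R N \<beta>) \<and>
     integrable (\<Pi>\<^sub>M i\<in>{1..N}. \<nu>) (integrand_P1 N \<beta>) \<and>
     Z_R \<mu> N \<beta> = Z_R_ext N \<beta> (real (residue_card TYPE('k))) \<and>
     Z_P1 \<nu> N \<beta> = Z_P1_ext N \<beta> (real (residue_card TYPE('k))) \<and>
     smooth_on {0<..} (Z_R_ext N \<beta>) \<and>
     smooth_on {0<..} (Z_P1_ext N \<beta>) \<and>
     (\<forall>q>0. Z_R_ext N \<beta> (inverse q) =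
        complex_of_real q powr (- (of_nat (N choose 2) * \<beta>)) * Z_R_ext N \<beta> q) \<and>
     (\<forall>q>0. Z_P1_ext N \<beta> (inverse q) = Z_P1_ext N \<beta> q)"
proof -
  let ?q = "real (residue_card TYPE('k))"
  let ?I = "{1..N}"
  have q: "1 < ?q" using residue_card_gt_1[where 'a = 'k] by simp
  have \<beta>: "Re \<beta> > - 2 / real n" if "2 \<le> n" "n \<le> N" for n
    using exponent_bound_mono[OF assms(4) that] .
  \<comment> \<open>Absolute convergence and the value of the integral are obtained in one
    statement.\<close>
  have R: "has_bochner_integral (\<Pi>\<^sub>M i\<in>?I. \<mu>)
      (\<lambda>x. indicator (\<Pi>\<^sub>E i\<in>?I. int_ring) x *\<^sub>R integrand_R N \<beta> x) (Z_R_ext N \<beta> ?q)"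
  proof -
    have "has_bochner_integral (\<Pi>\<^sub>M i\<in>?I. \<mu>)
        (restricted_pair_prod int_ring (\<lambda>x y. real_cpowr \<beta> (absv (x - y))) ?I)
        (fact N * (recF N (ln ?q) \<beta> * exp (of_real (ln ?q) * (recE N \<beta> - of_nat N) / 2)))"
      using has_partition_seriesD[OF partition_series_R[OF assms(1) \<beta>], of N ?I] by simp
    moreover have "fact N * (recF N (ln ?q) \<beta> * exp (of_real (ln ?q) * (recE N \<beta> - of_nat N) / 2)) = Z_R_ext N \<beta> ?q"
      unfolding Z_R_ext_def of_real_powr_eq_exp[OF less_trans[OF zero_less_one q]] recE_def by (simp add: mult_ac)
    \<comment> \<open>Restricted to the space of the product measure, since the indicator on the
      right also tests extensionality.\<close>
    moreover have "restricted_pair_prod int_ring (\<lambda>x y. real_cpowr \<beta> (absv (x - y))) ?I x =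
        indicator (\<Pi>\<^sub>E i\<in>?I. int_ring) x *\<^sub>R integrand_R N \<beta> x" if "x \<in> space (\<Pi>\<^sub>M i\<in>?I. \<mu>)" for x
    proof -
      have "integrand_R N \<beta> x = pair_prod (\<lambda>x y. real_cpowr \<beta> (absv (x - y))) ?I x"
        by (simp add: integrand_R_def pair_prod_def pairs_eq_ordered_pairs real_cpowr_eq absv_nonneg)
      moreover have "indicator (\<Pi>\<^sub>E i\<in>?I. int_ring) x = (\<Prod>i\<in>?I. indicator int_ring (x i) :: real)"
        using that by (auto simp: prod_indicator_eq space_PiM PiE_def Pi_def indicator_def)
      ultimately show ?thesis by (simp add: restricted_pair_prod_def scaleR_prod_indicator_mult)
    qed
    ultimately show ?thesis by (simp cong: has_bochner_integral_cong)
  qed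
  have P1: "has_bochner_integral (\<Pi>\<^sub>M i\<in>?I. \<nu>) (integrand_P1 N \<beta>) (Z_P1_ext N \<beta> ?q)"
  proof -
    have eq: "restricted_pair_prod UNIV (\<lambda>p p'. real_cpowr \<beta> (spherical_dist p p')) ?I = integrand_P1 N \<beta>"
      by (simp add: fun_eq_iff restricted_pair_prod_def pair_prod_def integrand_P1_def pairs_eq_ordered_pairs
          real_cpowr_eq spherical_dist_nonneg)
    have "1 \<le> N" using assms(3) by simp
    note coeff = P1_coefficient[OF q this, of \<beta>]
    have "finite ?I" "card ?I = N" by simp_all
    from has_partition_seriesD[OF partition_series_P1[OF assms(1,2) \<beta>] this]
    show ?thesis unfolding eq coeff .
  qed
  show ?thesis
    using R P1 Z_R_ext_smooth[OF \<beta>] Z_P1_ext_smooth[OF \<beta>] Z_R_ext_inverse Z_P1_ext_inverse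
    by (simp add: has_bochner_integral_iff set_integrable_def Z_R_def Z_P1_def set_lebesgue_integral_def)
qed

end
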